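(* Let $T$ be sufficiently large and let $x>1$ satisfy $\log x\le(\log_2T)^2/(\log_3T)^2$. Then for every real $\theta$ with $|\theta|\le\pi$ there is a set of $t\in[1,T]$ of Lebesgue measure at least $T^{1-2/\log x}$ such that for all $t$ in this set $$\sum_{n\le x}n^{\mathrm{i}t}=x\,\mathrm{e}^{\mathrm{i}\theta}\rho\bigg(\frac{\log x}{\log_2T}\bigg)\bigg(1+O\bigg(\frac{1}{\log x}+\frac{\log x(\log_3T)^2}{(\log_2T)^2}\bigg)\bigg).$$
   Context: $\log_2=\log\log$, $\log_3=\log\log\log$. $\rho$ denotes the Dickman function: $\rho(u)=1$ for $0\le u\le 1$ and $u\rho'(u)=-\rho(u-1)$ for $u>1$, $\rho$ continuous. *)

theory Defs
  imports "HOL-Analysis.Analysis"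
begin

definition dickman_rho :: "real \<Rightarrow> real" where
  "dickman_rho = (THE f. (\<forall>u<0. f u = 0) \<and> (\<forall>u\<in>{0..1}. f u = 1)
      \<and> continuous_on {0..} f
      \<and> (\<forall>u>1. (f has_real_derivative (- f (u - 1) / u)) (at u)))"

end

theory Submission
  imports Defs "HOL-Number_Theory.Prime_Powers" "HOL-Real_Asymp.Real_Asymp"
begin

text \<open>
  Write $L = \log\log T$, let $k$ be about $\log T / L^{10}$, and let $\Psi(x,k)$ count the
  $k$-smooth integers up to $x$.

  Resonance: let $R(t) = \sum_{d \mid Q} d^{\mathrm{i}t}$ with $Q = (k!)^N$. For smooth $n$ almost every
  divisor $d$ of $Q$ has $nd \mid Q$, so $n^{\mathrm{i}t} \approx 1$ in mean square with respect
  to the weight $|R(t)|^2$, while the terms with non-smooth $n$ are nearly orthogonal and contribute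
  little. Translating $t$ by $\theta / \log x$ turns the main term $\Psi(x,k)$ into
  $\mathrm{e}^{\mathrm{i}\theta} \Psi(x,k)$, because most smooth integers lie near $x$. Since $|R|^2$ is
  at most the square of the number of divisors, and $Q$ is a small power of $T$, Chebyshev's
  inequality yields the required measure.

  Smooth numbers: $\Psi(x,\mathrm{e}^J)$ is compared with $x \rho(\log x / L')$ by induction on $x$ through
  $\sum \log n = \sum_d \Lambda(d) \Psi(x/d)$. Moving $L'$ away from $J$ by a constant creates a slack that
  absorbs the error in Mertens' theorem, so the prime number theorem is not needed.

  Dickman function: $-\rho'/\rho$ is increasing and $O(\log u)$. Hence replacing $L$ by
  $L + O(\log L)$ in $\rho(\log x / L)$ costs a relative error
  $O(\log x (\log L)^2 / L^2)$, which is the second error term of the theorem.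
\<close>

section \<open>The Dickman function\<close>

text \<open>The parameters are forced by orders of magnitude. Put s = log x <= L^2 and let r be the
  Dickman value. The deviation allowed in Chebyshev's inequality is x r / s, so the mean square loss
  from bad divisors, about s (x r)^2 / N, must be below a small multiple of (x r / s)^2. Hence N is
  of order L^6. With k about log T / L^10 this gives log Q <= N k log k of order log T / L^3, which
  is below the 2 log T / log x that the measure T^(1 - 2 / log x) permits. Smaller arguments are
  always reached through \<rho>(log z / L) <= \<rho>(log x / L) (x / z)^(1/4). The weight 1 / d then
  becomes d^(-3/4), whose square is still summable; this controls both the proper prime powers and
  the rough parts of integers. Counting and Dickman function satisfy parallel equations: u \<rho>(u)
  is the integral of \<rho> over [u - 1, u], and the sum of log n over smooth n is the sum of
  \<Lambda>(d) Psi(x / d). Mertens' theorem passes from one to the other. The induction carries a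
  plain inequality at a shifted scale instead of an error term, so nothing accumulates over its
  steps.\<close>

definition dickman_spec :: "(real \<Rightarrow> real) \<Rightarrow> bool" where
  "dickman_spec f \<longleftrightarrow> (\<forall>u<0. f u = 0) \<and> (\<forall>u\<in>{0..1}. f u = 1) \<and> continuous_on {0..} f
      \<and> (\<forall>u>1. (f has_real_derivative (- f (u - 1) / u)) (at u))"

text \<open>Picard iteration for the integrated delay equation, started at the constant 1. Because
  of the delay, each iteration makes the function final on one more unit interval:
  \<open>dickman_iter n\<close> no longer changes for arguments up to n + 1.\<close>

primrec dickman_iter :: "nat \<Rightarrow> real \<Rightarrow> real" where
  "dickman_iter 0 u = 1"
| "dickman_iter (Suc n) u =
     (if u \<le> 1 then 1 else 1 - integral {1..u} (\<lambda>t. dickman_iter n (t - 1) / t))"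

lemma dickman_iter_le_1: "u \<le> 1 \<Longrightarrow> dickman_iter n u = 1"
  by (cases n) auto

lemma dickman_iter_Suc_ge_1:
  "u \<ge> 1 \<Longrightarrow> dickman_iter (Suc n) u = 1 - integral {1..u} (\<lambda>t. dickman_iter n (t - 1) / t)"
  by (cases "u = 1") auto

lemma continuous_on_dickman_iter: "continuous_on A (dickman_iter n)"
proof -
  have "continuous_on UNIV (dickman_iter n)"
  proof (induction n)
    case (Suc n)
    have *: "continuous_on {1..b} (\<lambda>t. dickman_iter n (t - 1) / t)" for b
      by (intro continuous_intros continuous_on_compose2[OF Suc]) auto
    have c1: "continuous_on {1..b} (dickman_iter (Suc n))" for b
    proof -
      have "continuous_on {1..b} (\<lambda>u. 1 - integral {1..u} (\<lambda>t. dickman_iter n (t - 1) / t))"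
        by (intro continuous_intros indefinite_integral_continuous_1 integrable_continuous_real *)
      thus ?thesis
        by (rule continuous_on_eq) (use dickman_iter_Suc_ge_1 in auto)
    qed
    have c2: "continuous_on {..1} (dickman_iter (Suc n))"
      by (rule continuous_on_eq[OF continuous_on_const[of _ 1]]) auto
    have "isCont (dickman_iter (Suc n)) x" for x
    proof -
      have "continuous_on ({..1} \<union> {1..x+2}) (dickman_iter (Suc n))"
        by (intro continuous_on_closed_Un c1 c2) auto
      moreover have "{..<x+2} \<subseteq> {..1} \<union> {1..x+2}" by auto
      ultimately have "continuous_on {..<x+2} (dickman_iter (Suc n))"
        using continuous_on_subset by blast
      thus ?thesis
        by (subst (asm) continuous_on_eq_continuous_at) auto
    qed
    thus ?case by (simp add: continuous_at_imp_continuous_on del: dickman_iter.simps)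
  qed simp
  thus ?thesis by (rule continuous_on_subset) auto
qed

lemma dickman_iter_deriv:
  assumes "u > 1"
  shows "(dickman_iter (Suc n) has_real_derivative (- dickman_iter n (u - 1) / u)) (at u)"
proof -
  let ?g = "\<lambda>t. dickman_iter n (t - 1) / t"
  have c: "continuous_on {1..u+1} ?g"
    by (intro continuous_intros continuous_on_compose2[OF continuous_on_dickman_iter[of UNIV]]) auto
  have "((\<lambda>v. integral {1..v} ?g) has_real_derivative ?g u) (at u within {1..u+1})"
    by (rule integral_has_real_derivative[OF c]) (use assms in auto)
  hence "((\<lambda>v. integral {1..v} ?g) has_real_derivative ?g u) (at u)"
    using at_within_interior[of u "{1..u+1}"] assms by (simp add: interior_atLeastAtMost_real)
  hence "((\<lambda>v. 1 - integral {1..v} ?g) has_real_derivative (- ?g u)) (at u)"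
    by (auto intro!: derivative_eq_intros)
  moreover have "\<forall>\<^sub>F v in nhds u. dickman_iter (Suc n) v = 1 - integral {1..v} ?g"
    using eventually_nhds_in_open[of "{1<..}" u] assms
    by (auto elim!: eventually_mono)
  ultimately show ?thesis
    by (subst DERIV_cong_ev[OF refl _ refl]) auto
qed

text \<open>The integrand at t only sees the previous iterate at t - 1, so agreement up to n + 1
  propagates to agreement up to n + 2.\<close>

lemma dickman_iter_Suc_eq: "u \<le> real n + 1 \<Longrightarrow> dickman_iter (Suc n) u = dickman_iter n u"
proof (induction n arbitrary: u)
  case (Suc n)
  show ?case
  proof (cases "u \<le> 1")
    case False
    have "integral {1..u} (\<lambda>t. dickman_iter (Suc n) (t - 1) / t)
        = integral {1..u} (\<lambda>t. dickman_iter n (t - 1) / t)"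
    proof (rule integral_cong)
      fix t assume "t \<in> {1..u}"
      thus "dickman_iter (Suc n) (t - 1) / t = dickman_iter n (t - 1) / t"
        using Suc.IH[of "t - 1"] Suc.prems by (simp del: dickman_iter.simps)
    qed
    with False show ?thesis
      by (metis dickman_iter.simps(2))
  qed (simp add: dickman_iter_le_1)
qed (auto simp: dickman_iter_le_1)

lemma dickman_iter_eq: "m \<le> n \<Longrightarrow> u \<le> real m + 1 \<Longrightarrow> dickman_iter n u = dickman_iter m u"
proof (induction n)
  case (Suc n)
  show ?case
  proof (cases "m = Suc n")
    case False
    with Suc.prems have "m \<le> n" by simp
    with Suc show ?thesis using dickman_iter_Suc_eq[of u n] by simp
  qed auto
qed auto

lemma dickman_spec_exists: "\<exists>f. dickman_spec f"
proof -
  \<comment> \<open>The iterates are glued along the diagonal. By \<open>dickman_iter_eq\<close> any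
    later iterate gives the same value, so near each positive point f coincides with one fixed
    iterate and inherits its continuity and derivative.\<close>
  define f where "f = (\<lambda>u. if u < 0 then 0 else dickman_iter (nat \<lceil>u\<rceil>) u)"
  have f_eq: "f u = dickman_iter n u" if "u \<ge> 0" "u \<le> real n" for u n
  proof -
    have "nat \<lceil>u\<rceil> \<le> n" "u \<le> real (nat \<lceil>u\<rceil>)" using that by linarith+
    moreover from this have "dickman_iter n u = dickman_iter (nat \<lceil>u\<rceil>) u"
      by (intro dickman_iter_eq) auto
    ultimately show ?thesis using that by (simp add: f_def)
  qed
  have ev: "\<forall>\<^sub>F v in nhds u. f v = dickman_iter n v" if "u > 0" "u < real n" for u n
    using eventually_nhds_in_open[of "{0<..<real n}" u] that f_eq
    by (auto elim!: eventually_mono)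
  have "continuous_on {0..real n} f" for n
    by (rule continuous_on_eq[OF continuous_on_dickman_iter[of _ n]]) (use f_eq in auto)
  hence "continuous (at u within {0..}) f" if "u \<ge> 0" for u
  proof -
    obtain n where n: "u < real n" using reals_Archimedean2 by blast
    have "continuous (at u within {0..real n}) f"
      using \<open>\<And>n. continuous_on {0..real n} f\<close>[of n] n that
      by (simp add: continuous_on_eq_continuous_within)
    moreover have "at u within {0..real n} = at u within {0..}"
      by (rule at_within_nhd[of _ "{..<real n}"]) (use n in auto)
    ultimately show ?thesis by simp
  qed
  hence "continuous_on {0..} f" by (simp add: continuous_on_eq_continuous_within)
  moreover have "(f has_real_derivative (- f (u - 1) / u)) (at u)" if "u > 1" for u
  proof -
    obtain n where n: "u < real n" using reals_Archimedean2 by blast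
    have "(dickman_iter (Suc n) has_real_derivative (- dickman_iter n (u - 1) / u)) (at u)"
      using dickman_iter_deriv that .
    moreover have "f (u - 1) = dickman_iter n (u - 1)" using f_eq that n by simp
    moreover have "\<forall>\<^sub>F v in nhds u. f v = dickman_iter (Suc n) v"
      by (rule ev) (use that n in auto)
    ultimately show ?thesis by (subst DERIV_cong_ev[OF refl _ refl]) auto
  qed
  moreover have "f u = 1" if "u \<in> {0..1}" for u
    using that by (simp add: f_def dickman_iter_le_1)
  moreover have "f u = 0" if "u < 0" for u using that by (simp add: f_def)
  ultimately show ?thesis unfolding dickman_spec_def by blast
qed

text \<open>Method of steps: if f and g agree up to n, the delay equation gives their difference
  zero derivative on the next unit interval. The prescribed value 0 for negative arguments settles
  the rest of the real line.\<close>

lemma dickman_spec_unique: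
  assumes "dickman_spec f" "dickman_spec g"
  shows "f = g"
proof
  fix u
  note F = assms(1)[unfolded dickman_spec_def] and G = assms(2)[unfolded dickman_spec_def]
  have "f u = g u" if "u \<le> real n" for n u
    using that
  proof (induction n arbitrary: u)
    case 0
    thus ?case using F G by (cases "u = 0") auto
  next
    case (Suc n)
    show ?case
    proof (cases "u \<le> real n \<or> u \<le> 1")
      case True
      thus ?thesis
      proof
        assume "u \<le> 1"
        thus ?thesis using F G by (cases "u < 0") auto
      qed (use Suc.IH in auto)
    next
      case False
      \<comment> \<open>The differential equation holds only beyond 1, so the first step starts at 1
        rather than at 0.\<close>
      define m where "m = max 1 (real n)"
      have "(\<lambda>v. f v - g v) u = (\<lambda>v. f v - g v) m"
      proof (rule DERIV_isconst_end[of m u "\<lambda>v. f v - g v"])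
        show "continuous_on {m..u} (\<lambda>v. f v - g v)"
          by (rule continuous_on_diff; rule continuous_on_subset[of "{0..}"])
             (use F G m_def in auto)
        fix x assume "m < x" "x < u"
        hence x: "x > 1" "x - 1 \<le> real n" using Suc.prems by (auto simp: m_def)
        have "((\<lambda>v. f v - g v) has_real_derivative (- f (x - 1) / x - (- g (x - 1) / x))) (at x)"
          by (intro DERIV_diff) (use F G x in auto)
        thus "((\<lambda>v. f v - g v) has_real_derivative 0) (at x)"
          using Suc.IH[OF x(2)] by simp
      qed (use False in \<open>auto simp: m_def\<close>)
      moreover have "f m = g m"
        using F G Suc.IH[of "real n"] by (auto simp: m_def max_def)
      ultimately show ?thesis by simp
    qed
  qed
  moreover obtain n where "u \<le> real n" using real_arch_simple by blast
  ultimately show "f u = g u" by blast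
qed

lemma dickman_spec_rho: "dickman_spec dickman_rho"
proof -
  have "dickman_rho = (THE f. dickman_spec f)"
    unfolding dickman_rho_def dickman_spec_def ..
  moreover have "\<exists>!f. dickman_spec f"
    using dickman_spec_exists dickman_spec_unique by blast
  ultimately show ?thesis using theI'[of dickman_spec] by simp
qed

lemma rho_le_1: "0 \<le> u \<Longrightarrow> u \<le> 1 \<Longrightarrow> dickman_rho u = 1"
  and continuous_on_rho: "A \<subseteq> {0..} \<Longrightarrow> continuous_on A dickman_rho"
  and rho_deriv: "u > 1 \<Longrightarrow> (dickman_rho has_real_derivative (- dickman_rho (u - 1) / u)) (at u)"
  using dickman_spec_rho continuous_on_subset[of "{0..}" dickman_rho A]
  unfolding dickman_spec_def by auto

section \<open>The averaging identity, positivity and monotonicity\<close>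

lemma rho_integrable: "a \<ge> 0 \<Longrightarrow> dickman_rho integrable_on {a..b}"
  by (intro integrable_continuous_real continuous_on_rho) auto

lemma rho_integral_deriv:
  assumes "u > a" "a \<ge> 0"
  shows "((\<lambda>v. integral {a..v} dickman_rho) has_real_derivative dickman_rho u) (at u)"
proof -
  have "((\<lambda>v. integral {a..v} dickman_rho) has_real_derivative dickman_rho u) (at u within {a..u+1})"
    by (rule integral_has_real_derivative) (use assms in \<open>auto intro!: continuous_on_rho\<close>)
  thus ?thesis
    using at_within_interior[of u "{a..u+1}"] assms by (simp add: interior_atLeastAtMost_real)
qed

lemma rho_integral_continuous:
  assumes "a \<ge> 0"
  shows "continuous_on {a..b} (\<lambda>v. integral {a..v} dickman_rho)"
  by (intro indefinite_integral_continuous_1 rho_integrable assms)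

text \<open>Both sides have derivative \<rho>(u) - \<rho>(u - 1) for u > 1 and equal 1 at u = 1.
  This form has a positive kernel, which the differential equation hides.\<close>

lemma rho_integral:
  assumes "u \<ge> 1"
  shows "u * dickman_rho u = integral {u-1..u} dickman_rho"
proof (cases "u = 1")
  case True
  have "integral {0..1} dickman_rho = integral {0..1::real} (\<lambda>_. 1::real)"
    by (rule integral_cong) (auto simp: rho_le_1)
  thus ?thesis using True by (simp add: rho_le_1)
next
  case False
  define I where "I = (\<lambda>v. integral {0..v} dickman_rho)"
  define h where "h = (\<lambda>v. v * dickman_rho v - (I v - I (v - 1)))"
  have split: "integral {v-1..v} dickman_rho = I v - I (v - 1)" if "v \<ge> 1" for v
    using Henstock_Kurzweil_Integration.integral_combine[of 0 "v-1" v dickman_rho] that rho_integrable[of 0 v]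
    unfolding I_def by simp
  have "h u = h 1"
  proof (rule DERIV_isconst_end[of 1 u h])
    show "1 < u" using assms False by simp
    have c: "continuous_on {0..u} I" unfolding I_def by (rule rho_integral_continuous) simp
    have "continuous_on {1..u} I" by (rule continuous_on_subset[OF c]) auto
    moreover have "continuous_on {1..u} (\<lambda>v. I (v - 1))"
      by (rule continuous_on_compose2[OF c]) (auto intro: continuous_on_diff continuous_on_id)
    ultimately show "continuous_on {1..u} h" unfolding h_def
      by (intro continuous_intros continuous_on_rho) auto
    fix v assume v: "1 < v" "v < u"
    have "(I has_real_derivative dickman_rho v) (at v)"
      unfolding I_def by (rule rho_integral_deriv) (use v in auto)
    moreover have "((\<lambda>v. I (v - 1)) has_real_derivative dickman_rho (v - 1)) (at v)"
    proof -
      have "(I has_real_derivative dickman_rho (v - 1)) (at (v + -1))"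
        using rho_integral_deriv[of 0 "v - 1"] v unfolding I_def by simp
      thus ?thesis using DERIV_shift[of I "dickman_rho (v - 1)" v "-1"] by simp
    qed
    moreover have "((\<lambda>v. v * dickman_rho v) has_real_derivative
        (1 * dickman_rho v + - dickman_rho (v - 1) / v * v)) (at v)"
      by (rule DERIV_mult[OF DERIV_ident rho_deriv]) (use v in simp)
    ultimately have "(h has_real_derivative (1 * dickman_rho v + - dickman_rho (v - 1) / v * v)
        - (dickman_rho v - dickman_rho (v - 1))) (at v)"
      unfolding h_def by (intro DERIV_diff)
    thus "(h has_real_derivative 0) (at v)" using v by simp
  qed
  moreover have "h 1 = 0"
  proof -
    have "I 1 = integral {0..1::real} (\<lambda>_. 1::real)"
      unfolding I_def by (rule integral_cong) (auto simp: rho_le_1)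
    thus ?thesis by (simp add: h_def rho_le_1 I_def)
  qed
  ultimately show ?thesis using split[of u] assms by (simp add: h_def)
qed

text \<open>At a first point z with a nonpositive value, \<open>rho_integral\<close> would express z
  \<rho>(z) as an integral over [z - 1, z] of values that are positive before z.\<close>

lemma rho_pos:
  assumes "u \<ge> 0"
  shows "dickman_rho u > 0"
proof (rule ccontr)
  assume neg: "\<not> dickman_rho u > 0"
  define Z where "Z = {0..u} \<inter> dickman_rho -` {..0}"
  have "closed Z"
    unfolding Z_def by (intro continuous_closed_preimage continuous_on_rho) auto
  moreover have "u \<in> Z" using neg assms by (auto simp: Z_def)
  moreover have bdd: "bdd_below Z" by (auto simp: Z_def bdd_below_def)
  ultimately have z: "Inf Z \<in> Z" using closed_contains_Inf by blast
  define z where "z = Inf Z"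
  have z1: "z > 1" using z rho_le_1[of z] by (auto simp: Z_def z_def not_le[symmetric])
  have pos: "dickman_rho v > 0" if "0 \<le> v" "v < z" for v
    using cInf_lower[OF _ bdd, of v] that z by (fastforce simp: Z_def z_def)
  have "integral {z-1..z-1} dickman_rho < integral {z-1..z} dickman_rho"
  proof (rule DERIV_pos_imp_increasing_open[of "z-1" z "\<lambda>b. integral {z-1..b} dickman_rho"])
    show "continuous_on {z - 1..z} (\<lambda>b. integral {z - 1..b} dickman_rho)"
      by (rule rho_integral_continuous) (use z1 in auto)
    fix x assume "z - 1 < x" "x < z"
    thus "\<exists>y. ((\<lambda>b. integral {z - 1..b} dickman_rho) has_real_derivative y) (at x) \<and> 0 < y"
      using rho_integral_deriv[of "z-1" x] pos[of x] z1 by auto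
  qed auto
  hence "z * dickman_rho z > 0" using rho_integral[of z] z1 by simp
  moreover have "dickman_rho z \<le> 0" using z by (auto simp: Z_def z_def)
  ultimately show False using z1 by (simp add: zero_less_mult_iff)
qed

lemma rho_antimono:
  assumes "0 \<le> u" "u \<le> v"
  shows "dickman_rho v \<le> dickman_rho u"
proof -
  have *: "dickman_rho v \<le> dickman_rho u" if "1 \<le> u" "u \<le> v" for u v
  proof (rule DERIV_nonpos_imp_decreasing_open[of u v dickman_rho, OF that(2)])
    fix x assume "u < x" "x < v"
    thus "\<exists>y. (dickman_rho has_real_derivative y) (at x) \<and> y \<le> 0"
      using rho_deriv[of x] rho_pos[of "x - 1"] that by (intro exI conjI) auto
  qed (use that in \<open>auto intro!: continuous_on_rho\<close>)
  show ?thesis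
    using *[of u v] *[of 1 v] assms rho_le_1[of u] rho_le_1[of v] rho_le_1[of 1]
    by (cases "u \<le> 1"; cases "v \<le> 1") auto
qed

lemma rho_bounds: "u \<ge> 0 \<Longrightarrow> dickman_rho u \<le> 1"
  using rho_antimono[of 0 u] rho_le_1[of 0] by simp

section \<open>The logarithmic derivative of the Dickman function\<close>

text \<open>This is -\<rho>'/\<rho> for u > 1, with \<rho>' eliminated by the delay equation; in
  this form it extends continuously to u = 1.\<close>

definition rho_rate :: "real \<Rightarrow> real" where
  "rho_rate u = dickman_rho (u - 1) / (u * dickman_rho u)"

lemma rho_deriv_rate: "u > 1 \<Longrightarrow> (dickman_rho has_real_derivative (- rho_rate u * dickman_rho u)) (at u)"
  using rho_deriv[of u] rho_pos[of u] by (simp add: rho_rate_def)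

lemma continuous_on_rho_rate: "A \<subseteq> {1..} \<Longrightarrow> continuous_on A rho_rate"
  unfolding rho_rate_def using rho_pos
  by (intro continuous_intros continuous_on_rho continuous_on_compose2[OF continuous_on_rho[of "{0..}"]])
     (auto simp: less_imp_neq[THEN not_sym] subset_iff dest!: bspec)

text \<open>Here \<rho>(u - 1) = 1, so the rate is 1 / (u \<rho>(u)), and u \<rho>(u) decreases
  because its derivative is \<rho>(u) - 1 < 0. The interval is treated apart since \<rho>(u - 1) has
  a corner at u = 2.\<close>

lemma rho_rate_less_on_1_2:
  assumes "1 \<le> u" "u < v" "v \<le> 2"
  shows "rho_rate u < rho_rate v"
proof -
  have r: "rho_rate w = 1 / (w * dickman_rho w)" if "1 \<le> w" "w \<le> 2" for w
    using that rho_le_1[of "w - 1"] by (simp add: rho_rate_def)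
  have "v * dickman_rho v < u * dickman_rho u"
  proof (rule DERIV_neg_imp_decreasing_open[of u v "\<lambda>x. x * dickman_rho x", OF assms(2)])
    fix x assume x: "u < x" "x < v"
    have "((\<lambda>x. x * dickman_rho x) has_real_derivative (dickman_rho x - 1)) (at x)"
      using x assms rho_le_1[of "x-1"]
      by (auto intro!: derivative_eq_intros rho_deriv)
    moreover have "dickman_rho x < dickman_rho 1"
    proof (rule DERIV_neg_imp_decreasing_open[of 1 x dickman_rho])
      fix w assume w: "1 < w" "w < x"
      have "- dickman_rho (w - 1) / w < 0" using w rho_pos[of "w-1"] by simp
      thus "\<exists>y. (dickman_rho has_real_derivative y) (at w) \<and> y < 0"
        using rho_deriv[of w] w by blast
    qed (use x assms in \<open>auto intro!: continuous_on_rho\<close>)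
    ultimately show "\<exists>y. ((\<lambda>x. x * dickman_rho x) has_real_derivative y) (at x) \<and> y < 0"
      using rho_le_1[of 1] by auto
  qed (use assms in \<open>auto intro!: continuous_intros continuous_on_rho\<close>)
  thus ?thesis using assms r[of u] r[of v] rho_pos[of v]
    by (simp add: frac_less2)
qed

text \<open>The derivative is arranged as a positive factor times one bracket, so that the bracket
  alone decides monotonicity.\<close>

lemma rho_rate_has_derivative:
  assumes "u > 2"
  shows "(rho_rate has_real_derivative
     rho_rate u / (u * dickman_rho u) * (dickman_rho (u - 1) - dickman_rho u - rho_rate (u - 1) * (u * dickman_rho u))) (at u)"
proof -
  have 1: "((\<lambda>v. dickman_rho (v - 1)) has_real_derivative (- rho_rate (u - 1) * dickman_rho (u - 1))) (at u)"
    using DERIV_shift[of dickman_rho "- rho_rate (u - 1) * dickman_rho (u - 1)" u "-1"] rho_deriv_rate[of "u - 1"] assms by simp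
  have p: "dickman_rho u > 0" "dickman_rho (u-1) > 0" using rho_pos assms by auto
  have 2: "((\<lambda>v. v * dickman_rho v) has_real_derivative (dickman_rho u - dickman_rho (u - 1))) (at u)"
    using assms by (auto intro!: derivative_eq_intros rho_deriv)
  have "((\<lambda>v. dickman_rho (v - 1) / (v * dickman_rho v)) has_real_derivative
      ((- rho_rate (u - 1) * dickman_rho (u - 1)) * (u * dickman_rho u) - dickman_rho (u - 1) * (dickman_rho u - dickman_rho (u - 1))) / ((u * dickman_rho u) * (u * dickman_rho u))) (at u)"
    by (rule DERIV_divide[OF 1 2]) (use p assms in auto)
  also have "(\<lambda>v. dickman_rho (v - 1) / (v * dickman_rho v)) = rho_rate"
    by (simp add: rho_rate_def[abs_def])
  finally show ?thesis
    by (rule DERIV_cong) (use p assms in \<open>simp add: rho_rate_def[of u] field_simps\<close>)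
qed

text \<open>The bracket is the integral over [u - 1, u] of \<rho>(v) (rate(v) - rate(u - 1)): the
  rate times \<rho> integrates to \<rho>(u - 1) - \<rho>(u), and \<rho> itself integrates to u
  \<rho>(u).\<close>

lemma rho_rate_increment_pos:
  assumes u: "u \<ge> 2" and r: "\<And>v. u - 1 < v \<Longrightarrow> v < u \<Longrightarrow> rho_rate (u - 1) < rho_rate v"
  shows "dickman_rho (u - 1) - dickman_rho u - rho_rate (u - 1) * (u * dickman_rho u) > 0"
proof -
  define P where "P = (\<lambda>v. dickman_rho (u - 1) - dickman_rho v - rho_rate (u - 1) * integral {u-1..v} dickman_rho)"
  have "P (u - 1) < P u"
  proof (rule DERIV_pos_imp_increasing_open[of "u-1" u P])
    fix x assume x: "u - 1 < x" "x < u"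
    have "(P has_real_derivative (dickman_rho x * (rho_rate x - rho_rate (u - 1)))) (at x)"
      unfolding P_def using x u
      by (auto intro!: derivative_eq_intros rho_deriv_rate rho_integral_deriv simp: algebra_simps)
    moreover have "dickman_rho x * (rho_rate x - rho_rate (u - 1)) > 0"
      using r[OF x] rho_pos[of x] x u by simp
    ultimately show "\<exists>y. (P has_real_derivative y) (at x) \<and> 0 < y" by blast
  next
    show "continuous_on {u-1..u} P" unfolding P_def
      by (intro continuous_intros continuous_on_rho rho_integral_continuous) (use u in auto)
  qed auto
  thus ?thesis using rho_integral[of u] u by (simp add: P_def)
qed

text \<open>At a first point where the derivative of the rate fails to be positive, the rate is still
  increasing on the preceding unit interval, and \<open>rho_rate_increment_pos\<close> gives positivity there.\<close>

lemma rho_rate_strict_mono: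
  assumes "1 \<le> u" "u < v"
  shows "rho_rate u < rho_rate v"
proof -
  define H where "H = (\<lambda>u. dickman_rho (u - 1) - dickman_rho u - rho_rate (u - 1) * (u * dickman_rho u))"
  \<comment> \<open>Monotonicity up to b uses positivity of H strictly below b only; this keeps the
    argument at the first failure free of circularity.\<close>
  have step: "rho_rate a < rho_rate b" if "1 \<le> a" "a < b" "\<And>w. 2 < w \<Longrightarrow> w < b \<Longrightarrow> H w > 0" for a b
  proof -
    have *: "rho_rate a < rho_rate b" if ab: "2 \<le> a" "a < b" "\<And>w. 2 < w \<Longrightarrow> w < b \<Longrightarrow> H w > 0" for a b
    proof (rule DERIV_pos_imp_increasing_open[of a b rho_rate, OF ab(2)])
      fix x assume x: "a < x" "x < b"
      have "rho_rate x / (x * dickman_rho x) > 0"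
        unfolding rho_rate_def using rho_pos[of x] rho_pos[of "x-1"] x ab by simp
      hence "rho_rate x / (x * dickman_rho x) * H x > 0" using ab x by (intro mult_pos_pos) auto
      thus "\<exists>y. (rho_rate has_real_derivative y) (at x) \<and> 0 < y"
        using rho_rate_has_derivative[of x] x ab unfolding H_def by auto
    qed (use ab in \<open>auto intro!: continuous_on_rho_rate\<close>)
    consider "b \<le> 2" | "a \<ge> 2" | "a < 2" "b > 2" by linarith
    thus ?thesis
    proof cases
      case 3
      thus ?thesis using rho_rate_less_on_1_2[of a 2] *[of 2 b] that by force
    qed (use that * rho_rate_less_on_1_2 in auto)
  qed
  have "H w > 0" if "w \<ge> 2" for w
  proof (rule ccontr)
    assume neg: "\<not> H w > 0"
    define Z where "Z = {2..w} \<inter> H -` {..0}"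
    have "continuous_on {2..w} H" unfolding H_def
      by (intro continuous_intros continuous_on_rho continuous_on_compose2[OF continuous_on_rho[of "{0..}"]] continuous_on_compose2[OF continuous_on_rho_rate[of "{1..}"]]) auto
    hence "closed Z" unfolding Z_def by (intro continuous_closed_preimage) auto
    moreover have "w \<in> Z" using neg that by (auto simp: Z_def)
    moreover have bdd: "bdd_below Z" by (auto simp: Z_def bdd_below_def)
    ultimately have z: "Inf Z \<in> Z" using closed_contains_Inf by blast
    define z where "z = Inf Z"
    have z2: "z \<ge> 2" "H z \<le> 0" using z by (auto simp: Z_def z_def)
    have pos: "H v > 0" if "2 \<le> v" "v < z" for v
      using cInf_lower[OF _ bdd, of v] that z by (fastforce simp: Z_def z_def)
    have "H z > 0" unfolding H_def
      by (rule rho_rate_increment_pos[OF z2(1)]) (rule step, use z2 pos in auto)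
    with z2 show False by simp
  qed
  thus ?thesis using step[OF assms] by auto
qed

lemma rho_rate_mono: "1 \<le> u \<Longrightarrow> u \<le> v \<Longrightarrow> rho_rate u \<le> rho_rate v"
  using rho_rate_strict_mono[of u v] by (cases "u = v") auto

text \<open>Multiplying by \<open>exp (c * x)\<close> changes the logarithmic derivative from minus
  the rate to c minus the rate, so a bound on the rate becomes monotonicity.\<close>

lemma rho_exp_rate_mono:
  assumes "1 \<le> a" "a \<le> b" "\<And>v. a < v \<Longrightarrow> v < b \<Longrightarrow> rho_rate v \<le> c"
  shows "dickman_rho a * exp (c * a) \<le> dickman_rho b * exp (c * b)"
proof (rule DERIV_nonneg_imp_increasing_open[of a b "\<lambda>x. dickman_rho x * exp (c * x)", OF assms(2)])
  fix x assume x: "a < x" "x < b"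
  have "((\<lambda>x. dickman_rho x * exp (c * x)) has_real_derivative (dickman_rho x * exp (c * x) * (c - rho_rate x))) (at x)"
    using x assms by (auto intro!: derivative_eq_intros rho_deriv_rate simp: algebra_simps)
  moreover have "dickman_rho x * exp (c * x) * (c - rho_rate x) \<ge> 0"
    using x assms rho_pos[of x] by (intro mult_nonneg_nonneg) auto
  ultimately show "\<exists>y. ((\<lambda>x. dickman_rho x * exp (c * x)) has_real_derivative y) (at x) \<and> 0 \<le> y"
    by blast
qed (use assms in \<open>auto intro!: continuous_intros continuous_on_rho\<close>)

lemma rho_exp_rate_antimono:
  assumes "1 \<le> a" "a \<le> b" "\<And>v. a < v \<Longrightarrow> v < b \<Longrightarrow> c \<le> rho_rate v"
  shows "dickman_rho b * exp (c * b) \<le> dickman_rho a * exp (c * a)"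
proof (rule DERIV_nonpos_imp_decreasing_open[of a b "\<lambda>x. dickman_rho x * exp (c * x)", OF assms(2)])
  fix x assume x: "a < x" "x < b"
  have "((\<lambda>x. dickman_rho x * exp (c * x)) has_real_derivative (dickman_rho x * exp (c * x) * (c - rho_rate x))) (at x)"
    using x assms by (auto intro!: derivative_eq_intros rho_deriv_rate simp: algebra_simps)
  moreover have "dickman_rho x * exp (c * x) * (c - rho_rate x) \<le> 0"
    using x assms rho_pos[of x] by (intro mult_nonneg_nonpos) auto
  ultimately show "\<exists>y. ((\<lambda>x. dickman_rho x * exp (c * x)) has_real_derivative y) (at x) \<and> y \<le> 0"
    by blast
qed (use assms in \<open>auto intro!: continuous_intros continuous_on_rho\<close>)

text \<open>Keep only the left half of the interval in \<open>rho_integral\<close>, where \<rho> is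
  at least \<rho>(u - 1/2).\<close>

lemma rho_half_step:
  assumes "u \<ge> 1"
  shows "dickman_rho (u - 1 / 2) \<le> 2 * u * dickman_rho u"
proof -
  have "dickman_rho (u - 1/2) / 2 = integral {u-1..u-1/2} (\<lambda>_. dickman_rho (u - 1/2))" by simp
  also have "\<dots> \<le> integral {u-1..u-1/2} dickman_rho"
    by (rule integral_le) (use assms in \<open>auto intro!: rho_integrable rho_antimono\<close>)
  also have "\<dots> \<le> integral {u-1..u} dickman_rho"
    by (rule integral_subset_le) (use assms in \<open>auto intro!: rho_integrable less_imp_le[OF rho_pos]\<close>)
  finally show ?thesis using rho_integral[OF assms] by simp
qed

text \<open>Since the rate increases, \<rho> falls by at least the factor exp(rate(u)) from u to u +
  1. Two half steps show that it falls by at most (2 (u + 1))^2.\<close>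

lemma rho_rate_le:
  assumes "u \<ge> 1"
  shows "rho_rate u \<le> 2 * ln (2 * (u + 1))"
proof -
  define w where "w = u + 1"
  have w: "w \<ge> 2" using assms by (simp add: w_def)
  have "dickman_rho w * exp (rho_rate u * w) \<le> dickman_rho u * exp (rho_rate u * u)"
    by (rule rho_exp_rate_antimono) (use assms rho_rate_mono in \<open>auto simp: w_def\<close>)
  hence "dickman_rho w * exp (rho_rate u) \<le> dickman_rho u"
    by (simp add: w_def distrib_left exp_add mult.assoc flip: mult.commute[of "exp (rho_rate u)"])
  also have "dickman_rho u \<le> 2 * (w - 1/2) * dickman_rho (w - 1/2)"
    using rho_half_step[of "w - 1/2"] w by (simp add: w_def)
  also have "\<dots> \<le> 2 * w * (2 * w * dickman_rho w)"
    using rho_half_step[of w] w rho_pos[of "w-1/2"] by (intro mult_mono) auto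
  finally have "dickman_rho w * exp (rho_rate u) \<le> dickman_rho w * (2 * w)\<^sup>2"
    by (simp add: power2_eq_square algebra_simps)
  hence "exp (rho_rate u) \<le> (2 * w)\<^sup>2" using rho_pos[of w] w by simp
  hence "ln (exp (rho_rate u)) \<le> ln ((2 * w)\<^sup>2)" using w by (subst ln_le_cancel_iff) auto
  thus ?thesis using w by (simp add: ln_realpow w_def)
qed

text \<open>The working form of the logarithmic bound on the rate. The recurring side condition
  \<open>2 * ln (2 * (ln x / L + 1)) \<le> L / 4\<close> is its hypothesis with u = log x / L and c
  = L / 4.\<close>

lemma rho_le_exp:
  assumes "0 \<le> v" "v \<le> u" "2 * ln (2 * (u + 1)) \<le> c"
  shows "dickman_rho v \<le> dickman_rho u * exp (c * (u - v))"
proof (cases "u \<le> 1")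
  case True
  have "ln (2 * (u + 1)) \<ge> 0" using assms by simp
  hence "c \<ge> 0" using assms by linarith
  thus ?thesis using True assms rho_le_1[of u] rho_le_1[of v] by simp
next
  case False
  have c: "rho_rate x \<le> c" if "1 \<le> x" "x \<le> u" for x
    using rho_rate_mono[OF that] rho_rate_le[of u] assms False by linarith
  have *: "dickman_rho x \<le> dickman_rho u * exp (c * (u - x))" if "1 \<le> x" "x \<le> u" for x
  proof -
    have "dickman_rho x * exp (c * x) \<le> dickman_rho u * exp (c * u)"
      by (rule rho_exp_rate_mono) (use that c in auto)
    thus ?thesis by (simp add: right_diff_distrib exp_diff field_simps)
  qed
  show ?thesis
  proof (cases "v \<ge> 1")
    case False
    have "ln (2 * (u + 1)) \<ge> 0" using assms by simp
    hence "c \<ge> 0" using assms by linarith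
    hence "exp (c * (u - 1)) \<le> exp (c * (u - v))" using False by (auto intro!: mult_left_mono)
    hence "dickman_rho u * exp (c * (u - 1)) \<le> dickman_rho u * exp (c * (u - v))"
      using rho_pos[of u] assms by (intro mult_left_mono) auto
    thus ?thesis using *[of 1] False \<open>\<not> u \<le> 1\<close> rho_le_1[of 1] rho_le_1[of v] assms by simp
  qed (use * assms in auto)
qed

section \<open>Chebyshev and Mertens estimates\<close>

abbreviation (input) \<Lambda> :: "nat \<Rightarrow> real" where "\<Lambda> \<equiv> mangoldt"

text \<open>Passing from n to n + 1 raises \<open>n div d\<close> exactly for the d dividing n + 1,
  and \<Lambda> summed over those is log (n + 1).\<close>

lemma ln_fact_mangoldt: "ln (fact n) = (\<Sum>d=1..n. \<Lambda> d * real (n div d))"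
proof (induction n)
  case (Suc n)
  have "(\<Sum>d=1..Suc n. \<Lambda> d * real (Suc n div d))
      = (\<Sum>d=1..Suc n. \<Lambda> d * real (n div d) + (if d dvd Suc n then \<Lambda> d else 0))"
    by (intro sum.cong) (auto simp: div_Suc dvd_eq_mod_eq_0 algebra_simps)
  also have "\<dots> = (\<Sum>d=1..n. \<Lambda> d * real (n div d)) + (\<Sum>d | d \<in> {1..Suc n} \<and> d dvd Suc n. \<Lambda> d)"
    by (subst sum.distrib, subst sum.inter_filter) auto
  also have "{d. d \<in> {1..Suc n} \<and> d dvd Suc n} = {d. d dvd Suc n}"
    by (auto dest: dvd_imp_le intro!: Nat.gr0I simp: Suc_le_eq)
  also have "(\<Sum>d | d dvd Suc n. \<Lambda> d) = ln (Suc n)"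
    by (subst mangoldt_sum) auto
  finally show ?case using Suc by (simp add: ln_mult add.commute)
qed auto

definition chebyshev_psi :: "nat \<Rightarrow> real" where
  "chebyshev_psi n = (\<Sum>d=1..n. \<Lambda> d)"

text \<open>The weights floor(2n/d) - 2 floor(n/d) are nonnegative, equal 1 for n < d <= 2n, and
  their total against \<Lambda> is the logarithm of the central binomial coefficient.\<close>

lemma chebyshev_psi_double: "chebyshev_psi (2 * n) - chebyshev_psi n \<le> 2 * real n * ln 2"
proof -
  have "chebyshev_psi (2 * n) - chebyshev_psi n = (\<Sum>d=n+1..2*n. \<Lambda> d)"
    unfolding chebyshev_psi_def using sum.ub_add_nat[of 1 n \<Lambda> n] by (simp add: mult_2)
  also have "\<dots> \<le> (\<Sum>d=n+1..2*n. \<Lambda> d * (real (2 * n div d) - 2 * real (n div d)))"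
  proof (rule sum_mono)
    fix d assume d: "d \<in> {n+1..2*n}"
    hence "2 * n div d \<ge> 1" by (subst less_eq_div_iff_mult_less_eq) auto
    moreover have "n div d = 0" using d by auto
    ultimately show "\<Lambda> d \<le> \<Lambda> d * (real (2 * n div d) - 2 * real (n div d))"
      using mangoldt_nonneg[of d] by (simp add: mult_le_cancel_left1)
  qed
  also have "\<dots> \<le> (\<Sum>d=1..2*n. \<Lambda> d * (real (2 * n div d) - 2 * real (n div d)))"
  proof (rule sum_mono2)
    fix d
    have "2 * (n div d) \<le> 2 * n div d" by (cases "d = 0") (simp_all add: less_eq_div_iff_mult_less_eq)
    hence "real (2 * (n div d)) \<le> real (2 * n div d)" by (rule of_nat_mono)
    thus "0 \<le> \<Lambda> d * (real (2 * n div d) - 2 * real (n div d))"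
      by (intro mult_nonneg_nonneg mangoldt_nonneg) simp
  qed auto
  also have "\<dots> = (\<Sum>d=1..2*n. \<Lambda> d * real (2 * n div d)) - 2 * (\<Sum>d=1..2*n. \<Lambda> d * real (n div d))"
    by (simp add: right_diff_distrib sum_subtractf sum_distrib_left mult_ac)
  also have "(\<Sum>d=1..2*n. \<Lambda> d * real (n div d)) = (\<Sum>d=1..n. \<Lambda> d * real (n div d))"
    by (rule sum.mono_neutral_right) auto
  also have "(\<Sum>d=1..2*n. \<Lambda> d * real (2 * n div d)) - 2 * (\<Sum>d=1..n. \<Lambda> d * real (n div d))
    = ln (real ((2 * n) choose n))"
  proof -
    have "fact (2 * n) = (fact n * fact n * real ((2 * n) choose n) :: real)"
      by (subst binomial_fact) auto
    hence "ln (fact (2 * n) :: real) = ln (fact n) + ln (fact n) + ln (real ((2 * n) choose n))"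
      by (simp add: ln_mult)
    thus ?thesis by (simp add: ln_fact_mangoldt)
  qed
  also have "\<dots> \<le> ln (2 ^ (2 * n))"
  proof (subst ln_le_cancel_iff)
    show "real (2 * n choose n) \<le> 2 ^ (2 * n)"
      using binomial_le_pow2[of "2 * n" n] by (metis of_nat_le_iff of_nat_numeral of_nat_power)
  qed auto
  finally show ?thesis by (simp add: ln_realpow)
qed

text \<open>Halving gives 4n + 2n = 6n at 2n; the odd argument 2n + 1 adds at most log (2n + 1) <=
  2n. The constant 4 accommodates this 8n.\<close>

lemma chebyshev_psi_le: "chebyshev_psi n \<le> 4 * real n"
proof (induction n rule: less_induct)
  case (less m)
  have ln2: "ln (2::real) \<le> 1" using ln_le_minus_one[of 2] by simp
  define n where "n = m div 2"
  show ?case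
  proof (cases "m \<le> 1")
    case True
    hence "m = 0 \<or> m = 1" by auto
    thus ?thesis by (auto simp: chebyshev_psi_def)
  next
    case False
    have even: "chebyshev_psi (2 * n) \<le> 6 * real n"
    proof -
      have "chebyshev_psi n \<le> 4 * real n" using less[of n] False by (simp add: n_def)
      moreover have "2 * real n * ln 2 \<le> 2 * real n * 1" using ln2 by (intro mult_left_mono) auto
      ultimately show ?thesis using chebyshev_psi_double[of n] by simp
    qed
    consider "m = 2 * n" | "m = Suc (2 * n)" unfolding n_def by linarith
    thus ?thesis
    proof cases
      case 2
      have "\<Lambda> m \<le> ln m" using mangoldt_le[of m] 2 by simp
      also have "\<dots> \<le> 2 * real n" using ln_le_minus_one[of "real m"] 2 by simp
      finally have "chebyshev_psi m \<le> 8 * real n"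
        using even by (simp add: 2 chebyshev_psi_def)
      thus ?thesis using 2 by simp
    qed (use even in auto)
  qed
qed

lemma ln_fact_ge: "n \<ge> 1 \<Longrightarrow> ln (fact n) \<ge> real n * ln n - n"
proof (induction n rule: dec_induct)
  case (step m)
  hence m: "m \<ge> 1" by simp
  have "1 + 1 / real m = (real m + 1) / real m" using m by (simp add: field_simps)
  hence "ln (real m + 1) - ln m = ln (1 + 1 / real m)" using m by (simp add: ln_div)
  also have "\<dots> \<le> 1 / real m" by (rule ln_add_one_self_le_self) auto
  finally have "real m * (ln (real m + 1) - ln m) \<le> 1"
    using m by (simp add: field_simps)
  moreover have "ln (fact (Suc m) :: real) = ln (real m + 1) + ln (fact m)"
    by (subst fact_Suc, subst ln_mult) (auto simp: add.commute)
  ultimately show ?case using step.IH by (simp add: algebra_simps)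
qed auto

definition mertens_sum :: "nat \<Rightarrow> real" where
  "mertens_sum n = (\<Sum>d=1..n. \<Lambda> d / real d)"

text \<open>Both bounds replace \<open>n div d\<close> by n / d in the formula for log n!. Below,
  this only helps and Stirling costs 1; above, the rounding costs psi(n) / n <= 4.\<close>

lemma mertens_nat:
  assumes "n \<ge> 1"
  shows "ln n - 1 \<le> mertens_sum n" "mertens_sum n \<le> ln n + 4"
proof -
  have "real n * ln n - n \<le> (\<Sum>d=1..n. \<Lambda> d * real (n div d))"
    using ln_fact_ge[OF assms] by (simp add: ln_fact_mangoldt)
  also have "\<dots> \<le> (\<Sum>d=1..n. \<Lambda> d * (real n / real d))"
    by (intro sum_mono mult_left_mono mangoldt_nonneg of_nat_div_le_of_nat)
  also have "\<dots> = real n * mertens_sum n"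
    by (simp add: mertens_sum_def sum_distrib_left mult_ac)
  finally have "real n * (ln n - 1) \<le> real n * mertens_sum n" by (simp add: algebra_simps)
  thus "ln n - 1 \<le> mertens_sum n" using assms by (subst (asm) mult_le_cancel_left_pos) auto
  have "real n * mertens_sum n - chebyshev_psi n = (\<Sum>d=1..n. \<Lambda> d * (real n / real d - 1))"
    by (simp add: mertens_sum_def chebyshev_psi_def sum_distrib_left algebra_simps sum_subtractf)
  also have "\<dots> \<le> (\<Sum>d=1..n. \<Lambda> d * real (n div d))"
  proof (intro sum_mono mult_left_mono mangoldt_nonneg)
    fix d show "real n / real d - 1 \<le> real (n div d)"
      using floor_divide_of_nat_eq[of n d, where ?'a = real] by linarith
  qed
  also have "\<dots> \<le> real n * ln n"
  proof -
    have "ln (fact n :: real) \<le> ln (real n ^ n)"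
      by (subst ln_le_cancel_iff) (use assms fact_le_power[of n, where ?'a = real] in auto)
    thus ?thesis by (simp add: ln_fact_mangoldt ln_realpow)
  qed
  finally have "real n * mertens_sum n \<le> real n * (ln n + 4)"
    using chebyshev_psi_le[of n] by (simp add: algebra_simps)
  thus "mertens_sum n \<le> ln n + 4" using assms by (subst (asm) mult_le_cancel_left_pos) auto
qed

lemma mertens_real:
  assumes "z \<ge> 1"
  shows "\<bar>mertens_sum (nat \<lfloor>z\<rfloor>) - ln z\<bar> \<le> 4"
proof -
  define n where "n = nat \<lfloor>z\<rfloor>"
  have "n \<ge> 1" "real n \<le> z" "z \<le> real n + 1" using assms unfolding n_def by linarith+
  hence n: "n \<ge> 1" "real n \<le> z" "z \<le> 2 * real n" by linarith+
  have "ln z \<le> ln (2 * real n)" "ln (real n) \<le> ln z" using n by (subst ln_le_cancel_iff; simp)+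
  moreover have "ln (2 * real n) = ln 2 + ln (real n)" using n by (simp add: ln_mult)
  moreover have "ln (2::real) \<le> 1" using ln_le_minus_one[of 2] by simp
  ultimately show ?thesis using mertens_nat[OF n(1)] unfolding n_def[symmetric] by linarith
qed

text \<open>Partial summation over the blocks j < log d <= j + 1, with E j the Mertens error at
  \<open>exp j\<close>. The constant 9 consists of 4 for the boundary term g(J) E(J) and 5 times the
  variation of g: 4 from E and 1 from comparing the integral with endpoint values.\<close>

lemma mertens_abel:
  fixes g :: "real \<Rightarrow> real"
  assumes mono: "\<And>v w. 0 \<le> v \<Longrightarrow> v \<le> w \<Longrightarrow> w \<le> real J \<Longrightarrow> g v \<le> g w"
    and nonneg: "g 0 \<ge> 0" and cont: "continuous_on {0..real J} g"
  defines "U \<equiv> (\<Sum>d=1..nat \<lfloor>exp (real J)\<rfloor>. \<Lambda> d / real d * g (ln d))"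
  shows "\<bar>U - integral {0..real J} g\<bar> \<le> 9 * g J"
proof -
  define k where "k = (\<lambda>j::nat. nat \<lfloor>exp (real j)\<rfloor>)"
  define V where "V = (\<lambda>j. \<Sum>d=1..k j. \<Lambda> d / real d * g (ln d))"
  define E where "E = (\<lambda>j. mertens_sum (k j) - real j)"
  have E: "\<bar>E j\<bar> \<le> 4" for j
    using mertens_real[of "exp (real j)"] by (simp add: E_def k_def)
  have kmono: "k j \<le> k (Suc j)" for j unfolding k_def
    by (intro nat_mono floor_mono) simp
  have inc: "\<exists>S. V (Suc j) = V j + S \<and> g (real j) * (1 + E (Suc j) - E j) \<le> S
       \<and> S \<le> g (real (Suc j)) * (1 + E (Suc j) - E j)" if "j < J" for j
  proof (intro exI conjI)
    have split: "(\<Sum>d=1..k (Suc j). f d) = (\<Sum>d=1..k j. f d) + (\<Sum>d=Suc (k j)..k (Suc j). f d)" for f :: "nat \<Rightarrow> real"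
      using sum.ub_add_nat[of 1 "k j" f "k (Suc j) - k j"] kmono[of j] by simp
    show "V (Suc j) = V j + (\<Sum>d=Suc (k j)..k (Suc j). \<Lambda> d / real d * g (ln d))"
      unfolding V_def by (rule split)
    have w: "1 + E (Suc j) - E j = (\<Sum>d=Suc (k j)..k (Suc j). \<Lambda> d / real d)"
      unfolding E_def mertens_sum_def split by simp
    have bd: "real j \<le> ln d" "ln d \<le> real (Suc j)" if d: "d \<in> {Suc (k j)..k (Suc j)}" for d
    proof -
      have "exp (real j) \<le> real d" "real d \<le> exp (real (Suc j))"
        using d unfolding k_def atLeastAtMost_iff by linarith+
      moreover have "0 < real d" using calculation(1) exp_gt_zero[of "real j"] by linarith
      ultimately have "ln (exp (real j)) \<le> ln d" "ln d \<le> ln (exp (real (Suc j)))"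
        by (subst ln_le_cancel_iff; simp)+
      thus "real j \<le> ln d" "ln d \<le> real (Suc j)" unfolding ln_exp .
    qed
    show "g (real j) * (1 + E (Suc j) - E j) \<le> (\<Sum>d=Suc (k j)..k (Suc j). \<Lambda> d / real d * g (ln d))"
      unfolding w sum_distrib_left
    proof (rule sum_mono)
      fix d assume d: "d \<in> {Suc (k j)..k (Suc j)}"
      have "g (real j) \<le> g (ln d)" using bd[OF d] that by (intro mono) auto
      thus "g (real j) * (\<Lambda> d / real d) \<le> \<Lambda> d / real d * g (ln d)"
        using mangoldt_nonneg[of d] by (subst mult.commute) (intro mult_left_mono, auto)
    qed
    show "(\<Sum>d=Suc (k j)..k (Suc j). \<Lambda> d / real d * g (ln d)) \<le> g (real (Suc j)) * (1 + E (Suc j) - E j)"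
      unfolding w sum_distrib_left
    proof (rule sum_mono)
      fix d assume d: "d \<in> {Suc (k j)..k (Suc j)}"
      have "0 \<le> ln (real d)" using d by auto
      hence "g (ln d) \<le> g (real (Suc j))" using bd[OF d] that by (intro mono) auto
      thus "\<Lambda> d / real d * g (ln d) \<le> g (real (Suc j)) * (\<Lambda> d / real d)"
        using mangoldt_nonneg[of d] by (subst (2) mult.commute) (intro mult_left_mono, auto)
    qed
  qed
  have "V j \<le> integral {0..real j} g + g j * E j + 5 * (g j - g 0) \<and>
        V j \<ge> integral {0..real j} g + g j * E j - 5 * (g j - g 0) - 4 * g 0" if "j \<le> J" for j
    using that
  proof (induction j)
    case 0
    have "k 0 = 1" by (simp add: k_def)
    thus ?case using nonneg by (simp add: V_def E_def mertens_sum_def)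
  next
    case (Suc j)
    have int: "g integrable_on {a..b}" if "0 \<le> a" "b \<le> real J" for a b
      by (intro integrable_continuous_real continuous_on_subset[OF cont]) (use that in auto)
    have I: "integral {0..real (Suc j)} g = integral {0..real j} g + integral {real j..real (Suc j)} g"
      by (rule Henstock_Kurzweil_Integration.integral_combine[symmetric])
         (use Suc.prems int in auto)
    have "integral {real j..real (Suc j)} (\<lambda>_. g j) \<le> integral {real j..real (Suc j)} g"
         "integral {real j..real (Suc j)} g \<le> integral {real j..real (Suc j)} (\<lambda>_. g (Suc j))"
      using Suc.prems by (intro integral_le int mono; auto)+
    hence I2: "g j \<le> integral {real j..real (Suc j)} g" "integral {real j..real (Suc j)} g \<le> g (Suc j)"
      by auto
    have gm: "g j \<le> g (Suc j)" using Suc.prems by (intro mono) auto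
    have "(g (Suc j) - g j) * E j \<ge> - (4 * (g (Suc j) - g j))"
      and "(g (Suc j) - g j) * E (Suc j) \<le> 4 * (g (Suc j) - g j)"
      using mult_left_mono[of "-4" "E j" "g (Suc j) - g j"] mult_left_mono[of "E (Suc j)" 4 "g (Suc j) - g j"]
        E[of j] E[of "Suc j"] gm by (auto simp: abs_le_iff algebra_simps)
    moreover obtain S where "V (Suc j) = V j + S" "g (real j) * (1 + E (Suc j) - E j) \<le> S"
       "S \<le> g (real (Suc j)) * (1 + E (Suc j) - E j)" using inc[of j] Suc.prems by auto
    ultimately show ?case using Suc I I2 gm by (auto simp: algebra_simps)
  qed
  from this[of J] have *: "V J \<le> integral {0..real J} g + g J * E J + 5 * (g J - g 0)"
     "V J \<ge> integral {0..real J} g + g J * E J - 5 * (g J - g 0) - 4 * g 0" by auto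
  have g0: "g 0 \<le> g J" by (intro mono) auto
  hence "\<bar>g J * E J\<bar> \<le> g J * 4" unfolding abs_mult
    using E[of J] nonneg by (intro mult_mono) auto
  moreover have "V J = U" unfolding V_def U_def k_def ..
  ultimately have "U \<le> integral {0..real J} g + 9 * g J" "U \<ge> integral {0..real J} g - 9 * g J"
    using * g0 nonneg by (simp_all add: abs_le_iff)
  thus ?thesis by (simp add: abs_le_iff)
qed

text \<open>Only d = p^m with m >= 2 contribute. The terms are led by log p * p^(-3/2), and log p <=
  4 p^(1/4) leaves the convergent p^(-5/4).\<close>

lemma proper_primepow_sum_bounded:
  obtains C where "C \<ge> 0"
    "\<And>F. finite F \<Longrightarrow> (\<And>d. d \<in> F \<Longrightarrow> \<not> prime d) \<Longrightarrow> (\<Sum>d\<in>F. \<Lambda> d * real d powr (- (3/4))) \<le> C"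
proof
  define Z where "Z = (\<Sum>n. real n powr (-(5/4)))"
  have summ: "summable (\<lambda>n. real n powr (-(5/4)))" by (subst summable_real_powr_iff) auto
  show "0 \<le> 10 * Z" unfolding Z_def by (intro mult_nonneg_nonneg suminf_nonneg summ) auto
  define h where "h = (\<lambda>d. \<Lambda> d * real d powr (- (3/4)))"
  fix F :: "nat set" assume F: "finite F" "\<And>d. d \<in> F \<Longrightarrow> \<not> prime d"
  \<comment> \<open>B bounds the primes and the exponents alike, since m <= p^m; inserting 0 covers
    the empty set.\<close>
  define B where "B = Max (insert 0 F)"
  have B: "d \<le> B" if "d \<in> F" for d unfolding B_def using F that by auto
  define P where "P = {p\<in>{2..B}. prime p}"
  have inner: "(\<Sum>m=2..B. h (p ^ m)) \<le> 10 * real p powr (-(5/4))" if p: "prime p" for p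
  proof -
    define q where "q = real p powr (-(3/4))"
    have p2: "real p \<ge> 2" using prime_ge_2_nat[OF p] by simp
    have "q powr 4 = real p powr (-3)" unfolding q_def by (simp add: powr_powr)
    also have "\<dots> \<le> 2 powr (-3)" using p2 by (intro powr_mono2') auto
    also have "\<dots> = 1/8" by (simp add: powr_minus)
    finally have "q ^ 4 \<le> 1/8" using p2 by (simp add: q_def flip: powr_numeral)
    \<comment> \<open>(3/5)^4 = 0.1296 exceeds 1/8, so the geometric ratio stays below 3/5.\<close>
    hence q: "q \<le> 3/5" by (rule_tac ccontr) (use power_strict_mono[of "3/5" q 4] in \<open>auto simp: eval_nat_numeral\<close>)
    have q0: "q > 0" unfolding q_def using p2 by simp
    have "(\<Sum>m=2..B. h (p ^ m)) = (\<Sum>m=2..B. ln p * q ^ m)"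
    proof (rule sum.cong)
      fix m assume "m \<in> {2..B}"
      moreover have "(real p ^ m) powr (-(3/4)) = q ^ m"
        unfolding q_def using p2 by (simp add: powr_powr powr_realpow[symmetric] powr_power mult.commute)
      ultimately show "h (p ^ m) = ln p * q ^ m" unfolding h_def using p by simp
    qed auto
    also have "\<dots> = ln p * (\<Sum>m=2..B. q ^ m)" by (simp add: sum_distrib_left)
    also have "\<dots> \<le> ln p * (q\<^sup>2 / (1 - q))"
    proof (rule mult_left_mono)
      have "(\<Sum>m=2..B. q ^ m) * (1 - q) \<le> q\<^sup>2"
      proof (cases "B \<ge> 2")
        case True
        hence "(\<Sum>m=2..B. q ^ m) * (1 - q) = q\<^sup>2 - q ^ Suc B"
        proof (induction B rule: dec_induct)
          case base
          thus ?case by (simp add: algebra_simps power2_eq_square power3_eq_cube)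
        next
          case (step n)
          have "(\<Sum>m=2..Suc n. q ^ m) * (1 - q) = (\<Sum>m=2..n. q ^ m) * (1 - q) + q ^ Suc n * (1 - q)"
            using step.hyps by (simp add: distrib_right)
          thus ?case using step.IH by (simp add: algebra_simps)
        qed
        thus ?thesis using q0 by simp
      qed auto
      thus "(\<Sum>m=2..B. q ^ m) \<le> q\<^sup>2 / (1 - q)" using q by (simp add: pos_le_divide_eq)
    qed (use p2 in auto)
    \<comment> \<open>The 10 below is 4 / (2/5): the 4 comes from bounding the logarithm by the
      power 1/4, and 2/5 bounds 1 - q from below.\<close>
    also have "\<dots> \<le> (real p powr (1/4) / (1/4)) * (q\<^sup>2 / (2/5))"
      using p2 q q0 by (intro mult_mono ln_powr_bound divide_left_mono) auto
    also have "q\<^sup>2 = real p powr (-(3/2))" unfolding q_def power2_eq_square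
      by (simp flip: powr_add)
    also have "(real p powr (1/4) / (1/4)) * (real p powr (-(3/2)) / (2/5)) = 10 * (real p powr (1/4) * real p powr (-(3/2)))"
      by simp
    also have "real p powr (1/4) * real p powr (-(3/2)) = real p powr (-(5/4))"
      by (simp flip: powr_add)
    finally show ?thesis .
  qed
  have "(\<Sum>d\<in>F. h d) = (\<Sum>d\<in>{d\<in>F. primepow d}. h d)"
    by (rule sum.mono_neutral_right) (use F in \<open>auto simp: h_def mangoldt_def\<close>)
  also have "\<dots> \<le> (\<Sum>(p,m)\<in>P \<times> {2..B}. h (p ^ m))"
  proof (rule sum_le_included[where i = "\<lambda>(p,m). p ^ m"])
    show "\<forall>x\<in>{d\<in>F. primepow d}. \<exists>y\<in>P \<times> {2..B}. (case y of (p, m) \<Rightarrow> p ^ m) = x \<and> h x \<le> (case y of (p, m) \<Rightarrow> h (p ^ m))"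
    proof
      fix d assume d: "d \<in> {d\<in>F. primepow d}"
      then obtain p m where pm: "prime p" "m > 0" "d = p ^ m" unfolding primepow_def by auto
      have p2: "p \<ge> 2" using prime_ge_2_nat[OF pm(1)] .
      have m1: "m \<noteq> 1" using pm d F by auto
      have mp: "m \<le> p ^ m" using power_mono[OF p2, of m] less_exp[of m] by linarith
      have pp: "p ^ 1 \<le> p ^ m" using pm p2 by (intro power_increasing) auto
      have pB: "p ^ m \<le> B" using B d pm by auto
      have "m \<le> B" using mp pB by linarith
      moreover have "p \<le> B" using pp pB by simp
      ultimately have "(p, m) \<in> P \<times> {2..B}" using m1 pm p2 unfolding P_def by auto
      thus "\<exists>y\<in>P \<times> {2..B}. (case y of (p, m) \<Rightarrow> p ^ m) = d \<and> h d \<le> (case y of (p, m) \<Rightarrow> h (p ^ m))"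
        using pm by (intro bexI[of _ "(p,m)"]) auto
    qed
  qed (use F in \<open>auto simp: P_def h_def mangoldt_nonneg\<close>)
  also have "\<dots> = (\<Sum>p\<in>P. \<Sum>m=2..B. h (p ^ m))" by (simp add: sum.cartesian_product)
  also have "\<dots> \<le> (\<Sum>p\<in>P. 10 * real p powr (-(5/4)))"
    by (intro sum_mono inner) (auto simp: P_def)
  also have "\<dots> = 10 * (\<Sum>p\<in>P. real p powr (-(5/4)))" by (simp add: sum_distrib_left)
  also have "\<dots> \<le> 10 * Z" unfolding Z_def
    by (intro mult_left_mono sum_le_suminf summ) (auto simp: P_def)
  finally show "(\<Sum>d\<in>F. \<Lambda> d * real d powr (- (3/4))) \<le> 10 * Z" unfolding h_def .
qed

section \<open>Smooth numbers\<close>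

definition smooth_upto :: "nat \<Rightarrow> real \<Rightarrow> nat set" where
  "smooth_upto k x = {n. n > 0 \<and> real n \<le> x \<and> (\<forall>p. prime p \<longrightarrow> p dvd n \<longrightarrow> p \<le> k)}"

definition Psi :: "nat \<Rightarrow> real \<Rightarrow> real" where
  "Psi k x = real (card (smooth_upto k x))"

lemma smooth_upto_subset: "smooth_upto k x \<subseteq> {1..nat \<lfloor>x\<rfloor>}"
  by (auto simp: smooth_upto_def le_nat_floor)

lemma finite_smooth_upto [simp]: "finite (smooth_upto k x)"
  using smooth_upto_subset finite_subset by blast

lemma Psi_nonneg: "Psi k x \<ge> 0" by (simp add: Psi_def)

lemma Psi_le: "x \<ge> 0 \<Longrightarrow> Psi k x \<le> x"
  using card_mono[OF _ smooth_upto_subset[of k x]] unfolding Psi_def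
  by simp linarith

lemma atLeastAtMost_subset_smooth_upto:
  assumes "0 \<le> x" "m \<le> k" "real m \<le> x"
  shows "{1..m} \<subseteq> smooth_upto k x"
proof
  fix n assume n: "n \<in> {1..m}"
  hence "p \<le> k" if "p dvd n" for p using dvd_imp_le[OF that] assms by auto
  thus "n \<in> smooth_upto k x" using assms n by (auto simp: smooth_upto_def)
qed

lemma Psi_ge:
  assumes "0 \<le> x" "x < real k + 1"
  shows "Psi k x \<ge> x - 1"
proof -
  have "card {1..nat \<lfloor>x\<rfloor>} \<le> card (smooth_upto k x)"
    by (intro card_mono atLeastAtMost_subset_smooth_upto) (use assms in \<open>auto, linarith\<close>)
  thus ?thesis unfolding Psi_def using assms by simp linarith
qed

lemma smooth_upto_multiples:
  assumes "d \<in> smooth_upto k x"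
  shows "{n \<in> smooth_upto k x. d dvd n} = (\<lambda>m. d * m) ` smooth_upto k (x / d)"
proof -
  have d: "d > 0" using assms by (auto simp: smooth_upto_def)
  have "n \<in> (\<lambda>m. d * m) ` smooth_upto k (x / d)" if n: "n \<in> smooth_upto k x" "d dvd n" for n
  proof -
    obtain m where m: "n = d * m" using n by auto
    hence "m \<in> smooth_upto k (x / d)" using n d by (auto simp: smooth_upto_def field_simps)
    thus ?thesis using m by blast
  qed
  moreover have "d * m \<in> smooth_upto k x" if "m \<in> smooth_upto k (x / d)" for m
    using that d assms by (auto simp: smooth_upto_def field_simps prime_dvd_mult_iff)
  ultimately show ?thesis by auto
qed

text \<open>Write log n as the sum of \<Lambda> over the divisors of n and exchange sums: divisors
  of smooth numbers are smooth, and the smooth multiples of d up to x correspond to the smooth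
  numbers up to x / d.\<close>

lemma sum_ln_smooth: "(\<Sum>n\<in>smooth_upto k x. ln n) = (\<Sum>d\<in>smooth_upto k x. \<Lambda> d * Psi k (x / d))"
proof -
  let ?S = "smooth_upto k x"
  have "(\<Sum>n\<in>?S. ln n) = (\<Sum>n\<in>?S. \<Sum>d\<in>?S. if d dvd n then \<Lambda> d else 0)"
  proof (rule sum.cong)
    fix n assume n: "n \<in> ?S"
    hence "{d. d \<in> ?S \<and> d dvd n} = {d. d dvd n}"
      by (auto simp: smooth_upto_def dest: dvd_imp_le intro: dvd_trans)
    moreover have "(\<Sum>d\<in>?S. if d dvd n then \<Lambda> d else 0) = (\<Sum>d | d \<in> ?S \<and> d dvd n. \<Lambda> d)"
      by (rule sum.inter_filter[symmetric]) simp
    ultimately show "ln n = (\<Sum>d\<in>?S. if d dvd n then \<Lambda> d else 0)"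
      using mangoldt_sum[of n, where ?'a = real] n by (auto simp: smooth_upto_def)
  qed auto
  also have "\<dots> = (\<Sum>d\<in>?S. \<Sum>n\<in>?S. if d dvd n then \<Lambda> d else 0)" by (rule sum.swap)
  also have "\<dots> = (\<Sum>d\<in>?S. \<Lambda> d * Psi k (x / d))"
  proof (rule sum.cong)
    fix d assume d: "d \<in> ?S"
    hence "d > 0" by (auto simp: smooth_upto_def)
    have "(\<Sum>n\<in>?S. if d dvd n then \<Lambda> d else 0) = (\<Sum>n | n \<in> ?S \<and> d dvd n. \<Lambda> d)"
      by (rule sum.inter_filter[symmetric]) simp
    also have "\<dots> = \<Lambda> d * real (card {n\<in>?S. d dvd n})" by simp
    also have "card {n\<in>?S. d dvd n} = card (smooth_upto k (x / d))"
      unfolding smooth_upto_multiples[OF d] using \<open>d > 0\<close> by (intro card_image inj_onI) auto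
    finally show "(\<Sum>n\<in>?S. if d dvd n then \<Lambda> d else 0) = \<Lambda> d * Psi k (x / d)"
      by (simp add: Psi_def)
  qed auto
  finally show ?thesis .
qed

text \<open>log (x / n) is at most the number of integers j >= 0 with n <= x e^(-j); counting by j
  instead of n gives the right-hand side.\<close>

lemma sum_ln_quotient_le:
  assumes "x \<ge> 1"
  shows "(\<Sum>n\<in>smooth_upto k x. ln (x / n)) \<le> (\<Sum>j\<le>nat \<lfloor>ln x\<rfloor>. Psi k (x * exp (- real j)))"
proof -
  let ?S = "smooth_upto k x" and ?m = "nat \<lfloor>ln x\<rfloor>"
  have "(\<Sum>n\<in>?S. ln (x / n)) \<le> (\<Sum>n\<in>?S. \<Sum>j\<le>?m. if n \<in> smooth_upto k (x * exp (- real j)) then 1 else 0)"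
  proof (rule sum_mono)
    fix n assume n: "n \<in> ?S"
    hence n1: "real n \<ge> 1" "real n \<le> x" by (auto simp: smooth_upto_def Suc_le_eq)
    define l where "l = ln (x / n)"
    have l: "l \<ge> 0" "l \<le> ln x" using n1 assms unfolding l_def by (auto simp: ln_div)
    have "real n = x * exp (- l)" unfolding l_def using n1 assms by (simp add: exp_minus field_simps)
    hence "n \<in> smooth_upto k (x * exp (- real j))" if "j \<le> nat \<lfloor>l\<rfloor>" for j
    proof -
      have "real j \<le> l" using that l by linarith
      hence "x * exp (- l) \<le> x * exp (- real j)" using assms by (intro mult_left_mono) auto
      thus ?thesis using n \<open>real n = x * exp (- l)\<close> by (auto simp: smooth_upto_def)
    qed
    hence sub: "{..nat \<lfloor>l\<rfloor>} \<subseteq> {j. j \<in> {..?m} \<and> n \<in> smooth_upto k (x * exp (- real j))}"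
      using l by (auto intro: order_trans[OF _ nat_mono[OF floor_mono]])
    have "l \<le> real (card {..nat \<lfloor>l\<rfloor>})" using l by simp linarith
    also have "\<dots> \<le> real (card {j. j \<in> {..?m} \<and> n \<in> smooth_upto k (x * exp (- real j))})"
      by (intro of_nat_mono card_mono sub) auto
    also have "\<dots> = (\<Sum>j | j \<in> {..?m} \<and> n \<in> smooth_upto k (x * exp (- real j)). 1)" by simp
    also have "\<dots> = (\<Sum>j\<le>?m. if n \<in> smooth_upto k (x * exp (- real j)) then 1 else 0)"
      by (rule sum.inter_filter) simp
    finally show "ln (x / n) \<le> (\<Sum>j\<le>?m. if n \<in> smooth_upto k (x * exp (- real j)) then 1 else 0)"
      unfolding l_def .
  qed
  also have "\<dots> = (\<Sum>j\<le>?m. \<Sum>n\<in>?S. if n \<in> smooth_upto k (x * exp (- real j)) then 1 else 0)"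
    by (rule sum.swap)
  also have "\<dots> = (\<Sum>j\<le>?m. Psi k (x * exp (- real j)))"
  proof (rule sum.cong)
    fix j :: nat
    have "x * exp (- real j) \<le> x" using assms by (simp add: mult_le_cancel_left1)
    hence "{n. n \<in> ?S \<and> n \<in> smooth_upto k (x * exp (- real j))} = smooth_upto k (x * exp (- real j))"
      by (auto simp: smooth_upto_def)
    moreover have "(\<Sum>n\<in>?S. if n \<in> smooth_upto k (x * exp (- real j)) then 1 else 0)
       = (\<Sum>n | n \<in> ?S \<and> n \<in> smooth_upto k (x * exp (- real j)). 1::real)"
      by (rule sum.inter_filter[symmetric]) simp
    ultimately show "(\<Sum>n\<in>?S. if n \<in> smooth_upto k (x * exp (- real j)) then 1 else 0) = Psi k (x * exp (- real j))"
      by (simp add: Psi_def)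
  qed auto
  finally show ?thesis .
qed

section \<open>Comparison of smooth number counts with the Dickman function\<close>

text \<open>A rate of L / 4 in the variable log x / L is a rate of 1/4 in log x, that is, a power of
  x / z.\<close>

lemma rho_rescale_le:
  assumes "L > 0" "1 \<le> z" "z \<le> x" "2 * ln (2 * (ln x / L + 1)) \<le> L / 4"
  shows "dickman_rho (ln z / L) \<le> dickman_rho (ln x / L) * (x / z) powr (1/4)"
proof -
  have "dickman_rho (ln z / L) \<le> dickman_rho (ln x / L) * exp (L / 4 * (ln x / L - ln z / L))"
    by (rule rho_le_exp) (use assms in \<open>auto intro!: divide_right_mono\<close>)
  also have "L / 4 * (ln x / L - ln z / L) = 1/4 * ln (x / z)"
    using assms by (simp add: ln_div field_simps)
  also have "exp (1/4 * ln (x / z)) = (x / z) powr (1/4)" using assms by (simp add: powr_def)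
  finally show ?thesis .
qed

lemma log_rate_cond_mono:
  assumes "L > 0" "1 \<le> z" "z \<le> x" "2 * ln (2 * (ln x / L + 1)) \<le> c"
  shows "2 * ln (2 * (ln z / L + 1)) \<le> (c::real)"
proof -
  have "ln z / L \<le> ln x / L" "ln z / L \<ge> 0" using assms by (auto intro!: divide_right_mono)
  hence "ln (2 * (ln z / L + 1)) \<le> ln (2 * (ln x / L + 1))"
    by (subst ln_le_cancel_iff) auto
  thus ?thesis using assms by linarith
qed

text \<open>For j >= 1 the terms of \<open>sum_ln_quotient_le\<close> decay by e^(-3/4) <= 1/2 each.
  The term j = 0 stays as \<open>Psi k x\<close>, and \<open>up\<close> is assumed only up to x / 2,
  so the lemma can be used inside an induction that has not yet reached x.\<close>

lemma sum_ln_quotient_le_rho: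
  assumes x: "x \<ge> 1" and L: "L > 0" and cond: "2 * ln (2 * (ln x / L + 1)) \<le> L / 4"
    and up: "\<And>z. 1 \<le> z \<Longrightarrow> z \<le> x / 2 \<Longrightarrow> Psi k z \<le> z * dickman_rho (ln z / L)"
  shows "(\<Sum>n\<in>smooth_upto k x. ln (x / n)) \<le> Psi k x + x * dickman_rho (ln x / L)"
proof -
  let ?m = "nat \<lfloor>ln x\<rfloor>" and ?r = "dickman_rho (ln x / L)"
  have r: "?r > 0" using x L by (intro rho_pos) auto
  have terms: "Psi k (x * exp (- real j)) \<le> x * ?r * (1/2) ^ j" if j: "1 \<le> j" "j \<le> ?m" for j
  proof -
    define z where "z = x * exp (- real j)"
    have "real j \<le> ln x" using j x by linarith
    hence "exp (real j) \<le> x" using x by (simp add: ln_ge_iff)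
    hence z1: "z \<ge> 1" unfolding z_def by (simp add: exp_minus field_simps)
    have "exp (real j) \<ge> 2" using exp_ge_add_one_self[of "real j"] j by linarith
    hence z2: "z \<le> x / 2" unfolding z_def using x by (simp add: exp_minus field_simps)
    have "x / z = exp (real j)" unfolding z_def using x by (simp add: exp_minus field_simps)
    hence "(x / z) powr (1/4) = exp (real j / 4)" by (simp add: powr_def)
    moreover have "dickman_rho (ln z / L) \<le> ?r * (x / z) powr (1/4)"
      by (rule rho_rescale_le) (use L z1 z2 cond x in auto)
    ultimately have "Psi k z \<le> z * (?r * exp (real j / 4))"
      by (intro order_trans[OF up[OF z1 z2]] mult_left_mono) (use z1 in auto)
    also have "\<dots> = x * ?r * exp (- (3 / 4)) ^ j" unfolding z_def
      by (simp add: exp_of_nat_mult[symmetric] mult_ac flip: exp_add)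
    also have "\<dots> \<le> x * ?r * (1/2) ^ j"
    proof (intro mult_left_mono power_mono)
      have "exp (3/4::real) \<ge> 1 + 3/4 + (3/4)^2/2" by (rule exp_lower_Taylor_quadratic) auto
      hence "exp (3/4::real) \<ge> 2" by (simp add: power2_eq_square)
      thus "exp (- (3 / 4::real)) \<le> 1/2" by (simp add: exp_minus field_simps)
    qed (use x r in auto)
    finally show ?thesis unfolding z_def .
  qed
  have geo: "(\<Sum>j=1..m. (1/2::real) ^ j) \<le> 1" for m
  proof -
    have "(\<Sum>j=1..m. (1/2::real) ^ j) = 1 - (1/2) ^ m" by (induction m) auto
    thus ?thesis by simp
  qed
  have "(\<Sum>n\<in>smooth_upto k x. ln (x / n)) \<le> (\<Sum>j\<le>?m. Psi k (x * exp (- real j)))"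
    by (rule sum_ln_quotient_le[OF x])
  also have "{..?m} = insert 0 {1..?m}" by auto
  also have "(\<Sum>j\<in>insert 0 {1..?m}. Psi k (x * exp (- real j))) = Psi k x + (\<Sum>j=1..?m. Psi k (x * exp (- real j)))"
    by simp
  also have "(\<Sum>j=1..?m. Psi k (x * exp (- real j))) \<le> (\<Sum>j=1..?m. x * ?r * (1/2) ^ j)"
    by (intro sum_mono terms) auto
  also have "\<dots> = x * ?r * (\<Sum>j=1..?m. (1/2) ^ j)" by (simp add: sum_distrib_left)
  also have "\<dots> \<le> x * ?r * 1" by (intro mult_left_mono geo) (use x r in auto)
  finally show ?thesis by simp
qed

lemma rho_rescaled_integral:
  assumes "L > 0" "0 \<le> b" "b \<le> X"
  shows "((\<lambda>v. dickman_rho ((X - v) / L)) has_integral (L * integral {(X - b) / L..X / L} dickman_rho)) {0..b}"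
proof -
  define a where "a = (X - b) / L"
  have a: "a \<ge> 0" "a \<le> X / L" unfolding a_def using assms by (auto intro!: divide_right_mono)
  define F where "F = (\<lambda>v. - (L * integral {a..(X - v) / L} dickman_rho))"
  have "((\<lambda>v. dickman_rho ((X - v) / L)) has_integral F b - F 0) {0..b}"
  proof (rule fundamental_theorem_of_calculus_interior)
    show "continuous_on {0..b} F" unfolding F_def
      by (intro continuous_intros continuous_on_compose2[OF rho_integral_continuous[OF a(1), of "X / L"]])
         (use assms in \<open>auto simp: a_def intro!: divide_right_mono\<close>)
    fix v assume v: "v \<in> {0<..<b}"
    have gt: "(X - v) / L > a" using v assms by (auto simp: a_def divide_strict_right_mono)
    have "((\<lambda>w. integral {a..w} dickman_rho) has_real_derivative dickman_rho ((X - v) / L)) (at ((X - v) / L))"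
      by (rule rho_integral_deriv) (use gt a in auto)
    moreover have "((\<lambda>v. (X - v) / L) has_real_derivative (- 1 / L)) (at v)"
      using assms by (auto intro!: derivative_eq_intros)
    ultimately have "((\<lambda>v. integral {a..(X - v) / L} dickman_rho) has_real_derivative dickman_rho ((X - v) / L) * (- 1 / L)) (at v)"
      by (rule DERIV_chain2[where f = "\<lambda>w. integral {a..w} dickman_rho"])
    from DERIV_minus[OF DERIV_cmult[OF this, of L]]
    have "(F has_real_derivative dickman_rho ((X - v) / L)) (at v)"
      unfolding F_def using assms by simp
    thus "(F has_vector_derivative dickman_rho ((X - v) / L)) (at v)"
      by (simp add: has_real_derivative_iff_has_vector_derivative)
  qed (use assms in auto)
  thus ?thesis by (simp add: F_def a_def)
qed

text \<open>The averaging identity after v = L (u - w), with u = X / L. With X = log x and v = log d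
  it is the continuous counterpart of \<open>sum_ln_smooth\<close>.\<close>

lemma rho_rescaled_integral_full:
  assumes "L > 0" "X \<ge> L"
  shows "integral {0..L} (\<lambda>v. dickman_rho ((X - v) / L)) = X * dickman_rho (X / L)"
proof -
  have "integral {0..L} (\<lambda>v. dickman_rho ((X - v) / L)) = L * integral {X / L - 1..X / L} dickman_rho"
    using rho_rescaled_integral[of L L X] assms by (simp add: diff_divide_distrib integral_unique)
  also have "\<dots> = L * (X / L * dickman_rho (X / L))"
    using rho_integral[of "X / L"] assms by simp
  finally show ?thesis using assms by simp
qed

lemma continuous_on_rho_rescaled:
  assumes "L > 0" "b \<le> X"
  shows "continuous_on {a..b} (\<lambda>v. dickman_rho ((X - v) / L))"
  by (intro continuous_on_compose2[OF continuous_on_rho[of "{0..}"]] continuous_intros)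
     (use assms in auto)

text \<open>Enlarging the scale from \<open>J\<close> to \<open>L \<ge> J + K\<close> adds at least \<open>K * g J\<close> to the integral of \<open>g\<close>, which
  dominates the Mertens error \<open>9 * g J\<close>, the prime powers and the difference between \<open>ln n\<close> and \<open>ln x\<close>.\<close>

lemma Psi_upper:
  obtains K where "K \<ge> 1"
    "\<And>J L x. L \<ge> real J + K \<Longrightarrow> x \<ge> 1 \<Longrightarrow> 2 * ln (2 * (ln x / L + 1)) \<le> L / 4 \<Longrightarrow>
       Psi (nat \<lfloor>exp (real J)\<rfloor>) x \<le> x * dickman_rho (ln x / L)"
proof -
  obtain C where C: "C \<ge> 0" "\<And>F. finite F \<Longrightarrow> (\<And>d. d \<in> F \<Longrightarrow> \<not> prime d) \<Longrightarrow>
      (\<Sum>d\<in>F. \<Lambda> d * real d powr (- (3/4))) \<le> C"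
    using proper_primepow_sum_bounded by blast
  \<comment> \<open>9 for the Mertens error, C for the proper prime powers, 1 for the summand
    \<open>x * r\<close> in B below, and 1 because moving \<open>Psi k x\<close> from B to the left
    turns log x into log x - 1.\<close>
  define K where "K = 11 + C"
  have "Psi (nat \<lfloor>exp (real J)\<rfloor>) x \<le> x * dickman_rho (ln x / L)"
    if L: "L \<ge> real J + K" and "x \<ge> 1" "x \<le> 2 ^ n" "2 * ln (2 * (ln x / L + 1)) \<le> L / 4" for J L n x
    using that(2-)
  \<comment> \<open>Dyadic induction on the bound for x suffices because the identity involves Psi
    only at x / d with d >= 2, the term d = 1 having weight \<Lambda>(1) = 0.\<close>
  proof (induction n arbitrary: x)
    case 0
    hence "ln x / L \<ge> 0" "ln x / L \<le> 1" using L C by (auto simp: K_def)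
    thus ?case using rho_le_1[of "ln x / L"] Psi_le[of x] 0 by simp
  next
    case (Suc n)
    define k where "k = nat \<lfloor>exp (real J)\<rfloor>"
    define r where "r = dickman_rho (ln x / L)"
    have L1: "L \<ge> 11" using L C by (simp add: K_def)
    have x: "x \<ge> 1" by fact
    show ?case
    proof (cases "ln x \<le> L")
      case True
      hence "ln x / L \<ge> 0" "ln x / L \<le> 1" using L1 x by auto
      thus ?thesis using rho_le_1[of "ln x / L"] Psi_le[of x] x by simp
    next
      case False
      have r: "r > 0" unfolding r_def using x L1 by (intro rho_pos) auto
      have up: "Psi k z \<le> z * dickman_rho (ln z / L)" if "1 \<le> z" "z \<le> x / 2" for z
      proof (unfold k_def, rule Suc.IH)
        show "2 * ln (2 * (ln z / L + 1)) \<le> L / 4"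
          by (rule log_rate_cond_mono[of L z x]) (use that Suc.prems L1 in auto)
      qed (use that Suc.prems in auto)
      let ?S = "smooth_upto k x"
      define g where "g = (\<lambda>v. dickman_rho ((ln x - v) / L))"
      have JL: "real J < L" using L C by (simp add: K_def)
      have gmono: "g v \<le> g w" if "0 \<le> v" "v \<le> w" "w \<le> L" for v w
        unfolding g_def by (rule rho_antimono) (use that False L1 in \<open>auto intro!: divide_right_mono\<close>)
      have gint: "g integrable_on {a..b}" if "b \<le> L" for a b
        unfolding g_def by (intro integrable_continuous_real continuous_on_rho_rescaled) (use that False L1 in auto)
      have g0: "g 0 = r" by (simp add: g_def r_def)
      have kx: "real k \<le> x"
      proof -
        have "exp (real J) \<le> exp (ln x)" using JL False by simp
        thus ?thesis unfolding k_def using x by simp linarith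
      qed
      have upd: "Psi k (x / d) \<le> x / d * g (ln d)" if d: "d \<ge> 2" "real d \<le> x" for d :: nat
      proof -
        have "1 \<le> x / d" "x / d \<le> x / 2" using d x by (auto simp: field_simps)
        from up[OF this] show ?thesis using d x by (simp add: g_def ln_div)
      qed
      have small: "(\<Sum>d=1..k. \<Lambda> d * Psi k (x / d)) \<le> x * (integral {0..real J} g + 9 * g J)"
      proof -
        have "(\<Sum>d=1..k. \<Lambda> d * Psi k (x / d)) \<le> (\<Sum>d=1..k. x * (\<Lambda> d / real d * g (ln d)))"
        proof (rule sum_mono)
          fix d assume d: "d \<in> {1..k}"
          show "\<Lambda> d * Psi k (x / d) \<le> x * (\<Lambda> d / real d * g (ln d))"
          proof (cases "d = 1")
            case False
            have "\<Lambda> d * Psi k (x / d) \<le> \<Lambda> d * (x / d * g (ln d))"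
              by (intro mult_left_mono upd mangoldt_nonneg) (use d False kx in auto)
            thus ?thesis by (simp add: mult_ac)
          qed auto
        qed
        also have "\<dots> = x * (\<Sum>d=1..k. \<Lambda> d / real d * g (ln d))" by (simp add: sum_distrib_left)
        also have "\<dots> \<le> x * (integral {0..real J} g + 9 * g J)"
        proof (rule mult_left_mono)
          have "\<bar>(\<Sum>d=1..k. \<Lambda> d / real d * g (ln d)) - integral {0..real J} g\<bar> \<le> 9 * g J"
            unfolding k_def
          proof (rule mertens_abel)
            show "continuous_on {0..real J} g" unfolding g_def
              by (rule continuous_on_rho_rescaled) (use L1 JL False in auto)
          qed (use gmono JL g0 r in auto)
          thus "(\<Sum>d=1..k. \<Lambda> d / real d * g (ln d)) \<le> integral {0..real J} g + 9 * g J"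
            by (simp add: abs_le_iff)
        qed (use x in auto)
        finally show ?thesis .
      qed
      \<comment> \<open>A smooth d > k is not prime, so \<Lambda> lives on proper prime powers
        here.\<close>
      have large: "(\<Sum>d\<in>{d\<in>?S. d > k}. \<Lambda> d * Psi k (x / d)) \<le> x * r * C"
      proof -
        have "(\<Sum>d\<in>{d\<in>?S. d > k}. \<Lambda> d * Psi k (x / d))
            \<le> (\<Sum>d\<in>{d\<in>?S. d > k}. x * r * (\<Lambda> d * real d powr (- (3/4))))"
        proof (rule sum_mono)
          fix d assume d: "d \<in> {d\<in>?S. d > k}"
          hence d1: "real d \<ge> 1" "real d \<le> x" by (auto simp: smooth_upto_def)
          show "\<Lambda> d * Psi k (x / d) \<le> x * r * (\<Lambda> d * real d powr (- (3/4)))"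
          proof (cases "d = 1")
            case False
            have "g (ln d) = dickman_rho (ln (x / d) / L)" using d1 x by (simp add: g_def ln_div)
            also have "\<dots> \<le> r * (x / (x / d)) powr (1/4)" unfolding r_def
              by (rule rho_rescale_le) (use d1 x L1 Suc.prems in \<open>auto simp: field_simps\<close>)
            finally have "x / d * g (ln d) \<le> x / d * (r * (x / (x / d)) powr (1/4))"
              by (rule mult_left_mono) (use x d1 in auto)
            moreover have "Psi k (x / d) \<le> x / d * g (ln d)" using upd d1 False by simp
            ultimately have "Psi k (x / d) \<le> x / d * (r * (x / (x / d)) powr (1/4))" by linarith
            also have "x / d * (r * (x / (x / d)) powr (1/4)) = x * r * (real d powr (1/4) / real d powr 1)"
              using x d1 by simp
            also have "real d powr (1/4) / real d powr 1 = real d powr (- (3/4))"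
              using powr_diff[of "real d" "1/4" 1] by simp
            finally have "Psi k (x / d) \<le> x * r * real d powr (- (3/4))" .
            hence "\<Lambda> d * Psi k (x / d) \<le> \<Lambda> d * (x * r * real d powr (- (3/4)))"
              by (intro mult_left_mono mangoldt_nonneg)
            thus ?thesis by (simp add: mult_ac)
          qed auto
        qed
        also have "\<dots> = x * r * (\<Sum>d\<in>{d\<in>?S. d > k}. \<Lambda> d * real d powr (- (3/4)))"
          by (simp add: sum_distrib_left)
        also have "\<dots> \<le> x * r * C"
        proof (rule mult_left_mono[OF C(2)])
          show "\<not> prime d" if "d \<in> {d\<in>?S. d > k}" for d
            using that by (auto simp: smooth_upto_def)
        qed (use x r in auto)
        finally show ?thesis .
      qed
      have S_split: "?S = {1..k} \<union> {d\<in>?S. d > k}"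
        using atLeastAtMost_subset_smooth_upto[of x k k] kx x by (auto simp: smooth_upto_def)
      have "(\<Sum>n\<in>?S. ln n) = (\<Sum>d=1..k. \<Lambda> d * Psi k (x / d)) + (\<Sum>d\<in>{d\<in>?S. d > k}. \<Lambda> d * Psi k (x / d))"
        unfolding sum_ln_smooth by (subst S_split, rule sum.union_disjoint) auto
      also note small
      also note large
      finally have A: "(\<Sum>n\<in>?S. ln n) \<le> x * (integral {0..real J} g + 9 * g J) + x * r * C" by simp
      have B: "(\<Sum>n\<in>?S. ln (x / n)) \<le> Psi k x + x * r"
        unfolding r_def by (rule sum_ln_quotient_le_rho) (use x L1 Suc.prems up in auto)
      have "Psi k x * ln x = (\<Sum>n\<in>?S. ln (x / n)) + (\<Sum>n\<in>?S. ln n)"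
      proof -
        have "(\<Sum>n\<in>?S. ln (x / n)) + (\<Sum>n\<in>?S. ln n) = (\<Sum>n\<in>?S. ln x)"
          unfolding sum.distrib[symmetric] by (rule sum.cong) (use x in \<open>auto simp: ln_div smooth_upto_def\<close>)
        thus ?thesis by (simp add: Psi_def)
      qed
      hence "Psi k x * (ln x - 1) \<le> x * (integral {0..real J} g + 9 * g J + (C + 1) * r)"
        using A B by (simp add: algebra_simps)
      also have "\<dots> \<le> x * (r * ln x - r)"
      proof (rule mult_left_mono)
        have "K * g J \<le> (L - real J) * g J"
          using L gmono[of 0 J] g0 r JL by (intro mult_right_mono) auto
        also have "\<dots> = integral {real J..L} (\<lambda>_. g J)" using JL by simp
        also have "\<dots> \<le> integral {real J..L} g"
          by (rule integral_le) (use gint gmono in auto)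
        also have "\<dots> = integral {0..L} g - integral {0..real J} g"
          using Henstock_Kurzweil_Integration.integral_combine[of 0 "real J" L g] gint JL by simp
        also have "integral {0..L} g = ln x * r"
          unfolding g_def r_def by (rule rho_rescaled_integral_full) (use L1 False in auto)
        finally have "K * g J + integral {0..real J} g \<le> ln x * r" by simp
        moreover have "(C + 2) * r \<le> (C + 2) * g J"
          using gmono[of 0 J] g0 JL C by (intro mult_left_mono) auto
        ultimately show "integral {0..real J} g + 9 * g J + (C + 1) * r \<le> r * ln x - r"
          by (simp add: K_def algebra_simps)
      qed (use x in auto)
      finally have "Psi k x * (ln x - 1) \<le> x * r * (ln x - 1)" by (simp add: algebra_simps)
      hence "Psi k x \<le> x * r"
        using False L1 by (subst (asm) mult_le_cancel_right_pos) auto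
      thus ?thesis by (simp add: k_def r_def)
    qed
  qed
  moreover have "\<exists>n. x \<le> 2 ^ n" for x :: real using real_arch_pow[of 2 x] less_imp_le by auto
  moreover have "K \<ge> 1" using C by (simp add: K_def)
  ultimately show ?thesis using that by meson
qed

text \<open>The \<open>- 1\<close> accounts for rounding when \<open>x \<le> exp J\<close>. In the inductive step it costs at most \<open>4 * exp J\<close>
  by Chebyshev; capping \<open>g\<close> at \<open>M = J - 13\<close> gains \<open>13 * g M\<close>, of which 9 parts pay for the Mertens error.\<close>

lemma Psi_lower:
  assumes J: "J \<ge> 26" and "x \<ge> 1" and "2 * ln (2 * (ln x / (real J - 13) + 1)) \<le> (real J - 13) / 4"
  shows "Psi (nat \<lfloor>exp (real J)\<rfloor>) x \<ge> x * dickman_rho (ln x / (real J - 13)) - 1"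
proof -
  define M where "M = real J - 13"
  define k where "k = nat \<lfloor>exp (real J)\<rfloor>"
  \<comment> \<open>J >= 26 is what makes J <= 2M, used in \<open>eM\<close>.\<close>
  have M: "M \<ge> 13" "2 * M \<ge> real J" "real J = M + 13" using J by (auto simp: M_def)
  have "Psi k x \<ge> x * dickman_rho (ln x / M) - 1"
    if "x \<ge> 1" "x \<le> 2 ^ n" "2 * ln (2 * (ln x / M + 1)) \<le> M / 4" for n x
    using that
  proof (induction n arbitrary: x)
    case 0
    have "x * dickman_rho (ln x / M) \<le> x * 1" using 0 M by (intro mult_left_mono rho_bounds) auto
    thus ?case using Psi_nonneg[of k x] 0 by simp
  next
    case (Suc n)
    have x: "x \<ge> 1" by fact
    show ?case
    proof (cases "ln x \<le> J")
      case True
      hence "x \<le> exp (real J)" using x by (metis exp_le_cancel_iff exp_ln less_le_trans zero_less_one)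
      hence "x < real k + 1" unfolding k_def by linarith
      moreover have "x * dickman_rho (ln x / M) \<le> x * 1" using x M by (intro mult_left_mono rho_bounds) auto
      ultimately show ?thesis using Psi_ge[of x k] x by linarith
    next
      case False
      define r where "r = dickman_rho (ln x / M)"
      define g where "g = (\<lambda>v. dickman_rho ((ln x - v) / M))"
      \<comment> \<open>Uncapped, the Mertens error would be 9 g(J), which the gain over [M, J] need
        not cover. The cap lowers the weights, which is the admissible direction for a lower
        bound.\<close>
      define h where "h = (\<lambda>v. g (min v M))"
      let ?S = "smooth_upto k x"
      have r: "r > 0" unfolding r_def using x M by (intro rho_pos) auto
      have low: "Psi k z \<ge> z * dickman_rho (ln z / M) - 1" if "1 \<le> z" "z \<le> x / 2" for z
      proof (rule Suc.IH)
        show "2 * ln (2 * (ln z / M + 1)) \<le> M / 4"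
          by (rule log_rate_cond_mono[of M z x]) (use that Suc.prems M in auto)
      qed (use that Suc.prems in auto)
      have expJ: "exp (real J) \<le> x"
        using False x by (metis exp_le_cancel_iff exp_ln less_le_trans linear zero_less_one)
      have kx: "real k \<le> x" "real k \<le> exp (real J)" using expJ unfolding k_def by (simp; linarith)+
      have gmono: "g v \<le> g w" if "0 \<le> v" "v \<le> w" "w \<le> real J" for v w
        unfolding g_def by (rule rho_antimono) (use that False M in \<open>auto intro!: divide_right_mono\<close>)
      have hmono: "h v \<le> h w" if "0 \<le> v" "v \<le> w" "w \<le> real J" for v w
        unfolding h_def by (rule gmono) (use that M in auto)
      have gcont: "continuous_on {0..real J} g" unfolding g_def
        by (rule continuous_on_rho_rescaled) (use M False in auto)
      have hcont: "continuous_on {0..real J} h" unfolding h_def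
        by (rule continuous_on_compose2[OF gcont]) (use M in \<open>auto intro!: continuous_intros\<close>)
      have hint: "h integrable_on {a..b}" if "0 \<le> a" "b \<le> real J" for a b
        by (intro integrable_continuous_real continuous_on_subset[OF hcont]) (use that in auto)
      have h0: "h 0 = r" using M by (simp add: h_def g_def r_def)
      have hJ: "h J = g M" using M by (simp add: h_def)
      have terms: "Psi k (x / d) \<ge> x / d * h (ln d) - 1" if d: "d \<ge> 2" "d \<le> k" for d :: nat
      proof -
        have dx: "real d \<le> x" "real d \<le> exp (real J)" using d kx by auto
        hence "ln d \<le> ln (exp (real J))" using d by (subst ln_le_cancel_iff) auto
        hence "h (ln d) \<le> g (ln d)" unfolding h_def using d M by (intro gmono) auto
        hence "x / d * h (ln d) \<le> x / d * g (ln d)" using x by (intro mult_left_mono) auto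
        moreover have "1 \<le> x / d" "x / d \<le> x / 2" using d x dx by (auto simp: field_simps)
        note low[OF this]
        ultimately show ?thesis using d x by (simp add: g_def ln_div)
      qed
      have gM: "g M = dickman_rho (ln x / M - 1)" "ln x / M - 1 \<ge> 0"
        using M False by (auto simp: g_def diff_divide_distrib)
      \<comment> \<open>Lets the remaining four parts \<open>4 * g M\<close> pay for the Chebyshev
        loss. When log x > 2M, the factor x outweighs the decay of \<rho>: 3/4 log x + M/2 >= 2M >=
        J.\<close>
      have eM: "exp (real J) \<le> x * g M"
      proof (cases "ln x / M - 1 \<le> 1")
        case True
        hence "g M = 1" using gM by (simp add: rho_le_1)
        thus ?thesis using expJ by simp
      next
        case u: False
        have "dickman_rho 1 \<le> dickman_rho (ln x / M - 1) * exp (M / 4 * ((ln x / M - 1) - 1))"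
        proof (rule rho_le_exp)
          have "ln (2 * ((ln x / M - 1) + 1)) \<le> ln (2 * (ln x / M + 1))"
            using u by (subst ln_le_cancel_iff) auto
          thus "2 * ln (2 * ((ln x / M - 1) + 1)) \<le> M / 4" using Suc.prems by linarith
        qed (use u in auto)
        also have "dickman_rho (ln x / M - 1) = g M" using gM by simp
        also have "M / 4 * ((ln x / M - 1) - 1) = ln x / 4 - M / 2" using M by (simp add: field_simps)
        finally have "1 \<le> g M * exp (ln x / 4 - M / 2)" by (simp add: rho_le_1)
        hence "exp (- (ln x / 4 - M / 2)) \<le> g M" by (simp add: exp_minus field_simps)
        hence "exp (ln x) * exp (- (ln x / 4 - M / 2)) \<le> x * g M"
          using x by (simp add: mult_left_mono)
        moreover have "real J \<le> ln x + - (ln x / 4 - M / 2)" using u M by (simp add: field_simps)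
        hence "exp (real J) \<le> exp (ln x) * exp (- (ln x / 4 - M / 2))"
          by (simp only: exp_le_cancel_iff flip: exp_add)
        ultimately show ?thesis by linarith
      qed
      have "x * (r * ln x) \<le> x * (ln x * r + 4 * g M) - 4 * exp (real J)"
        using eM by (simp add: algebra_simps)
      also have "ln x * r + 4 * g M \<le> integral {0..real J} h - 9 * g M"
      proof -
        have "integral {0..real J} h = integral {0..M} h + integral {M..real J} h"
          using Henstock_Kurzweil_Integration.integral_combine[of 0 M "real J" h] hint M by simp
        also have "integral {0..M} h = integral {0..M} g"
          by (rule integral_cong) (auto simp: h_def)
        also have "\<dots> = ln x * r" unfolding g_def r_def
          by (rule rho_rescaled_integral_full) (use M False in auto)
        also have "integral {M..real J} h = integral {M..real J} (\<lambda>_. g M)"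
          by (rule integral_cong) (auto simp: h_def min_def)
        also have "\<dots> = 13 * g M" using M by simp
        finally show ?thesis by simp
      qed
      also have "integral {0..real J} h - 9 * g M \<le> (\<Sum>d=1..k. \<Lambda> d / real d * h (ln d))"
      proof -
        have "\<bar>(\<Sum>d=1..k. \<Lambda> d / real d * h (ln d)) - integral {0..real J} h\<bar> \<le> 9 * h J"
          unfolding k_def by (rule mertens_abel) (use hmono h0 r hcont in auto)
        thus ?thesis using hJ by (simp add: abs_le_iff)
      qed
      also have "x * (\<Sum>d=1..k. \<Lambda> d / real d * h (ln d)) - 4 * exp (real J)
           \<le> (\<Sum>d=1..k. x * (\<Lambda> d / real d * h (ln d))) - chebyshev_psi k"
        using chebyshev_psi_le[of k] kx by (simp add: sum_distrib_left)
      also have "\<dots> = (\<Sum>d=1..k. \<Lambda> d * (x / d * h (ln d) - 1))"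
        by (simp add: chebyshev_psi_def sum_subtractf[symmetric] algebra_simps)
      also have "\<dots> \<le> (\<Sum>d=1..k. \<Lambda> d * Psi k (x / d))"
      proof (rule sum_mono)
        fix d assume d: "d \<in> {1..k}"
        show "\<Lambda> d * (x / d * h (ln d) - 1) \<le> \<Lambda> d * Psi k (x / d)"
        proof (cases "d = 1")
          case False
          show ?thesis by (intro mult_left_mono terms mangoldt_nonneg) (use d False in auto)
        qed auto
      qed
      also have "\<dots> \<le> (\<Sum>d\<in>?S. \<Lambda> d * Psi k (x / d))"
        by (intro sum_mono2 atLeastAtMost_subset_smooth_upto) (use kx x in \<open>auto intro!: mult_nonneg_nonneg mangoldt_nonneg Psi_nonneg\<close>)
      also have "\<dots> = (\<Sum>n\<in>?S. ln n)" by (rule sum_ln_smooth[symmetric])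
      \<comment> \<open>Replacing log n by log x goes in the favourable direction here, in contrast
        to the upper bound.\<close>
      also have "\<dots> \<le> (\<Sum>n\<in>?S. ln x)"
        by (rule sum_mono) (use x in \<open>auto simp: smooth_upto_def\<close>)
      also have "\<dots> = Psi k x * ln x" by (simp add: Psi_def)
      finally have "x * r * ln x \<le> Psi k x * ln x" using x by (simp add: mult_left_mono mult.assoc)
      moreover have "ln x > 0" using False J by linarith
      ultimately have "x * r \<le> Psi k x" by simp
      thus ?thesis by (simp add: r_def)
    qed
  qed
  moreover have "\<exists>n. x \<le> 2 ^ n" using real_arch_pow[of 2 x] less_imp_le by auto
  ultimately show ?thesis using assms unfolding M_def k_def by blast
qed

section \<open>Mean values and the resonator\<close>

text \<open>The function n^(it), written with \<open>cis\<close> so that modulus 1 and additivity in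
  t hold for every n; \<open>powr_eq_chi\<close> links it to the complex power for n > 0.\<close>

definition chi :: "nat \<Rightarrow> real \<Rightarrow> complex" where
  "chi n t = cis (t * ln (real n))"

lemma norm_chi [simp]: "cmod (chi n t) = 1" by (simp add: chi_def)

lemma chi_mult: "m > 0 \<Longrightarrow> n > 0 \<Longrightarrow> chi (m * n) t = chi m t * chi n t"
  by (simp add: chi_def ln_mult cis_mult distrib_left)

lemma chi_add: "chi n (s + t) = chi n s * chi n t"
  by (simp add: chi_def cis_mult distrib_right)

lemma continuous_on_chi [continuous_intros]:
  "continuous_on A f \<Longrightarrow> continuous_on A (\<lambda>t. chi n (f t))"
  unfolding chi_def cis_conv_exp by (intro continuous_intros)

lemma powr_eq_chi: "n > 0 \<Longrightarrow> (of_nat n :: complex) powr (\<i> * of_real t) = chi n t"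
  by (simp add: powr_def chi_def cis_conv_exp mult_ac flip: Ln_of_nat)

lemma norm_integral_cis_le:
  fixes w T :: real
  assumes "w \<noteq> 0" "T \<ge> 1"
  shows "cmod (integral {1..T} (\<lambda>t. cis (t * w))) \<le> 2 / \<bar>w\<bar>"
proof -
  define F where "F = (\<lambda>z::complex. exp (\<i> * of_real w * z) / (\<i> * of_real w))"
  have "((\<lambda>t. cis (t * w)) has_integral F (of_real T) - F (of_real 1)) {1..T}"
  proof (rule fundamental_theorem_of_calculus)
    fix t :: real
    have "(F has_field_derivative exp (\<i> * of_real w * of_real t)) (at (of_real t))"
      unfolding F_def using assms(1) by (auto intro!: derivative_eq_intros)
    hence "((\<lambda>t. F (of_real t)) has_vector_derivative exp (\<i> * of_real w * of_real t)) (at t within {1..T})"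
      by (rule has_vector_derivative_real_field)
    thus "((\<lambda>t. F (of_real t)) has_vector_derivative cis (t * w)) (at t within {1..T})"
      by (simp add: cis_conv_exp mult_ac)
  qed (use assms in auto)
  hence "integral {1..T} (\<lambda>t. cis (t * w)) = F (of_real T) - F (of_real 1)" by (rule integral_unique)
  moreover have "cmod (F (of_real t)) = 1 / \<bar>w\<bar>" for t :: real
    unfolding F_def by (simp add: norm_divide norm_mult norm_exp_eq_Re)
  ultimately show ?thesis using norm_triangle_ineq4[of "F (of_real T)" "F (of_real 1)"]
    by (metis (no_types, lifting) add_divide_distrib one_add_one)
qed

lemma abs_ln_diff_ge:
  assumes "0 < m" "m < n" "n \<le> X"
  shows "1 / real X \<le> \<bar>ln (real m) - ln (real n)\<bar>" "1 / real X \<le> \<bar>ln (real n) - ln (real m)\<bar>"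
proof -
  have "ln (real m / real n) \<le> real m / real n - 1"
    using assms by (intro ln_le_minus_one) auto
  also have "real m / real n \<le> (real n - 1) / real n"
    using assms by (intro divide_right_mono) auto
  also have "(real n - 1) / real n - 1 = - (1 / real n)" using assms by (simp add: diff_divide_distrib)
  also have "\<dots> \<le> - (1 / real X)" using assms by (simp add: frac_le)
  finally show "1 / real X \<le> \<bar>ln (real m) - ln (real n)\<bar>" "1 / real X \<le> \<bar>ln (real n) - ln (real m)\<bar>"
    using assms by (auto simp: ln_div)
qed

text \<open>The diagonal contributes T - 1 per term. Distinct frequencies log m, log n differ by at
  least 1 / X, so each off-diagonal integral is at most 2X. This crude error is affordable because
  X^2 will be far below T.\<close>

lemma mean_value:
  fixes a :: "nat \<Rightarrow> complex"
  assumes A: "A \<subseteq> {1..X}" and T: "T \<ge> 1"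
  shows "\<bar>integral {1..T} (\<lambda>t. (cmod (\<Sum>n\<in>A. a n * chi n t))\<^sup>2) - (T - 1) * (\<Sum>n\<in>A. (cmod (a n))\<^sup>2)\<bar>
     \<le> 2 * (real X)\<^sup>2 * (\<Sum>n\<in>A. (cmod (a n))\<^sup>2)"
proof -
  have fin: "finite A" using A finite_subset by blast
  define P where "P = (\<lambda>t. \<Sum>n\<in>A. a n * chi n t)"
  define S where "S = (\<Sum>n\<in>A. (cmod (a n))\<^sup>2)"
  define V where "V = (\<lambda>m n. integral {1..T} (\<lambda>t. cis (t * (ln (real m) - ln (real n)))))"
  have V: "((\<lambda>t. cis (t * (ln (real m) - ln (real n)))) has_integral V m n) {1..T}" for m n :: nat
    unfolding V_def
    by (intro integrable_integral integrable_continuous_real)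
       (auto intro!: continuous_intros simp: cis_conv_exp)
  have Vd: "V m m = of_real (T - 1)" for m unfolding V_def using T by (simp add: scaleR_conv_of_real)
  have Vn: "cmod (V m n) \<le> 2 * real X" if "m \<in> A" "n \<in> A" "m \<noteq> n" for m n
  proof -
    define w where "w = ln (real m) - ln (real n)"
    have X: "X > 0" using that A by fastforce
    have w: "1 / real X \<le> \<bar>w\<bar>" unfolding w_def
      using that A abs_ln_diff_ge[of m n X] abs_ln_diff_ge[of n m X] by (cases "m < n") (auto simp: subset_iff Suc_le_eq)
    moreover have "1 / real X > 0" using X by simp
    ultimately have w0: "\<bar>w\<bar> > 0" by linarith
    have "cmod (V m n) \<le> 2 / \<bar>w\<bar>" unfolding V_def w_def[symmetric]
      using norm_integral_cis_le[of w T] T w0 by simp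
    also have "\<dots> \<le> 2 * real X" using w w0 X by (simp add: field_simps)
    finally show ?thesis .
  qed
  have sq: "complex_of_real ((cmod (P t))\<^sup>2) = (\<Sum>m\<in>A. \<Sum>n\<in>A. a m * cnj (a n) * cis (t * (ln (real m) - ln (real n))))" for t
  proof -
    have "complex_of_real ((cmod (P t))\<^sup>2) = (\<Sum>m\<in>A. \<Sum>n\<in>A. (a m * chi m t) * cnj (a n * chi n t))"
      unfolding complex_norm_square P_def by (simp only: cnj_sum sum_product)
    also have "\<dots> = (\<Sum>m\<in>A. \<Sum>n\<in>A. a m * cnj (a n) * cis (t * (ln (real m) - ln (real n))))"
    proof (intro sum.cong refl)
      fix m n
      have "chi m t * cnj (chi n t) = cis (t * (ln (real m) - ln (real n)))"
        by (simp add: chi_def cis_cnj cis_mult algebra_simps)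
      thus "(a m * chi m t) * cnj (a n * chi n t) = a m * cnj (a n) * cis (t * (ln (real m) - ln (real n)))"
        by (metis complex_cnj_mult mult.assoc mult.left_commute)
    qed
    finally show ?thesis .
  qed
  define I where "I = (\<Sum>m\<in>A. \<Sum>n\<in>A. a m * cnj (a n) * V m n)"
  have "((\<lambda>t. complex_of_real ((cmod (P t))\<^sup>2)) has_integral I) {1..T}"
    unfolding sq I_def by (intro has_integral_sum fin has_integral_mult_right V)
  from has_integral_linear[OF this bounded_linear_Re]
  have "((\<lambda>t. Re (complex_of_real ((cmod (P t))\<^sup>2))) has_integral Re I) {1..T}"
    by (simp only: o_def)
  hence int: "integral {1..T} (\<lambda>t. (cmod (P t))\<^sup>2) = Re I" by (simp add: integral_unique)
  have "I - of_real ((T - 1) * S) = (\<Sum>m\<in>A. \<Sum>n\<in>A. if m = n then 0 else a m * cnj (a n) * V m n)"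
  proof -
    have "(\<Sum>m\<in>A. \<Sum>n\<in>A. if m = n then a m * cnj (a n) * V m n else 0) = of_real ((T - 1) * S)"
      using fin by (simp add: S_def Vd sum_distrib_left mult.commute flip: complex_norm_square)
    moreover have "I = (\<Sum>m\<in>A. \<Sum>n\<in>A. (if m = n then a m * cnj (a n) * V m n else 0) + (if m = n then 0 else a m * cnj (a n) * V m n))"
      unfolding I_def by (intro sum.cong) auto
    ultimately show ?thesis by (simp add: sum.distrib)
  qed
  also have "cmod \<dots> \<le> (\<Sum>m\<in>A. \<Sum>n\<in>A. cmod (if m = n then 0 else a m * cnj (a n) * V m n))"
    by (intro order_trans[OF norm_sum] sum_mono) auto
  also have "\<dots> \<le> (\<Sum>m\<in>A. \<Sum>n\<in>A. real X * ((cmod (a m))\<^sup>2 + (cmod (a n))\<^sup>2))"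
  proof (intro sum_mono)
    fix m n assume mn: "m \<in> A" "n \<in> A"
    show "cmod (if m = n then 0 else a m * cnj (a n) * V m n) \<le> real X * ((cmod (a m))\<^sup>2 + (cmod (a n))\<^sup>2)"
    proof (cases "m = n")
      case False
      have "cmod (a m * cnj (a n) * V m n) \<le> cmod (a m) * cmod (a n) * (2 * real X)"
        using Vn[OF mn False] by (simp add: norm_mult mult_left_mono)
      also have "\<dots> = real X * (2 * cmod (a m) * cmod (a n))" by simp
      also have "\<dots> \<le> real X * ((cmod (a m))\<^sup>2 + (cmod (a n))\<^sup>2)"
        by (intro mult_left_mono sum_squares_bound) auto
      finally show ?thesis using False by simp
    qed auto
  qed
  also have "\<dots> = real X * (2 * real (card A) * S)"
    by (simp add: S_def sum.distrib sum_distrib_left[symmetric])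
  also have "\<dots> \<le> real X * (2 * real X * S)"
  proof -
    have "card A \<le> X" using card_mono[OF _ A] by simp
    moreover have "S \<ge> 0" unfolding S_def by (intro sum_nonneg) auto
    ultimately show ?thesis by (intro mult_left_mono mult_right_mono) auto
  qed
  finally have "\<bar>Re (I - of_real ((T - 1) * S))\<bar> \<le> real X * (2 * real X * S)"
    using abs_Re_le_cmod order_trans by blast
  thus ?thesis using int unfolding P_def S_def by (simp add: power2_eq_square mult_ac)
qed

text \<open>Collect the indices of equal frequency: a coefficient is bounded by the size of its
  class, and the squared class sizes add up to the number of coinciding pairs.\<close>

lemma mean_value_multiset:
  fixes c :: "'i \<Rightarrow> complex" and \<kappa> :: "'i \<Rightarrow> nat"
  assumes I: "finite I" "\<And>i. i \<in> I \<Longrightarrow> \<kappa> i \<in> {1..X}" "\<And>i. i \<in> I \<Longrightarrow> cmod (c i) \<le> 1" and T: "T \<ge> 1"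
  shows "integral {1..T} (\<lambda>t. (cmod (\<Sum>i\<in>I. c i * chi (\<kappa> i) t))\<^sup>2)
     \<le> (T + 2 * (real X)\<^sup>2) * card {(i, j) \<in> I \<times> I. \<kappa> i = \<kappa> j}"
proof -
  define a where "a = (\<lambda>n. \<Sum>i | i \<in> I \<and> \<kappa> i = n. c i)"
  have "(\<Sum>i\<in>I. c i * chi (\<kappa> i) t) = (\<Sum>n\<in>\<kappa> ` I. a n * chi n t)" for t
  proof -
    have "(\<Sum>i\<in>I. c i * chi (\<kappa> i) t) = (\<Sum>n\<in>\<kappa> ` I. \<Sum>i | i \<in> I \<and> \<kappa> i = n. c i * chi (\<kappa> i) t)"
      by (rule sum.image_gen) (rule I)
    also have "\<dots> = (\<Sum>n\<in>\<kappa> ` I. a n * chi n t)"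
      unfolding a_def sum_distrib_right by (intro sum.cong) auto
    finally show ?thesis .
  qed
  moreover have "\<bar>integral {1..T} (\<lambda>t. (cmod (\<Sum>n\<in>\<kappa> ` I. a n * chi n t))\<^sup>2) - (T - 1) * (\<Sum>n\<in>\<kappa> ` I. (cmod (a n))\<^sup>2)\<bar>
     \<le> 2 * (real X)\<^sup>2 * (\<Sum>n\<in>\<kappa> ` I. (cmod (a n))\<^sup>2)"
    by (rule mean_value) (use I T in auto)
  moreover have s0: "(\<Sum>n\<in>\<kappa> ` I. (cmod (a n))\<^sup>2) \<ge> 0" by (intro sum_nonneg) auto
  ultimately have "integral {1..T} (\<lambda>t. (cmod (\<Sum>i\<in>I. c i * chi (\<kappa> i) t))\<^sup>2)
     \<le> (T + 2 * (real X)\<^sup>2) * (\<Sum>n\<in>\<kappa> ` I. (cmod (a n))\<^sup>2)"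
    by (simp add: algebra_simps abs_le_iff)
  also have "(\<Sum>n\<in>\<kappa> ` I. (cmod (a n))\<^sup>2) \<le> (\<Sum>n\<in>\<kappa> ` I. real (card {i\<in>I. \<kappa> i = n} * card {i\<in>I. \<kappa> i = n}))"
  proof (rule sum_mono)
    fix n
    have "cmod (a n) \<le> (\<Sum>i | i \<in> I \<and> \<kappa> i = n. 1)"
      unfolding a_def by (rule sum_norm_le) (use I in auto)
    hence "cmod (a n) \<le> real (card {i\<in>I. \<kappa> i = n})" by simp
    thus "(cmod (a n))\<^sup>2 \<le> real (card {i\<in>I. \<kappa> i = n} * card {i\<in>I. \<kappa> i = n})"
      using power_mono[of "cmod (a n)" "real (card {i\<in>I. \<kappa> i = n})" 2] by (simp add: power2_eq_square)
  qed
  also have "\<dots> = real (\<Sum>n\<in>\<kappa> ` I. \<Sum>i | i \<in> I \<and> \<kappa> i = n. card {j\<in>I. \<kappa> j = \<kappa> i})"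
    by simp
  also have "(\<Sum>n\<in>\<kappa> ` I. \<Sum>i | i \<in> I \<and> \<kappa> i = n. card {j\<in>I. \<kappa> j = \<kappa> i}) = (\<Sum>i\<in>I. card {j\<in>I. \<kappa> j = \<kappa> i})"
    by (rule sum.image_gen[symmetric]) (rule I)
  also have "\<dots> = card (SIGMA i:I. {j\<in>I. \<kappa> j = \<kappa> i})" by (rule card_SigmaI[symmetric]) (use I in auto)
  also have "(SIGMA i:I. {j\<in>I. \<kappa> j = \<kappa> i}) = {(i, j) \<in> I \<times> I. \<kappa> i = \<kappa> j}" by auto
  finally show ?thesis using T by (simp add: mult_left_mono)
qed

section \<open>Divisors of a power of a factorial and the resonator\<close>

definition bad_divisors :: "nat \<Rightarrow> nat \<Rightarrow> nat set" where
  "bad_divisors Q n = {d. d dvd Q \<and> \<not> n * d dvd Q}"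

lemma finite_bad_divisors: "Q > 0 \<Longrightarrow> finite (bad_divisors Q n)"
  unfolding bad_divisors_def by (rule finite_subset[of _ "{d. d dvd Q}"]) auto

text \<open>For a bad \<open>d\<close> the power of \<open>p\<close> in \<open>d\<close> is maximal, so the quotients of \<open>d\<close> by \<open>p ^ j\<close> for \<open>j < N\<close> are
  distinct divisors of \<open>Q\<close>.\<close>

lemma card_bad_prime:
  assumes p: "prime p" and Q: "Q > 0" "p ^ N dvd Q"
  shows "N * card (bad_divisors Q p) \<le> card {d. d dvd Q}"
proof -
  let ?B = "bad_divisors Q p"
  have cof: "\<exists>e. Q = d * e \<and> \<not> p dvd e \<and> p ^ N dvd d" if d: "d \<in> ?B" for d
  proof -
    obtain e where e: "Q = d * e" using d by (auto simp: bad_divisors_def)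
    have "\<not> p dvd e" using d e by (auto simp: bad_divisors_def mult_ac)
    moreover from this have "coprime (p ^ N) e" using p by (simp add: prime_imp_coprime)
    hence "p ^ N dvd d" using Q e by (metis coprime_dvd_mult_left_iff)
    ultimately show ?thesis using e by blast
  qed
  have sub: "p ^ j dvd d" if "d \<in> ?B" "j < N" for d j
    using cof[OF that(1)] that(2) le_imp_power_dvd[of j N p] dvd_trans by (metis less_imp_le)
  \<comment> \<open>With equal quotients and j < j', comparing both factorizations of Q would make
    the cofactor Q / d divisible by p.\<close>
  have main: "\<not> j < j'" if h: "d \<in> ?B" "d' \<in> ?B" "j < N" "j' < N" and eq: "d div p ^ j = d' div p ^ j'" for d d' j j'
  proof
    assume jj: "j < j'"
    obtain e where e: "Q = d * e" "\<not> p dvd e" using cof[OF h(1)] by blast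
    obtain e' where e': "Q = d' * e'" "\<not> p dvd e'" using cof[OF h(2)] by blast
    define m where "m = d div p ^ j"
    have d1: "d = m * p ^ j" unfolding m_def using sub[OF h(1,3)] by simp
    have d2: "d' = m * p ^ j'" unfolding m_def eq using sub[OF h(2,4)] by simp
    have "d * e = d' * e'" using e(1) e'(1) by simp
    hence "m * p ^ j * e = m * p ^ j' * e'" unfolding d1 d2 .
    moreover have "m > 0" using Q e d1 by (cases m) auto
    ultimately have "p ^ j * e = p ^ j' * e'" by (simp add: mult.assoc)
    also have "p ^ j' = p ^ j * (p * p ^ (j' - j - 1))" using jj
      by (simp flip: power_add power_Suc)
    finally have "e = p * p ^ (j' - j - 1) * e'" using prime_gt_0_nat[OF p] by simp
    thus False using e by simp
  qed
  have eqs: "d = d' \<and> j = j'"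
    if h: "d \<in> ?B" "d' \<in> ?B" "j < N" "j' < N" "d div p ^ j = d' div p ^ j'" for d d' j j'
  proof -
    have j: "j = j'" using main[OF h] main[OF h(2,1,4,3) h(5)[symmetric]] by linarith
    have "d = d div p ^ j * p ^ j" using sub[OF h(1,3)] by simp
    also have "\<dots> = d' div p ^ j' * p ^ j'" using h(5) j by simp
    also have "\<dots> = d'" using sub[OF h(2,4)] by simp
    finally show ?thesis using j by simp
  qed
  have inj: "inj_on (\<lambda>(d, j). d div p ^ j) (?B \<times> {..<N})"
    unfolding inj_on_def using eqs by auto
  have "N * card ?B = card ((\<lambda>(d, j). d div p ^ j) ` (?B \<times> {..<N}))"
    by (subst card_image[OF inj]) (simp add: card_cartesian_product)
  also have "\<dots> \<le> card {d. d dvd Q}"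
  proof (rule card_mono)
    show "(\<lambda>(d, j). d div p ^ j) ` (?B \<times> {..<N}) \<subseteq> {d. d dvd Q}"
    proof (rule image_subsetI)
      fix z assume z: "z \<in> ?B \<times> {..<N}"
      obtain d j where dj: "z = (d, j)" by (cases z)
      with z have h: "d \<in> ?B" "j < N" by auto
      have "d div p ^ j dvd d" using sub[OF h] by (metis dvd_div_mult_self dvd_triv_left)
      moreover have "d dvd Q" using h by (simp add: bad_divisors_def)
      ultimately show "(case z of (d, j) \<Rightarrow> d div p ^ j) \<in> {d. d dvd Q}"
        using dj by (auto intro: dvd_trans)
    qed
  qed (use Q in auto)
  finally show ?thesis .
qed

text \<open>If d is bad for p m, then either d is bad for p, or p d still divides Q and is bad for
  m; d determines p d and conversely.\<close>

lemma card_bad_mult: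
  assumes "Q > 0" "p > 0"
  shows "card (bad_divisors Q (p * m)) \<le> card (bad_divisors Q p) + card (bad_divisors Q m)"
proof -
  define E where "E = {d. p * d \<in> bad_divisors Q m}"
  have inj: "inj_on ((*) p) E" using assms by (auto intro: inj_onI)
  have img: "(*) p ` E \<subseteq> bad_divisors Q m" by (auto simp: E_def)
  have fE: "finite E" using finite_imageD[OF finite_subset[OF img finite_bad_divisors] inj] assms by simp
  have "card E \<le> card (bad_divisors Q m)"
    using card_image[OF inj] card_mono[OF finite_bad_divisors img] assms by simp
  moreover have "bad_divisors Q (p * m) \<subseteq> bad_divisors Q p \<union> E"
    by (auto simp: bad_divisors_def E_def mult_ac)
  hence "card (bad_divisors Q (p * m)) \<le> card (bad_divisors Q p \<union> E)"
    by (intro card_mono finite_UnI finite_bad_divisors fE assms)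
  moreover have "card (bad_divisors Q p \<union> E) \<le> card (bad_divisors Q p) + card E" by (rule card_Un_le)
  ultimately show ?thesis by linarith
qed

text \<open>Each prime factor of n, counted with multiplicity, spoils at most the fraction 1 / N of
  the divisors, because p^N divides (k!)^N for every p <= k. There are at most log n / log 2 such
  factors.\<close>

lemma card_bad_smooth:
  assumes "n > 0" "\<And>p. prime p \<Longrightarrow> p dvd n \<Longrightarrow> p \<le> k"
  shows "real N * ln 2 * real (card (bad_divisors (fact k ^ N) n)) \<le> ln n * real (card {d. d dvd (fact k ^ N :: nat)})"
  using assms
proof (induction n rule: prime_divisors_induct)
  case (unit x)
  thus ?case by (simp add: bad_divisors_def)
next
  case (factor p m)
  let ?Q = "fact k ^ N :: nat"
  let ?D = "real (card {d. d dvd ?Q})"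
  have Q: "?Q > 0" by simp
  have m: "m > 0" using factor.prems by auto
  have p: "p > 0" "p \<ge> 2" using prime_gt_0_nat prime_ge_2_nat factor.hyps by auto
  have "p dvd fact k" using factor p by (intro dvd_fact) auto
  hence "N * card (bad_divisors ?Q p) \<le> card {d. d dvd ?Q}"
    by (intro card_bad_prime factor.hyps Q dvd_power_same)
  hence "real N * real (card (bad_divisors ?Q p)) \<le> ?D"
    by (metis of_nat_le_iff of_nat_mult)
  hence "ln 2 * (real N * real (card (bad_divisors ?Q p))) \<le> ln p * ?D"
    using p by (intro mult_mono) auto
  moreover have "real N * ln 2 * real (card (bad_divisors ?Q m)) \<le> ln m * ?D"
    by (rule factor.IH) (use m factor.prems in auto)
  moreover have "real N * ln 2 * real (card (bad_divisors ?Q (p * m)))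
      \<le> real N * ln 2 * real (card (bad_divisors ?Q p) + card (bad_divisors ?Q m))"
    by (intro mult_left_mono of_nat_mono card_bad_mult) (use p in auto)
  ultimately show ?case using p m by (simp add: ln_mult algebra_simps)
qed auto

text \<open>Multiplying by \<open>chi n\<close> moves the frequency set D to nD, so after
  subtraction only the symmetric difference survives, with coefficients of modulus 1. Its two halves
  have equal size, the number of bad divisors.\<close>

lemma resonator_almost_invariant:
  assumes Q: "Q > 0" and n: "n > 0" "n * Q \<le> X" and T: "T \<ge> 1"
  shows "integral {1..T} (\<lambda>t. (cmod ((\<Sum>d | d dvd Q. chi d (t - \<alpha>)) * (chi n (t - \<alpha>) - 1)))\<^sup>2)
     \<le> (T + 2 * (real X)\<^sup>2) * (2 * card (bad_divisors Q n))"
proof -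
  define D where "D = {d. d dvd Q}"
  have fD: "finite D" using Q by (simp add: D_def)
  define E where "E = (*) n ` D"
  have inj: "inj_on ((*) n) D" using n by (auto intro: inj_onI)
  have fE: "finite E" using fD by (simp add: E_def)
  have cE: "card E = card D" unfolding E_def by (rule card_image[OF inj])
  have c1: "card (E - D) = card (bad_divisors Q n)"
  proof -
    have "E - D = (*) n ` bad_divisors Q n" by (auto simp: E_def D_def bad_divisors_def)
    moreover have "inj_on ((*) n) (bad_divisors Q n)" using n by (auto intro: inj_onI)
    ultimately show ?thesis by (simp add: card_image)
  qed
  have c2: "card (D - E) = card (E - D)"
    using fD fE cE card_Diff_subset_Int[of D E] card_Diff_subset_Int[of E D] by (simp add: Int_commute)
  define A where "A = (E - D) \<union> (D - E)"
  define a where "a = (\<lambda>m. (if m \<in> E then 1 else -1) * chi m (- \<alpha>))"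
  have D1: "d > 0" "d \<le> Q" if "d \<in> D" for d using that Q by (auto simp: D_def dvd_imp_le intro: Nat.gr0I)
  have E1: "d > 0" "d \<le> X" if dE: "d \<in> E" for d
  proof -
    obtain e where "e \<in> D" "d = n * e" using dE by (auto simp: E_def)
    thus "d > 0" "d \<le> X" using D1[of e] n by (auto intro: order_trans[OF mult_le_mono2])
  qed
  have "1 * Q \<le> n * Q" by (rule mult_le_mono1) (use n in simp)
  hence QX: "Q \<le> X" using n by linarith
  have AX: "A \<subseteq> {1..X}"
  proof
    fix m assume "m \<in> A"
    hence "m \<in> E \<or> m \<in> D" by (auto simp: A_def)
    thus "m \<in> {1..X}" using E1[of m] D1[of m] QX by auto
  qed
  have eq: "(\<Sum>d | d dvd Q. chi d (t - \<alpha>)) * (chi n (t - \<alpha>) - 1) = (\<Sum>m\<in>A. a m * chi m t)" for t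
  proof -
    have "(\<Sum>d\<in>D. chi d (t - \<alpha>)) * (chi n (t - \<alpha>) - 1)
       = (\<Sum>d\<in>D. chi (n * d) (t - \<alpha>)) - (\<Sum>d\<in>D. chi d (t - \<alpha>))"
    proof -
      have "chi (n * d) (t - \<alpha>) = chi d (t - \<alpha>) * chi n (t - \<alpha>)" if "d \<in> D" for d
        using chi_mult[of n d] D1[OF that] n by simp
      thus ?thesis by (simp add: right_diff_distrib sum_distrib_right)
    qed
    also have "(\<Sum>d\<in>D. chi (n * d) (t - \<alpha>)) = (\<Sum>m\<in>E. chi m (t - \<alpha>))"
      unfolding E_def by (simp add: sum.reindex[OF inj])
    also have "(\<Sum>m\<in>E. chi m (t - \<alpha>)) - (\<Sum>d\<in>D. chi d (t - \<alpha>))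
      = (\<Sum>m\<in>E - D. chi m (t - \<alpha>)) - (\<Sum>m\<in>D - E. chi m (t - \<alpha>))"
      using sum.Int_Diff[OF fE, of "\<lambda>m. chi m (t - \<alpha>)" D] sum.Int_Diff[OF fD, of "\<lambda>m. chi m (t - \<alpha>)" E]
      by (simp add: Int_commute)
    also have "(\<Sum>m\<in>E - D. chi m (t - \<alpha>)) = (\<Sum>m\<in>E - D. a m * chi m t)"
      by (intro sum.cong) (auto simp: a_def chi_add[of _ "-\<alpha>", symmetric])
    also have "(\<Sum>m\<in>D - E. chi m (t - \<alpha>)) = - (\<Sum>m\<in>D - E. a m * chi m t)"
      unfolding sum_negf[symmetric] by (intro sum.cong) (auto simp: a_def chi_add[of _ "-\<alpha>", symmetric])
    also have "(\<Sum>m\<in>E - D. a m * chi m t) - - (\<Sum>m\<in>D - E. a m * chi m t) = (\<Sum>m\<in>A. a m * chi m t)"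
      unfolding A_def using fD fE by (subst sum.union_disjoint) auto
    finally show ?thesis by (simp add: D_def)
  qed
  have "cmod (a m) = 1" for m by (simp add: a_def norm_mult)
  hence "(\<Sum>m\<in>A. (cmod (a m))\<^sup>2) = real (card A)" by simp
  also have "card A = 2 * card (bad_divisors Q n)"
    unfolding A_def using c1 c2 fD fE by (subst card_Un_disjoint) auto
  finally have s: "(\<Sum>m\<in>A. (cmod (a m))\<^sup>2) = 2 * real (card (bad_divisors Q n))" by simp
  show ?thesis unfolding eq
    using mean_value[OF AX T, of a] unfolding s by (simp add: abs_le_iff algebra_simps)
qed

lemma smooth_rough_decomp:
  fixes n :: nat
  assumes "n > 0"
  obtains a b where "n = a * b" "\<And>p. prime p \<Longrightarrow> p dvd a \<Longrightarrow> p \<le> k" "\<And>p. prime p \<Longrightarrow> p dvd b \<Longrightarrow> p > k"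
proof -
  have "\<exists>a b. n = a * b \<and> (\<forall>p. prime p \<longrightarrow> p dvd a \<longrightarrow> p \<le> k) \<and> (\<forall>p. prime p \<longrightarrow> p dvd b \<longrightarrow> p > k)"
    using assms
  proof (induction n rule: prime_divisors_induct)
    case (unit x)
    thus ?case by (intro exI[of _ 1]) auto
  next
    case (factor q m)
    hence "m > 0" by auto
    then obtain a b where ab: "m = a * b" "\<forall>p. prime p \<longrightarrow> p dvd a \<longrightarrow> p \<le> k" "\<forall>p. prime p \<longrightarrow> p dvd b \<longrightarrow> p > k"
      using factor.IH by blast
    have qd: "p = q" if "prime p" "p dvd q" for p
      using that factor.hyps primes_dvd_imp_eq by blast
    show ?case
    proof (cases "q \<le> k")
      case True
      have "\<forall>p. prime p \<longrightarrow> p dvd q * a \<longrightarrow> p \<le> k"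
        using ab(2) qd True by (auto simp: prime_dvd_mult_iff)
      thus ?thesis using ab by (intro exI[of _ "q * a"] exI[of _ b]) auto
    next
      case False
      have "\<forall>p. prime p \<longrightarrow> p dvd q * b \<longrightarrow> p > k"
        using ab(3) qd False by (auto simp: prime_dvd_mult_iff)
      thus ?thesis using ab by (intro exI[of _ a] exI[of _ "q * b"]) auto
    qed
  qed auto
  thus ?thesis using that by blast
qed

text \<open>A smooth factor is coprime to a rough one, so each rough part divides the other.\<close>

lemma smooth_rough_unique:
  fixes a b :: nat
  assumes eq: "a * b = a' * b'"
    and a: "\<And>p. prime p \<Longrightarrow> p dvd a \<Longrightarrow> p \<le> k" "\<And>p. prime p \<Longrightarrow> p dvd a' \<Longrightarrow> p \<le> k"
    and b: "\<And>p. prime p \<Longrightarrow> p dvd b \<Longrightarrow> p > k" "\<And>p. prime p \<Longrightarrow> p dvd b' \<Longrightarrow> p > k"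
  shows "b = b'"
proof (rule dvd_antisym)
  have cop: "coprime u v" if "\<And>p. prime p \<Longrightarrow> p dvd u \<Longrightarrow> p \<le> k" "\<And>p. prime p \<Longrightarrow> p dvd v \<Longrightarrow> p > k" for u v :: nat
  proof (rule ccontr)
    assume "\<not> coprime u v"
    then obtain p where "prime p" "p dvd u" "p dvd v"
      by (meson coprime_iff_gcd_eq_1 gcd_dvd1 gcd_dvd2 dvd_trans prime_factor_nat)
    thus False using that[of p] by force
  qed
  have "b dvd a' * b'" using eq by (metis dvd_triv_right)
  moreover have "coprime a' b" by (rule cop) (use a(2) b(1) in auto)
  ultimately show "b dvd b'" by (simp add: coprime_dvd_mult_right_iff coprime_commute)
  have "b' dvd a * b" using eq by (metis dvd_triv_right)
  moreover have "coprime a b'" by (rule cop) (use a(1) b(2) in auto)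
  ultimately show "b' dvd b" by (simp add: coprime_dvd_mult_right_iff coprime_commute)
qed

lemma dvd_fact_power_prime_le:
  assumes "prime p" "p dvd d" "d dvd (fact k ^ N :: nat)"
  shows "p \<le> k"
proof -
  have "p dvd fact k ^ N" using assms dvd_trans by blast
  hence "p dvd fact k" using assms(1) prime_dvd_power by blast
  thus ?thesis using assms(1) prime_dvd_fact_iff by blast
qed

text \<open>In d n = d' n' the divisors are smooth, so n and n' have the same rough part b, and b >
  k since n is not smooth. The smooth parts of n and n' together with b and d then determine
  d'.\<close>

lemma card_rough_collisions:
  fixes k N :: nat and x :: real
  assumes x: "x \<ge> 1"
  defines "D \<equiv> {d. d dvd (fact k ^ N :: nat)}" and "U \<equiv> {1..nat \<lfloor>x\<rfloor>} - smooth_upto k x"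
  shows "real (card {(i, j) \<in> (D \<times> U) \<times> (D \<times> U). fst i * snd i = fst j * snd j})
     \<le> real (card D) * (\<Sum>b=k+1..nat \<lfloor>x\<rfloor>. (Psi k (x / b))\<^sup>2)"
proof -
  let ?Q = "fact k ^ N :: nat"
  have fD: "finite D" unfolding D_def by (rule finite_divisors_nat) simp
  define W where "W = (SIGMA b:{k+1..nat \<lfloor>x\<rfloor>}. smooth_upto k (x / b) \<times> smooth_upto k (x / b) \<times> D)"
  have fW: "finite W" unfolding W_def using fD by (intro finite_SigmaI) auto
  \<comment> \<open>Rebuilds a collision from (b, a, a', d); d' is recovered by division.\<close>
  define f where "f = (\<lambda>(b, a, a', d). ((d, a * b), (d * (a * b) div (a' * b), a' * b)) :: (nat \<times> nat) \<times> (nat \<times> nat))"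
  have "{(i, j) \<in> (D \<times> U) \<times> (D \<times> U). fst i * snd i = fst j * snd j} \<subseteq> f ` W"
  proof clarsimp
    fix d n d' n' assume h: "d \<in> D" "n \<in> U" "d' \<in> D" "n' \<in> U" and eq: "d * n = d' * n'"
    have n: "n > 0" "real n \<le> x" "n' > 0" "real n' \<le> x"
      using h x by (auto simp: U_def le_nat_iff le_floor_iff)
    obtain a b where ab: "n = a * b" "\<And>p. prime p \<Longrightarrow> p dvd a \<Longrightarrow> p \<le> k" "\<And>p. prime p \<Longrightarrow> p dvd b \<Longrightarrow> p > k"
      using smooth_rough_decomp[OF n(1)] by metis
    obtain a' b' where ab': "n' = a' * b'" "\<And>p. prime p \<Longrightarrow> p dvd a' \<Longrightarrow> p \<le> k" "\<And>p. prime p \<Longrightarrow> p dvd b' \<Longrightarrow> p > k"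
      using smooth_rough_decomp[OF n(3)] by metis
    have dp: "p \<le> k" if "prime p" "p dvd d * a \<or> p dvd d' * a'" for p
      using that h ab(2) ab'(2) dvd_fact_power_prime_le[of p _ k N] by (auto simp: D_def prime_dvd_mult_iff)
    have bb: "b = b'"
      by (rule smooth_rough_unique[of "d * a" b "d' * a'" b' k])
         (use eq ab ab' dp in \<open>auto simp: mult.assoc\<close>)
    have "b \<noteq> 1"
    proof
      assume "b = 1"
      hence "n \<in> smooth_upto k x" using ab n by (auto simp: smooth_upto_def)
      thus False using h by (simp add: U_def)
    qed
    then obtain p where p: "prime p" "p dvd b" using prime_factor_nat by blast
    have pos: "a > 0" "b > 0" "a' > 0" using n ab ab' by (auto intro: Nat.gr0I)
    have "b > k" using ab(3)[OF p] dvd_imp_le[OF p(2) pos(2)] by linarith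
    moreover have "b \<le> n" using ab pos by simp
    hence "real b \<le> x" using n by linarith
    hence "b \<le> nat \<lfloor>x\<rfloor>" by (simp add: le_nat_floor)
    moreover have "a \<in> smooth_upto k (x / b)" "a' \<in> smooth_upto k (x / b)"
      using n ab ab' bb pos by (auto simp: smooth_upto_def field_simps)
    ultimately have "(b, a, a', d) \<in> W" using h by (auto simp: W_def)
    moreover have "f (b, a, a', d) = ((d, n), (d', n'))"
    proof -
      have "d * (a * b) div (a' * b) = d'" using eq ab ab' bb n by simp
      thus ?thesis using ab ab' bb by (simp add: f_def)
    qed
    ultimately show "((d, n), (d', n')) \<in> f ` W" by (metis imageI)
  qed
  hence "card {(i, j) \<in> (D \<times> U) \<times> (D \<times> U). fst i * snd i = fst j * snd j} \<le> card (f ` W)"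
    by (intro card_mono finite_imageI fW)
  also have "\<dots> \<le> card W" by (rule card_image_le[OF fW])
  finally have "real (card {(i, j) \<in> (D \<times> U) \<times> (D \<times> U). fst i * snd i = fst j * snd j}) \<le> real (card W)"
    by (rule of_nat_mono)
  also have "card W = (\<Sum>b=k+1..nat \<lfloor>x\<rfloor>. card (smooth_upto k (x / b) \<times> smooth_upto k (x / b) \<times> D))"
    unfolding W_def by (rule card_SigmaI) (use fD in auto)
  also have "real \<dots> = (\<Sum>b=k+1..nat \<lfloor>x\<rfloor>. real (card D) * (Psi k (x / b))\<^sup>2)"
    by (simp add: card_cartesian_product Psi_def power2_eq_square mult_ac)
  also have "\<dots> = real (card D) * (\<Sum>b=k+1..nat \<lfloor>x\<rfloor>. (Psi k (x / b))\<^sup>2)"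
    by (simp add: sum_distrib_left)
  finally show ?thesis .
qed

text \<open>Chebyshev's inequality for the weight |R|^2: the integrand on the left is at most B^2 on
  S and nonpositive off S, where |f| > \<mu>.\<close>

lemma chebyshev_measure_bound:
  fixes f :: "real \<Rightarrow> complex" and R :: "real \<Rightarrow> complex"
  assumes f: "continuous_on {1..T} f" and R: "continuous_on {1..T} R"
    and bd: "\<And>t. cmod (R t) \<le> B" and lam: "\<mu> > 0"
  defines "S \<equiv> {t\<in>{1..T}. cmod (f t) \<le> \<mu>}"
  shows "S \<in> sets lebesgue" "emeasure lebesgue S = ennreal (measure lebesgue S)"
    "integral {1..T} (\<lambda>t. (cmod (R t))\<^sup>2) - integral {1..T} (\<lambda>t. (cmod (R t * f t))\<^sup>2) / \<mu>\<^sup>2 \<le> B\<^sup>2 * measure lebesgue S"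
proof -
  have "S = {1..T} \<inter> (\<lambda>t. cmod (f t)) -` {..\<mu>}" by (auto simp: S_def)
  also have "closed \<dots>" by (intro continuous_closed_preimage continuous_intros f closed_atMost)
  finally have "closed S" .
  moreover have "bounded S" by (rule bounded_subset[of "{1..T}"]) (auto simp: S_def)
  ultimately have "compact S" by (simp add: compact_eq_bounded_closed)
  hence lm: "S \<in> lmeasurable" by (rule lmeasurable_compact)
  thus "S \<in> sets lebesgue" by (rule fmeasurableD)
  show "emeasure lebesgue S = ennreal (measure lebesgue S)" using lm by (rule emeasure_eq_measure2)
  have "((\<lambda>t. 1::real) has_integral measure lebesgue S) S"
    using lm by (simp add: lmeasure_integral has_integral_integral[symmetric] integrable_on_const)
  hence "((\<lambda>t. if t \<in> S then 1 else 0) has_integral measure lebesgue S) {1..T}"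
    by (subst has_integral_restrict) (auto simp: S_def)
  from has_integral_mult_right[OF this, of "B\<^sup>2"]
  have i1: "((\<lambda>t. B\<^sup>2 * (if t \<in> S then 1 else 0)) has_integral B\<^sup>2 * measure lebesgue S) {1..T}" .
  have i2: "((\<lambda>t. (cmod (R t))\<^sup>2) has_integral integral {1..T} (\<lambda>t. (cmod (R t))\<^sup>2)) {1..T}"
    by (intro integrable_integral integrable_continuous_real continuous_intros R)
  have "((\<lambda>t. (cmod (R t * f t))\<^sup>2) has_integral integral {1..T} (\<lambda>t. (cmod (R t * f t))\<^sup>2)) {1..T}"
    by (intro integrable_integral integrable_continuous_real continuous_intros R f)
  from has_integral_divide[OF this, of "\<mu>\<^sup>2"]
  have i3: "((\<lambda>t. (cmod (R t * f t))\<^sup>2 / \<mu>\<^sup>2) has_integral integral {1..T} (\<lambda>t. (cmod (R t * f t))\<^sup>2) / \<mu>\<^sup>2) {1..T}" .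
  show "integral {1..T} (\<lambda>t. (cmod (R t))\<^sup>2) - integral {1..T} (\<lambda>t. (cmod (R t * f t))\<^sup>2) / \<mu>\<^sup>2 \<le> B\<^sup>2 * measure lebesgue S"
  proof (rule has_integral_le[OF has_integral_diff[OF i2 i3] i1])
    fix t assume t: "t \<in> {1..T}"
    show "(cmod (R t))\<^sup>2 - (cmod (R t * f t))\<^sup>2 / \<mu>\<^sup>2 \<le> B\<^sup>2 * (if t \<in> S then 1 else 0)"
    proof (cases "t \<in> S")
      case True
      have "(cmod (R t))\<^sup>2 \<le> B\<^sup>2" by (intro power_mono bd) auto
      moreover have "(cmod (R t * f t))\<^sup>2 / \<mu>\<^sup>2 \<ge> 0" by simp
      ultimately have "(cmod (R t))\<^sup>2 - (cmod (R t * f t))\<^sup>2 / \<mu>\<^sup>2 \<le> B\<^sup>2" by linarith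
      thus ?thesis using True by simp
    next
      case False
      hence "\<mu>\<^sup>2 \<le> (cmod (f t))\<^sup>2" using t lam by (intro power_mono) (auto simp: S_def)
      hence "(cmod (R t))\<^sup>2 * \<mu>\<^sup>2 \<le> (cmod (R t))\<^sup>2 * (cmod (f t))\<^sup>2" by (intro mult_left_mono) auto
      thus ?thesis using False lam by (simp add: norm_mult power_mult_distrib field_simps)
    qed
  qed
qed

text \<open>Per divisor of Q, the mean of |R|^2 is at least T / 2, and that of |R F|^2 / \<mu>^2 is
  at most T / 4 by \<open>small\<close>. The surplus T / 4 must come from S, where |R|^2 is at most
  the squared number of divisors, and there are at most Q divisors.\<close>

lemma resonance:
  fixes k N :: nat and x T \<alpha> \<mu> :: real
  defines "Q \<equiv> (fact k ^ N :: nat)"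
  defines "F \<equiv> (\<lambda>t. (\<Sum>n=1..nat \<lfloor>x\<rfloor>. chi n t) - (\<Sum>n\<in>smooth_upto k x. chi n \<alpha>))"
  defines "S \<equiv> {t\<in>{1..T}. cmod (F t) \<le> \<mu>}"
  assumes N: "N \<ge> 1" and x: "x \<ge> 1" and T: "T \<ge> 4 * (real Q * x)\<^sup>2 + 2" and lam: "\<mu> > 0"
    and small: "16 * ln x * (Psi k x)\<^sup>2 / real N + 4 * (\<Sum>b=k+1..nat \<lfloor>x\<rfloor>. (Psi k (x / b))\<^sup>2) \<le> \<mu>\<^sup>2 / 4"
  shows "S \<in> sets lebesgue" "emeasure lebesgue S \<ge> ennreal (T / (4 * real Q))"
proof -
  define X where "X = Q * nat \<lfloor>x\<rfloor>"
  define D where "D = {d. d dvd Q}"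
  define G where "G = smooth_upto k x"
  define U where "U = {1..nat \<lfloor>x\<rfloor>} - G"
  define V where "V = (\<Sum>b=k+1..nat \<lfloor>x\<rfloor>. (Psi k (x / b))\<^sup>2)"
  \<comment> \<open>The shift by \<alpha> makes the weight favour t with n^(it) close to n^(i
    \<alpha>), rather than to 1, for smooth n.\<close>
  define R where "R = (\<lambda>t. \<Sum>d\<in>D. chi d (t - \<alpha>))"
  define F1 where "F1 = (\<lambda>t. \<Sum>n\<in>G. chi n \<alpha> * (chi n (t - \<alpha>) - 1))"
  define F2 where "F2 = (\<lambda>t. \<Sum>n\<in>U. chi n t)"
  have Q: "Q > 0" by (simp add: Q_def)
  have fD: "finite D" using Q by (simp add: D_def)
  have D0: "card D > 0" using fD Q by (auto simp: card_gt_0_iff D_def)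
  have DQ: "card D \<le> Q"
  proof -
    have "D \<subseteq> {1..Q}" using Q by (auto simp: D_def dvd_imp_le Suc_le_eq intro: Nat.gr0I)
    from card_mono[OF _ this] show ?thesis by simp
  qed
  have fG: "finite G" by (simp add: G_def)
  have GU: "{1..nat \<lfloor>x\<rfloor>} = G \<union> U" "G \<inter> U = {}"
    using smooth_upto_subset[of k x] by (auto simp: G_def U_def)
  have X: "real X \<le> real Q * x" unfolding X_def using x by (simp add: mult_left_mono)
  have "(real X)\<^sup>2 \<le> (real Q * x)\<^sup>2" by (intro power_mono X) auto
  hence T2: "2 * (2 * (real X)\<^sup>2) + 2 \<le> T" using T by linarith
  have "(real X)\<^sup>2 \<ge> 0" by simp
  hence T1: "T \<ge> 1" using T2 by linarith
  have DX: "d * n \<in> {1..X}" if "d \<in> D" "n \<in> {1..nat \<lfloor>x\<rfloor>}" for d n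
  proof -
    have "d \<le> Q" "d > 0" using that Q by (auto simp: D_def dvd_imp_le intro: Nat.gr0I)
    thus ?thesis using that unfolding X_def by (auto intro!: mult_le_mono simp: Suc_le_eq)
  qed
  have contR: "continuous_on A R" for A unfolding R_def by (intro continuous_intros)
  have contF1: "continuous_on A F1" for A unfolding F1_def by (intro continuous_intros)
  have contF2: "continuous_on A F2" for A unfolding F2_def by (intro continuous_intros)
  have F: "F t = F1 t + F2 t" for t
  proof -
    have "chi n \<alpha> * (chi n (t - \<alpha>) - 1) = chi n t - chi n \<alpha>" for n
      using chi_add[of n \<alpha> "t - \<alpha>"] by (simp add: algebra_simps)
    hence "F1 t = (\<Sum>n\<in>G. chi n t) - (\<Sum>n\<in>G. chi n \<alpha>)"
      by (simp add: F1_def sum_subtractf)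
    moreover have "(\<Sum>n=1..nat \<lfloor>x\<rfloor>. chi n t) = (\<Sum>n\<in>G. chi n t) + F2 t"
      unfolding GU(1) F2_def by (rule sum.union_disjoint) (use GU fG in \<open>auto simp: U_def\<close>)
    ultimately show ?thesis by (simp add: F_def G_def)
  qed
  have contF: "continuous_on A F" for A
    unfolding F[abs_def] by (intro continuous_intros contF1 contF2)
  have intg: "continuous_on {1..T} f \<Longrightarrow> f integrable_on {1..T}" for f :: "real \<Rightarrow> real"
    by (rule integrable_continuous_real)
  have R_low: "T / 2 * card D \<le> integral {1..T} (\<lambda>t. (cmod (R t))\<^sup>2)"
  proof -
    have "R t = (\<Sum>d\<in>D. chi d (-\<alpha>) * chi d t)" for t
      unfolding R_def by (simp add: chi_add[symmetric])
    moreover have "D \<subseteq> {1..X}"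
      using DX[of _ 1] x by (force simp: le_nat_iff)
    ultimately have "\<bar>integral {1..T} (\<lambda>t. (cmod (R t))\<^sup>2) - (T - 1) * real (card D)\<bar> \<le> 2 * (real X)\<^sup>2 * real (card D)"
      using mean_value[of D X T "\<lambda>d. chi d (-\<alpha>)"] T1 by simp
    hence "(T - 1 - 2 * (real X)\<^sup>2) * real (card D) \<le> integral {1..T} (\<lambda>t. (cmod (R t))\<^sup>2)"
      by (simp add: abs_le_iff algebra_simps)
    moreover have "T / 2 * real (card D) \<le> (T - 1 - 2 * (real X)\<^sup>2) * real (card D)"
      using T2 by (intro mult_right_mono) auto
    ultimately show ?thesis by linarith
  qed
  have up1: "integral {1..T} (\<lambda>t. (cmod (R t * F1 t))\<^sup>2) \<le> 8 * T * ln x * (Psi k x)\<^sup>2 / real N * card D"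
  proof -
    have "(cmod (R t * F1 t))\<^sup>2 \<le> (\<Sum>n\<in>G. Psi k x * (cmod (R t * (chi n (t - \<alpha>) - 1)))\<^sup>2)" for t
    proof -
      have "cmod (R t * F1 t) \<le> (\<Sum>n\<in>G. cmod (R t * (chi n (t - \<alpha>) - 1)))"
        unfolding F1_def sum_distrib_left
        by (rule order_trans[OF norm_sum]) (auto simp: norm_mult)
      hence "(cmod (R t * F1 t))\<^sup>2 \<le> (\<Sum>n\<in>G. cmod (R t * (chi n (t - \<alpha>) - 1)))\<^sup>2"
        by (intro power_mono) auto
      \<comment> \<open>Cauchy-Schwarz over G, so that each smooth n can be handled separately by
        \<open>resonator_almost_invariant\<close>.\<close>
      also have "\<dots> \<le> (\<Sum>n\<in>G. (cmod (R t * (chi n (t - \<alpha>) - 1)))\<^sup>2) * card G"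
        by (rule sum_squared_le_sum_of_squares)
      finally show ?thesis by (simp add: Psi_def G_def sum_distrib_left mult.commute)
    qed
    hence "integral {1..T} (\<lambda>t. (cmod (R t * F1 t))\<^sup>2)
       \<le> integral {1..T} (\<lambda>t. \<Sum>n\<in>G. Psi k x * (cmod (R t * (chi n (t - \<alpha>) - 1)))\<^sup>2)"
      by (intro integral_le intg continuous_intros contR contF1) auto
    also have "\<dots> = (\<Sum>n\<in>G. Psi k x * integral {1..T} (\<lambda>t. (cmod (R t * (chi n (t - \<alpha>) - 1)))\<^sup>2))"
    proof (subst integral_sum)
      show "(\<lambda>t. Psi k x * (cmod (R t * (chi n (t - \<alpha>) - 1)))\<^sup>2) integrable_on {1..T}" for n
        by (intro intg continuous_intros contR)
    qed (use fG in auto)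
    also have "\<dots> \<le> (\<Sum>n\<in>G. Psi k x * (8 * T * ln x / real N * card D))"
    proof (intro sum_mono mult_left_mono Psi_nonneg)
      fix n assume n: "n \<in> G"
      hence n1: "n > 0" "real n \<le> x" "n \<le> nat \<lfloor>x\<rfloor>" using smooth_upto_subset[of k x] by (auto simp: G_def smooth_upto_def)
      have "real N * ln 2 * real (card (bad_divisors Q n)) \<le> ln n * real (card D)"
        unfolding Q_def D_def by (rule card_bad_smooth) (use n in \<open>auto simp: G_def smooth_upto_def\<close>)
      also have "\<dots> \<le> ln x * real (card D)" using n1 by (intro mult_right_mono) auto
      finally have b: "real N * ln 2 * real (card (bad_divisors Q n)) \<le> ln x * real (card D)" .
      have ln2: "ln (2::real) \<ge> 1/2" using ln_le_minus_one[of "1/2::real"] by (simp add: ln_div)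
      have "real N * (1/2) * real (card (bad_divisors Q n)) \<le> real N * ln 2 * real (card (bad_divisors Q n))"
        using ln2 by (intro mult_right_mono mult_left_mono) auto
      hence "real N * (1/2) * real (card (bad_divisors Q n)) \<le> ln x * real (card D)" using b by linarith
      hence b2: "real (card (bad_divisors Q n)) \<le> 2 * ln x * real (card D) / real N"
        using N by (simp add: field_simps)
      have "integral {1..T} (\<lambda>t. (cmod (R t * (chi n (t - \<alpha>) - 1)))\<^sup>2)
          \<le> (T + 2 * (real X)\<^sup>2) * (2 * card (bad_divisors Q n))"
        unfolding R_def D_def
        by (rule resonator_almost_invariant) (use Q n1 T1 in \<open>auto simp: X_def mult.commute\<close>)
      also have "\<dots> \<le> (2 * T) * (2 * (2 * ln x * real (card D) / real N))"
        using T2 T1 b2 by (intro mult_mono) auto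
      finally show "integral {1..T} (\<lambda>t. (cmod (R t * (chi n (t - \<alpha>) - 1)))\<^sup>2) \<le> 8 * T * ln x / real N * card D"
        by (simp add: mult_ac)
    qed
    also have "\<dots> = 8 * T * ln x * (Psi k x)\<^sup>2 / real N * card D"
      by (simp add: Psi_def G_def power2_eq_square mult_ac)
    finally show ?thesis .
  qed
  have up2: "integral {1..T} (\<lambda>t. (cmod (R t * F2 t))\<^sup>2) \<le> 2 * T * (V * card D)"
  proof -
    have eq: "R t * F2 t = (\<Sum>i\<in>D \<times> U. chi (fst i) (-\<alpha>) * chi (fst i * snd i) t)" for t
    proof -
      have "R t * F2 t = (\<Sum>i\<in>D \<times> U. chi (fst i) (t - \<alpha>) * chi (snd i) t)"
        unfolding R_def F2_def by (simp add: sum_product sum.cartesian_product split_beta)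
      also have "\<dots> = (\<Sum>i\<in>D \<times> U. chi (fst i) (-\<alpha>) * chi (fst i * snd i) t)"
      proof (rule sum.cong)
        fix i assume i: "i \<in> D \<times> U"
        hence "fst i > 0" "snd i > 0" using Q by (auto simp: D_def U_def intro: Nat.gr0I)
        thus "chi (fst i) (t - \<alpha>) * chi (snd i) t = chi (fst i) (-\<alpha>) * chi (fst i * snd i) t"
          using chi_add[of "fst i" "-\<alpha>" t] by (simp add: chi_mult)
      qed auto
      finally show ?thesis .
    qed
    have "integral {1..T} (\<lambda>t. (cmod (R t * F2 t))\<^sup>2)
       \<le> (T + 2 * (real X)\<^sup>2) * card {(i, j) \<in> (D \<times> U) \<times> (D \<times> U). fst i * snd i = fst j * snd j}"
      unfolding eq
    proof (rule mean_value_multiset)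
      show "fst i * snd i \<in> {1..X}" if "i \<in> D \<times> U" for i
        using that by (intro DX) (auto simp: U_def)
    qed (use fD T1 in \<open>auto simp: U_def\<close>)
    also have "\<dots> \<le> (2 * T) * (real (card D) * V)"
    proof (intro mult_mono)
      show "real (card {(i, j) \<in> (D \<times> U) \<times> (D \<times> U). fst i * snd i = fst j * snd j}) \<le> real (card D) * V"
        unfolding D_def U_def V_def G_def Q_def by (rule card_rough_collisions[OF x])
    qed (use T2 T1 in auto)
    finally show ?thesis by (simp add: mult_ac)
  qed
  have "integral {1..T} (\<lambda>t. (cmod (R t * F t))\<^sup>2)
     \<le> integral {1..T} (\<lambda>t. 2 * (cmod (R t * F1 t))\<^sup>2 + 2 * (cmod (R t * F2 t))\<^sup>2)"
  proof (intro integral_le intg continuous_intros contR contF1 contF2 contF)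
    fix t
    have "cmod (R t * F t) \<le> cmod (R t * F1 t) + cmod (R t * F2 t)"
      unfolding F distrib_left by (rule norm_triangle_ineq)
    hence "(cmod (R t * F t))\<^sup>2 \<le> (cmod (R t * F1 t) + cmod (R t * F2 t))\<^sup>2"
      by (intro power_mono) auto
    also have "\<dots> \<le> 2 * (cmod (R t * F1 t))\<^sup>2 + 2 * (cmod (R t * F2 t))\<^sup>2"
      using sum_squares_bound[of "cmod (R t * F1 t)" "cmod (R t * F2 t)"] by (simp add: power2_sum)
    finally show "(cmod (R t * F t))\<^sup>2 \<le> 2 * (cmod (R t * F1 t))\<^sup>2 + 2 * (cmod (R t * F2 t))\<^sup>2" .
  qed
  also have "\<dots> = 2 * integral {1..T} (\<lambda>t. (cmod (R t * F1 t))\<^sup>2) + 2 * integral {1..T} (\<lambda>t. (cmod (R t * F2 t))\<^sup>2)"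
    by (subst integral_add) (auto intro!: intg continuous_intros contR contF1 contF2)
  also have "\<dots> \<le> T * card D * (16 * ln x * (Psi k x)\<^sup>2 / real N + 4 * V)"
  proof -
    have "T * card D * (16 * ln x * (Psi k x)\<^sup>2 / real N + 4 * V)
       = 2 * (8 * T * ln x * (Psi k x)\<^sup>2 / real N * card D) + 2 * (2 * T * (V * card D))"
      using N by (simp add: field_simps)
    thus ?thesis using up1 up2 by linarith
  qed
  also have "\<dots> \<le> T * card D * (\<mu>\<^sup>2 / 4)"
    using small T1 unfolding V_def by (intro mult_left_mono) auto
  finally have "integral {1..T} (\<lambda>t. (cmod (R t * F t))\<^sup>2) / \<mu>\<^sup>2 \<le> T / 4 * card D"
    using lam by (simp add: field_simps)
  moreover have "cmod (R t) \<le> real (card D)" for t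
    unfolding R_def by (rule order_trans[OF norm_sum]) simp
  note cheb = chebyshev_measure_bound[OF contF[of "{1..T}"] contR[of "{1..T}"] this lam, folded S_def]
  ultimately have "T / 4 * real (card D) \<le> (real (card D))\<^sup>2 * measure lebesgue S"
    using cheb(3) R_low by linarith
  hence "T / 4 \<le> real (card D) * measure lebesgue S"
    using D0 by (simp add: power2_eq_square mult.assoc)
  also have "\<dots> \<le> real Q * measure lebesgue S" using DQ by (intro mult_right_mono) auto
  finally have "T / (4 * real Q) \<le> measure lebesgue S" using Q by (simp add: field_simps)
  thus "emeasure lebesgue S \<ge> ennreal (T / (4 * real Q))" unfolding cheb(2) by (rule ennreal_leI)
  show "S \<in> sets lebesgue" by (rule cheb(1))
qed

section \<open>Choice of parameters\<close>

lemma norm_cis_diff_le: "cmod (cis a - cis b) \<le> \<bar>a - b\<bar>"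
proof -
  have "cis a - cis b = cis b * (cis (a - b) - 1)" by (simp add: cis_mult right_diff_distrib)
  hence "cmod (cis a - cis b) = cmod (exp (\<i> * of_real (a - b)) - 1)"
    by (simp add: norm_mult cis_conv_exp)
  also have "\<dots> \<le> \<bar>a - b\<bar>"
    unfolding dist_exp_i_1 using abs_sin_x_le_abs_x[of "(a - b) / 2"] by simp
  finally show ?thesis .
qed

text \<open>Replacing n^(i \<alpha>) by x^(i \<alpha>) costs |\<alpha>| log (x / n), and the sum of
  log (x / n) over smooth n is only of order x \<rho>(log x / L).\<close>

lemma smooth_sum_twist:
  assumes x: "x \<ge> 1" and L: "L > 0" and cond: "2 * ln (2 * (ln x / L + 1)) \<le> L / 4"
    and up: "\<And>z. 1 \<le> z \<Longrightarrow> z \<le> x \<Longrightarrow> Psi k z \<le> z * dickman_rho (ln z / L)"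
  shows "cmod ((\<Sum>n\<in>smooth_upto k x. chi n \<alpha>) - of_real (Psi k x) * cis (\<alpha> * ln x))
     \<le> \<bar>\<alpha>\<bar> * (2 * (x * dickman_rho (ln x / L)))"
proof -
  have "(\<Sum>n\<in>smooth_upto k x. chi n \<alpha>) - of_real (Psi k x) * cis (\<alpha> * ln x)
     = (\<Sum>n\<in>smooth_upto k x. chi n \<alpha> - cis (\<alpha> * ln x))"
    by (simp add: sum_subtractf Psi_def)
  also have "cmod \<dots> \<le> (\<Sum>n\<in>smooth_upto k x. \<bar>\<alpha>\<bar> * ln (x / n))"
  proof (rule sum_norm_le)
    fix n assume "n \<in> smooth_upto k x"
    hence n: "real n \<ge> 1" "real n \<le> x" by (auto simp: smooth_upto_def)
    have "cmod (chi n \<alpha> - cis (\<alpha> * ln x)) \<le> \<bar>\<alpha> * ln n - \<alpha> * ln x\<bar>"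
      unfolding chi_def by (rule norm_cis_diff_le)
    also have "\<dots> = \<bar>\<alpha>\<bar> * \<bar>ln n - ln x\<bar>" by (simp add: abs_mult flip: right_diff_distrib)
    also have "\<bar>ln n - ln x\<bar> = ln (x / n)" using n by (simp add: ln_div)
    finally show "cmod (chi n \<alpha> - cis (\<alpha> * ln x)) \<le> \<bar>\<alpha>\<bar> * ln (x / n)" .
  qed
  also have "\<dots> = \<bar>\<alpha>\<bar> * (\<Sum>n\<in>smooth_upto k x. ln (x / n))" by (simp add: sum_distrib_left)
  also have "\<dots> \<le> \<bar>\<alpha>\<bar> * (2 * (x * dickman_rho (ln x / L)))"
  proof (rule mult_left_mono)
    have "(\<Sum>n\<in>smooth_upto k x. ln (x / n)) \<le> Psi k x + x * dickman_rho (ln x / L)"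
      by (rule sum_ln_quotient_le_rho) (use x L cond up in auto)
    thus "(\<Sum>n\<in>smooth_upto k x. ln (x / n)) \<le> 2 * (x * dickman_rho (ln x / L))"
      using up[of x] x by simp
  qed auto
  finally show ?thesis .
qed

text \<open>Psi(x / b) is at most x \<rho> b^(-3/4). Its square splits into b^(-1/4), which gives
  the saving in k, and the summable b^(-5/4).\<close>

lemma rough_sum_le:
  obtains Z where "Z \<ge> 0"
    "\<And>x L k. x \<ge> 1 \<Longrightarrow> L > 0 \<Longrightarrow> 2 * ln (2 * (ln x / L + 1)) \<le> L / 4 \<Longrightarrow>
      (\<And>z. 1 \<le> z \<Longrightarrow> z \<le> x \<Longrightarrow> Psi k z \<le> z * dickman_rho (ln z / L)) \<Longrightarrow>
      (\<Sum>b=k+1..nat \<lfloor>x\<rfloor>. (Psi k (x / b))\<^sup>2) \<le> (x * dickman_rho (ln x / L))\<^sup>2 * (Z * (real k + 1) powr (-(1/4)))"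
proof
  define Z where "Z = (\<Sum>n. real n powr (-(5/4)))"
  have summ: "summable (\<lambda>n. real n powr (-(5/4)))" by (subst summable_real_powr_iff) auto
  show "0 \<le> Z" unfolding Z_def by (intro suminf_nonneg summ) auto
  fix x L :: real and k :: nat
  assume x: "x \<ge> 1" and L: "L > 0" and cond: "2 * ln (2 * (ln x / L + 1)) \<le> L / 4"
    and up: "\<And>z. 1 \<le> z \<Longrightarrow> z \<le> x \<Longrightarrow> Psi k z \<le> z * dickman_rho (ln z / L)"
  define r where "r = dickman_rho (ln x / L)"
  have r: "r > 0" unfolding r_def using x L by (intro rho_pos) auto
  have "(\<Sum>b=k+1..nat \<lfloor>x\<rfloor>. (Psi k (x / b))\<^sup>2)
     \<le> (\<Sum>b=k+1..nat \<lfloor>x\<rfloor>. (x * r)\<^sup>2 * ((real k + 1) powr (-(1/4)) * real b powr (-(5/4))))"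
  proof (rule sum_mono)
    fix b assume b: "b \<in> {k+1..nat \<lfloor>x\<rfloor>}"
    have b1: "real b \<ge> 1" "real k + 1 \<le> real b" using b by auto
    have b2: "real b \<le> x" using b x by (auto simp: le_nat_iff le_floor_iff)
    have "dickman_rho (ln (x / b) / L) \<le> r * (x / (x / b)) powr (1/4)" unfolding r_def
      by (rule rho_rescale_le) (use b1 b2 x L cond in \<open>auto simp: field_simps\<close>)
    hence "x / b * dickman_rho (ln (x / b) / L) \<le> x / b * (r * (x / (x / b)) powr (1/4))"
      by (rule mult_left_mono) (use x in auto)
    moreover have "Psi k (x / b) \<le> x / b * dickman_rho (ln (x / b) / L)"
      by (rule up) (use b1 b2 x in \<open>auto simp: field_simps\<close>)
    moreover have "x / b * (r * (x / (x / b)) powr (1/4)) = x * r * real b powr (-(3/4))"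
      using powr_diff[of "real b" "1/4" 1] x b1 by simp
    ultimately have "Psi k (x / b) \<le> x * r * real b powr (-(3/4))" by linarith
    hence "(Psi k (x / b))\<^sup>2 \<le> (x * r * real b powr (-(3/4)))\<^sup>2"
      by (intro power_mono Psi_nonneg)
    also have "\<dots> = (x * r)\<^sup>2 * (real b powr (-(1/4)) * real b powr (-(5/4)))"
      using b1 by (simp add: power_mult_distrib power2_eq_square flip: powr_add)
    also have "\<dots> \<le> (x * r)\<^sup>2 * ((real k + 1) powr (-(1/4)) * real b powr (-(5/4)))"
      using b1 by (intro mult_left_mono mult_right_mono powr_mono2') auto
    finally show "(Psi k (x / b))\<^sup>2 \<le> (x * r)\<^sup>2 * ((real k + 1) powr (-(1/4)) * real b powr (-(5/4)))" .
  qed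
  also have "\<dots> = (x * r)\<^sup>2 * ((real k + 1) powr (-(1/4)) * (\<Sum>b=k+1..nat \<lfloor>x\<rfloor>. real b powr (-(5/4))))"
    by (simp add: sum_distrib_left)
  also have "\<dots> \<le> (x * r)\<^sup>2 * ((real k + 1) powr (-(1/4)) * Z)"
    unfolding Z_def by (intro mult_left_mono sum_le_suminf summ) auto
  finally show "(\<Sum>b=k+1..nat \<lfloor>x\<rfloor>. (Psi k (x / b))\<^sup>2) \<le> (x * dickman_rho (ln x / L))\<^sup>2 * (Z * (real k + 1) powr (-(1/4)))"
    by (simp add: r_def mult.commute)
qed

lemma log_rate_mono:
  assumes "0 \<le> s" "0 \<le> w" "s / w \<le> (v::real)"
  shows "2 * ln (2 * (s / w + 1)) \<le> 2 * ln (2 * (v + 1))"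
proof -
  define q where "q = s / w"
  have "q \<ge> 0" "q \<le> v" using assms by (simp_all add: q_def)
  hence "ln (2 * (q + 1)) \<le> ln (2 * (v + 1))" by (intro ln_mono) auto
  hence "ln (2 * (s / w + 1)) \<le> ln (2 * (v + 1))" unfolding q_def .
  thus ?thesis by simp
qed

text \<open>\<rho>(log x / L) >= x^(-1/4), so the product is at least x^(3/4). It serves to absorb
  the \<open>- 1\<close> of \<open>Psi_lower\<close> into a relative error 1 / log x.\<close>

lemma x_rho_ge:
  assumes "x \<ge> 1" "L > 0" "2 * ln (2 * (ln x / L + 1)) \<le> L / 4"
  shows "ln x \<le> x * dickman_rho (ln x / L)"
proof -
  define s where "s = ln x"
  have s: "s \<ge> 0" using assms by (simp add: s_def)
  have "dickman_rho (ln 1 / L) \<le> dickman_rho (ln x / L) * (x / 1) powr (1/4)"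
    by (rule rho_rescale_le) (use assms in auto)
  hence "1 \<le> dickman_rho (ln x / L) * exp (s / 4)"
    using assms by (simp add: rho_le_1 powr_def s_def)
  hence "exp (- (s / 4)) \<le> dickman_rho (ln x / L)" by (simp add: exp_minus field_simps)
  hence "exp s * exp (- (s / 4)) \<le> x * dickman_rho (ln x / L)"
    using assms by (simp add: s_def)
  also have "exp s * exp (- (s / 4)) = exp (3 / 4 * s)" by (simp flip: exp_add)
  finally have "exp (3 / 4 * s) \<le> x * dickman_rho (ln x / L)" .
  moreover have "exp (3 / 4 * s) \<ge> 1 + 3 / 4 * s + (3 / 4 * s)\<^sup>2 / 2"
    by (rule exp_lower_Taylor_quadratic) (use s in auto)
  moreover have "1 + 3 / 4 * s + (3 / 4 * s)\<^sup>2 / 2 - s = 9 / 32 * (s - 4 / 9)\<^sup>2 + 17 / 18"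
    by (simp add: power2_eq_square field_simps)
  hence "1 + 3 / 4 * s + (3 / 4 * s)\<^sup>2 / 2 \<ge> s"
    using zero_le_power2[of "s - 4 / 9"] by linarith
  ultimately show ?thesis by (simp add: s_def)
qed

text \<open>The constant is 4 * 24 * 2: the rate up to s / M <= 2L is at most 2 log (L^2) = 4 l, the
  scales differ by at most 24 l, and 1 / (M L) <= 2 / L^2.\<close>

lemma rho_perturb:
  fixes L l M s :: real
  assumes L: "L \<ge> 1" "4 * L + 2 \<le> L\<^sup>2" and l: "l = ln L" "l \<ge> 1"
    and M: "L / 2 \<le> M" "L - M \<le> 24 * l" "M \<le> L" and s: "0 \<le> s" "s \<le> L\<^sup>2"
  shows "dickman_rho (s / M) \<ge> dickman_rho (s / L) * (1 - 192 * s * l\<^sup>2 / L\<^sup>2)"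
proof -
  have M0: "M > 0" using L M by linarith
  have sM: "s / M \<le> 2 * L"
  proof -
    have "s / M \<le> L\<^sup>2 / (L / 2)" using s L M by (intro frac_le) auto
    also have "\<dots> = 2 * L" using L by (simp add: power2_eq_square)
    finally show ?thesis .
  qed
  have "2 * ln (2 * (s / M + 1)) \<le> 2 * ln (2 * (2 * L + 1))"
    by (rule log_rate_mono) (use s M0 sM in auto)
  also have "\<dots> \<le> 2 * ln (L\<^sup>2)" using L by (intro mult_left_mono) (auto simp: algebra_simps)
  also have "\<dots> = 4 * l" using L l by (simp add: ln_realpow)
  finally have rate: "2 * ln (2 * (s / M + 1)) \<le> 4 * l" .
  have le: "s / L \<le> s / M" using s M M0 by (intro divide_left_mono) (use L in auto)
  have "dickman_rho (s / L) \<le> dickman_rho (s / M) * exp (4 * l * (s / M - s / L))"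
    by (rule rho_le_exp) (use s L le rate in auto)
  hence "dickman_rho (s / L) * exp (- (4 * l * (s / M - s / L)))
      \<le> dickman_rho (s / M) * exp (4 * l * (s / M - s / L)) * exp (- (4 * l * (s / M - s / L)))"
    by (rule mult_right_mono) simp
  also have "\<dots> = dickman_rho (s / M)" by (simp only: mult.assoc flip: exp_add) simp
  finally have A: "dickman_rho (s / L) * exp (- (4 * l * (s / M - s / L))) \<le> dickman_rho (s / M)" .
  have "s / M - s / L = s * (L - M) * (1 / (M * L))" using M0 L by (simp add: field_simps)
  also have "\<dots> \<le> s * (24 * l) * (1 / (L / 2 * L))"
    using s M M0 L l by (intro mult_mono divide_left_mono) auto
  also have "\<dots> = 48 * s * l / L\<^sup>2" by (simp add: power2_eq_square)
  finally have "4 * l * (s / M - s / L) \<le> 4 * l * (48 * s * l / L\<^sup>2)"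
    using l by (intro mult_left_mono) auto
  also have "\<dots> = 192 * s * l\<^sup>2 / L\<^sup>2" by (simp add: power2_eq_square)
  finally have "1 - 192 * s * l\<^sup>2 / L\<^sup>2 \<le> 1 + - (4 * l * (s / M - s / L))" by simp
  also have "\<dots> \<le> exp (- (4 * l * (s / M - s / L)))" by (rule exp_ge_add_one_self)
  finally have "dickman_rho (s / L) * (1 - 192 * s * l\<^sup>2 / L\<^sup>2)
      \<le> dickman_rho (s / L) * exp (- (4 * l * (s / M - s / L)))"
    using rho_pos[of "s / L"] s L by (intro mult_left_mono) auto
  with A show ?thesis by linarith
qed

text \<open>All demands on L = log log T, with K from \<open>Psi_upper\<close> and Z from
  \<open>rough_sum_le\<close>. The one with 128 L^6 + 1 bounds N k log k, hence log Q; the next two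
  compare Q with T and with the required measure.\<close>

definition large_param :: "real \<Rightarrow> real \<Rightarrow> real \<Rightarrow> bool" where
  "large_param K Z L \<longleftrightarrow> L \<ge> 52 \<and> ln L \<ge> 1 \<and> 10 * ln L \<ge> K \<and> 2 * ln (2 * (L + 1)) \<le> L / 4
     \<and> L - 10 * ln L - 14 \<ge> L / 2 \<and> 2 * ln (2 * (2 * L + 1)) \<le> L / 8
     \<and> (128 * L ^ 6 + 1) * L * exp (L - 10 * ln L) \<le> 129 * exp L / L ^ 3
     \<and> 2 + 258 * exp L / L ^ 3 + 2 * L\<^sup>2 \<le> exp L
     \<and> 2 + 129 * exp L / L ^ 3 \<le> 2 * exp L / L\<^sup>2
     \<and> 32 * Z * L ^ 4 \<le> exp ((L - 10 * ln L - 1) / 4) \<and> 4 * L + 2 \<le> L\<^sup>2"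

lemma eventually_large_param: "eventually (large_param K Z) at_top"
  unfolding large_param_def by (intro eventually_conj) real_asymp+

lemma fact_power_le:
  assumes "1 \<le> k"
  shows "real (fact k ^ N :: nat) \<le> exp (real N * real k * ln k)"
proof -
  have "fact k \<le> (real k) ^ k" using fact_le_power[of k, where ?'a = real] by simp
  hence "(fact k :: real) ^ N \<le> (real k ^ k) ^ N" by (intro power_mono) auto
  also have "\<dots> = exp (real N * real k * ln k)"
  proof -
    have "(real k ^ k) ^ N = real k ^ (k * N)" by (simp add: power_mult)
    also have "\<dots> = exp (real (k * N) * ln k)"
      using exp_of_nat_mult[of "k * N" "ln k"] assms by simp
    finally show ?thesis by (simp add: mult_ac)
  qed
  finally show ?thesis by simp
qed

text \<open>The first two assumptions are the conclusions of \<open>Psi_upper\<close> and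
  \<open>rough_sum_le\<close>, so that K and Z are fixed before L is chosen large.\<close>

lemma exponential_sum_large_x:
  fixes K Z L T x \<theta> :: real
  assumes K: "\<And>J L x. L \<ge> real J + K \<Longrightarrow> x \<ge> 1 \<Longrightarrow> 2 * ln (2 * (ln x / L + 1)) \<le> L / 4 \<Longrightarrow>
       Psi (nat \<lfloor>exp (real J)\<rfloor>) x \<le> x * dickman_rho (ln x / L)"
    and Z: "\<And>x L k. x \<ge> 1 \<Longrightarrow> L > 0 \<Longrightarrow> 2 * ln (2 * (ln x / L + 1)) \<le> L / 4 \<Longrightarrow>
      (\<And>z. 1 \<le> z \<Longrightarrow> z \<le> x \<Longrightarrow> Psi k z \<le> z * dickman_rho (ln z / L)) \<Longrightarrow>
      (\<Sum>b=k+1..nat \<lfloor>x\<rfloor>. (Psi k (x / b))\<^sup>2) \<le> (x * dickman_rho (ln x / L))\<^sup>2 * (Z * (real k + 1) powr (-(1/4)))"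
    and Z0: "Z \<ge> 0"
    and P: "large_param K Z L" and T: "T = exp (exp L)"
    and x: "x > 1" "ln x \<ge> 2" "ln x \<le> L\<^sup>2 / (ln L)\<^sup>2" and \<theta>: "\<bar>\<theta>\<bar> \<le> pi"
  shows "\<exists>S. S \<in> sets lebesgue \<and> S \<subseteq> {1..T} \<and> emeasure lebesgue S \<ge> ennreal (T powr (1 - 2 / ln x))
           \<and> (\<forall>t\<in>S. cmod ((\<Sum>n=1..nat \<lfloor>x\<rfloor>. chi n t) - of_real (x * dickman_rho (ln x / L)) * cis \<theta>)
               \<le> 192 * (1 / ln x + ln x * (ln L)\<^sup>2 / L\<^sup>2) * (x * dickman_rho (ln x / L)))"
proof -
  define l where "l = ln L"
  define s where "s = ln x"
  \<comment> \<open>J is an integer because \<open>mertens_abel\<close> works with unit blocks up to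
    J; e^J is about log T / L^10.\<close>
  define J where "J = nat \<lfloor>L - 10 * l\<rfloor>"
  define k where "k = nat \<lfloor>exp (real J)\<rfloor>"
  \<comment> \<open>N >= 128 s^3, so that 16 s (x r)^2 / N is at most (x r / s)^2 / 8.\<close>
  define N where "N = nat \<lceil>128 * L ^ 6\<rceil>"
  define Q where "Q = (fact k ^ N :: nat)"
  \<comment> \<open>With this shift x^(i \<alpha>) = e^(i \<theta>).\<close>
  define \<alpha> where "\<alpha> = \<theta> / s"
  define r where "r = dickman_rho (s / L)"
  \<comment> \<open>The upper bound for Psi holds at scale L itself, as J + K <= L; the lower bound
    lives at scale M, and L - M <= 10 l + 14 <= 24 l is repaired by
    \<open>rho_perturb\<close>.\<close>
  define M where "M = real J - 13"
  note P' = P[unfolded large_param_def, folded l_def]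
  have L: "L \<ge> 52" "l \<ge> 1" "10 * l \<ge> K" "2 * ln (2 * (L + 1)) \<le> L / 4"
     "L - 10 * l - 14 \<ge> L / 2" "2 * ln (2 * (2 * L + 1)) \<le> L / 8" "4 * L + 2 \<le> L\<^sup>2"
    using P' by blast+
  have s: "s \<ge> 2" "s \<le> L\<^sup>2" "s / L \<le> L"
  proof -
    show "s \<ge> 2" using x by (simp add: s_def)
    have "l\<^sup>2 \<ge> 1" using L by simp
    hence "L\<^sup>2 / l\<^sup>2 \<le> L\<^sup>2 / 1" by (intro divide_left_mono) auto
    thus "s \<le> L\<^sup>2" using x by (simp add: s_def l_def)
    thus "s / L \<le> L" using L by (simp add: field_simps power2_eq_square)
  qed
  have J: "real J \<le> L - 10 * l" "real J \<ge> L - 10 * l - 1" unfolding J_def using L by linarith+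
  have M: "M \<ge> L / 2" "L - M \<le> 24 * l" "M \<le> L" "J \<ge> 26" using J L unfolding M_def by linarith+
  have rpos: "r > 0" unfolding r_def using s L by (intro rho_pos) auto
  have x1: "x \<ge> 1" using x by simp
  have condL: "2 * ln (2 * (ln x / L + 1)) \<le> L / 4"
    using log_rate_mono[of s L L] s L by (simp add: s_def)
  have sM: "s / M \<le> 2 * L"
  proof -
    have "s / M \<le> L\<^sup>2 / (L / 2)" using s L M by (intro frac_le) auto
    also have "\<dots> = 2 * L" using L by (simp add: power2_eq_square)
    finally show ?thesis .
  qed
  have condM: "2 * ln (2 * (ln x / (real J - 13) + 1)) \<le> (real J - 13) / 4"
  proof -
    have "2 * ln (2 * (s / M + 1)) \<le> 2 * ln (2 * (2 * L + 1))"
      by (rule log_rate_mono) (use s L M sM in auto)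
    also have "\<dots> \<le> M / 4" using L M by linarith
    finally show ?thesis by (simp add: s_def M_def)
  qed
  have up: "Psi k z \<le> z * dickman_rho (ln z / L)" if "1 \<le> z" "z \<le> x" for z
    unfolding k_def
  proof (rule K)
    show "2 * ln (2 * (ln z / L + 1)) \<le> L / 4"
      by (rule log_rate_cond_mono[of L z x]) (use that condL L in auto)
  qed (use that J L in auto)
  have upx: "Psi k x \<le> x * r" using up[of x] x1 by (simp add: r_def s_def)
  have xr: "s \<le> x * r" unfolding r_def s_def by (rule x_rho_ge) (use x1 L condL in auto)
  have low: "Psi k x \<ge> x * r * (1 - 192 * s * l\<^sup>2 / L\<^sup>2) - x * r / s"
  proof -
    have "Psi k x \<ge> x * dickman_rho (s / M) - 1"
      using Psi_lower[OF M(4) x1 condM] by (simp add: k_def s_def M_def)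
    moreover have "dickman_rho (s / M) \<ge> r * (1 - 192 * s * l\<^sup>2 / L\<^sup>2)"
      unfolding r_def by (rule rho_perturb) (use L s M in \<open>auto simp: l_def\<close>)
    hence "x * dickman_rho (s / M) \<ge> x * (r * (1 - 192 * s * l\<^sup>2 / L\<^sup>2))"
      using x1 by (intro mult_left_mono) auto
    moreover have "1 \<le> x * r / s" using xr s by (simp add: field_simps)
    ultimately show ?thesis by (simp add: mult.assoc)
  qed
  have N1: "N \<ge> 1" "real N \<ge> 128 * L ^ 6" "real N \<le> 128 * L ^ 6 + 1"
  proof -
    have "L ^ 6 \<ge> 1" using L by (intro one_le_power) auto
    thus "real N \<ge> 128 * L ^ 6" "real N \<le> 128 * L ^ 6 + 1" "N \<ge> 1" unfolding N_def by linarith+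
  qed
  have k1: "k \<ge> 1" "real k \<le> exp (real J)" "exp (real J) \<le> real k + 1"
  proof -
    have "exp (real J) \<ge> 1" by simp
    thus "k \<ge> 1" "real k \<le> exp (real J)" "exp (real J) \<le> real k + 1" unfolding k_def by linarith+
  qed
  have Qle: "real Q \<le> exp (129 * exp L / L ^ 3)"
  proof -
    have "ln (real k) \<le> real J"
    proof -
      have "ln (real k) \<le> ln (exp (real J))" using k1 by (intro ln_mono) auto
      thus ?thesis by simp
    qed
    hence lnk: "ln (real k) \<le> L" using J L by linarith
    have "real k \<le> exp (L - 10 * l)"
      using k1 J by (meson exp_le_cancel_iff order_trans)
    hence "real N * real k * ln k \<le> (128 * L ^ 6 + 1) * exp (L - 10 * l) * L"
      using N1 k1 lnk L by (intro mult_mono) auto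
    also have "\<dots> = (128 * L ^ 6 + 1) * L * exp (L - 10 * l)" by simp
    also have "\<dots> \<le> 129 * exp L / L ^ 3" using P' by blast
    finally have "exp (real N * real k * ln k) \<le> exp (129 * exp L / L ^ 3)" by simp
    thus ?thesis unfolding Q_def using fact_power_le[OF k1(1), of N] by linarith
  qed
  have Q0: "Q > 0" by (simp add: Q_def)
  have xexp: "x \<le> exp (L\<^sup>2)"
  proof -
    have "exp (ln x) \<le> exp (L\<^sup>2)" using s by (simp add: s_def)
    thus ?thesis using x by simp
  qed
  have Tbig: "T \<ge> 4 * (real Q * x)\<^sup>2 + 2"
  proof -
    define B where "B = exp (129 * exp L / L ^ 3) * exp (L\<^sup>2)"
    have B1: "B \<ge> 1" unfolding B_def exp_add[symmetric] using L by simp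
    have "real Q * x \<le> B" unfolding B_def by (intro mult_mono Qle xexp) (use x in auto)
    hence "(real Q * x)\<^sup>2 \<le> B\<^sup>2" by (intro power_mono) (use x in auto)
    hence "4 * (real Q * x)\<^sup>2 + 2 \<le> 4 * B\<^sup>2 + 2 * B\<^sup>2" using B1 one_le_power[OF B1, of 2] by linarith
    also have "\<dots> \<le> exp 2 * B\<^sup>2"
    proof -
      have "exp (2::real) = exp 1 * exp 1" by (simp flip: exp_add)
      moreover have "exp (1::real) \<ge> 1 + 1 + 1\<^sup>2 / 2" by (rule exp_lower_Taylor_quadratic) simp
      hence "exp (1::real) \<ge> 5 / 2" by simp
      hence "exp (1::real) * exp 1 \<ge> 5 / 2 * (5 / 2)" by (intro mult_mono) auto
      ultimately have "exp (2::real) \<ge> 6" by simp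
      hence "6 * B\<^sup>2 \<le> exp 2 * B\<^sup>2" by (intro mult_right_mono) auto
      thus ?thesis by simp
    qed
    also have "\<dots> = exp (2 + 258 * exp L / L ^ 3 + 2 * L\<^sup>2)"
      unfolding B_def power2_eq_square by (simp flip: exp_add)
    also have "\<dots> \<le> T" unfolding T using P' by (subst exp_le_cancel_iff) blast
    finally show ?thesis .
  qed
  define \<mu> where "\<mu> = x * r / s"
  have mu: "\<mu> > 0" unfolding \<mu>_def using x rpos s by simp
  have small: "16 * ln x * (Psi k x)\<^sup>2 / real N + 4 * (\<Sum>b=k+1..nat \<lfloor>x\<rfloor>. (Psi k (x / b))\<^sup>2) \<le> \<mu>\<^sup>2 / 4"
  proof -
    have s6: "s ^ 3 \<le> L ^ 6" using power_mono[OF s(2), of 3] s by (simp flip: power_mult)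
    have "16 * s * (Psi k x)\<^sup>2 / real N \<le> 16 * s * (x * r)\<^sup>2 / (128 * s ^ 3)"
      using s N1 s6 upx Psi_nonneg by (intro frac_le mult_left_mono power_mono) auto
    also have "\<dots> = \<mu>\<^sup>2 / 8" unfolding \<mu>_def using s
      by (simp add: power2_eq_square power3_eq_cube field_simps)
    finally have A: "16 * ln x * (Psi k x)\<^sup>2 / real N \<le> \<mu>\<^sup>2 / 8" by (simp add: s_def)
    have "(\<Sum>b=k+1..nat \<lfloor>x\<rfloor>. (Psi k (x / b))\<^sup>2) \<le> (x * r)\<^sup>2 * (Z * (real k + 1) powr (-(1/4)))"
      unfolding r_def s_def by (rule Z) (use x1 L condL up in auto)
    moreover have "Z * (real k + 1) powr (-(1/4)) \<le> 1 / (32 * s\<^sup>2)"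
    proof -
      have "(real k + 1) powr (-(1/4)) \<le> exp (real J) powr (-(1/4))"
        using k1 by (intro powr_mono2') auto
      also have "\<dots> = exp (- (real J / 4))" by (simp add: powr_def)
      also have "\<dots> \<le> exp (- ((L - 10 * l - 1) / 4))" using J by simp
      finally have "Z * (real k + 1) powr (-(1/4)) \<le> Z * exp (- ((L - 10 * l - 1) / 4))"
        using Z0 by (intro mult_left_mono)
      moreover have "32 * s\<^sup>2 * Z \<le> 32 * L ^ 4 * Z"
        using power_mono[OF s(2), of 2] s Z0 by (intro mult_right_mono mult_left_mono) (auto simp flip: power_mult)
      hence "32 * s\<^sup>2 * Z \<le> exp ((L - 10 * l - 1) / 4)" using P' by (simp add: mult_ac)
      hence "Z * exp (- ((L - 10 * l - 1) / 4)) \<le> 1 / (32 * s\<^sup>2)"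
        using s by (simp add: exp_minus field_simps)
      ultimately show ?thesis by linarith
    qed
    hence "(x * r)\<^sup>2 * (Z * (real k + 1) powr (-(1/4))) \<le> (x * r)\<^sup>2 * (1 / (32 * s\<^sup>2))"
      by (intro mult_left_mono) auto
    moreover have "(x * r)\<^sup>2 * (1 / (32 * s\<^sup>2)) = \<mu>\<^sup>2 / 32"
      unfolding \<mu>_def by (simp add: power_divide)
    ultimately have "4 * (\<Sum>b=k+1..nat \<lfloor>x\<rfloor>. (Psi k (x / b))\<^sup>2) \<le> \<mu>\<^sup>2 / 8" by linarith
    with A show ?thesis by linarith
  qed
  define S where "S = {t\<in>{1..T}. cmod ((\<Sum>n=1..nat \<lfloor>x\<rfloor>. chi n t) - (\<Sum>n\<in>smooth_upto k x. chi n \<alpha>)) \<le> \<mu>}"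
  note res = resonance[OF N1(1) x1 Tbig[unfolded Q_def] mu small, of \<alpha>, folded S_def Q_def]
  \<comment> \<open>log (4Q) is at most 2 + 129 e^L / L^3 <= 2 e^L / L^2 <= 2 log T / log x; the
    last inequality uses log x <= L^2.\<close>
  have meas: "T powr (1 - 2 / ln x) \<le> T / (4 * real Q)"
  proof -
    have "4 * real Q \<le> exp 2 * exp (129 * exp L / L ^ 3)"
    proof (rule mult_mono[OF _ Qle])
      have "exp (2::real) \<ge> 1 + 2 + 2\<^sup>2 / 2" by (rule exp_lower_Taylor_quadratic) simp
      thus "exp (2::real) \<ge> 4" by simp
    qed auto
    also have "\<dots> = exp (2 + 129 * exp L / L ^ 3)" by (simp add: exp_add)
    also have "\<dots> \<le> exp (2 * exp L / s)"
    proof -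
      have "2 * exp L / L\<^sup>2 \<le> 2 * exp L / s" using s L by (intro divide_left_mono) auto
      thus ?thesis using P' by (subst exp_le_cancel_iff) linarith
    qed
    finally have "4 * real Q \<le> exp (2 * exp L / s)" .
    hence "T / exp (2 * exp L / s) \<le> T / (4 * real Q)"
      using Q0 by (intro divide_left_mono) (auto simp: T)
    moreover have "(1 - 2 / ln x) * exp L = exp L - 2 * exp L / s" by (simp add: s_def algebra_simps)
    hence "T powr (1 - 2 / ln x) = T / exp (2 * exp L / s)"
      unfolding T powr_def by (simp add: exp_diff)
    ultimately show ?thesis by simp
  qed
  have bound: "cmod ((\<Sum>n=1..nat \<lfloor>x\<rfloor>. chi n t) - of_real (x * r) * cis \<theta>)
      \<le> 192 * (1 / s + s * l\<^sup>2 / L\<^sup>2) * (x * r)" if t: "t \<in> S" for t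
  proof -
    define A where "A = (\<Sum>n=1..nat \<lfloor>x\<rfloor>. chi n t)"
    define G where "G = (\<Sum>n\<in>smooth_upto k x. chi n \<alpha>)"
    have 1: "cmod (A - G) \<le> x * r / s" using t by (simp add: S_def A_def G_def \<mu>_def)
    have "\<alpha> * ln x = \<theta>" using s by (simp add: \<alpha>_def s_def)
    hence "cmod (G - of_real (Psi k x) * cis \<theta>) \<le> \<bar>\<alpha>\<bar> * (2 * (x * r))"
      using smooth_sum_twist[of x L k \<alpha>] x1 L condL up by (simp add: G_def r_def s_def)
    also have "\<dots> \<le> (4 / s) * (2 * (x * r))"
    proof (rule mult_right_mono)
      have "\<bar>\<theta>\<bar> \<le> 4" using \<theta> pi_less_4 by linarith
      thus "\<bar>\<alpha>\<bar> \<le> 4 / s" unfolding \<alpha>_def using s by (simp add: abs_divide divide_right_mono)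
    qed (use x rpos in auto)
    finally have 2: "cmod (G - of_real (Psi k x) * cis \<theta>) \<le> 8 * (x * r / s)" by simp
    have "cmod (of_real (Psi k x) * cis \<theta> - of_real (x * r) * cis \<theta>) = \<bar>Psi k x - x * r\<bar>"
    proof -
      have "of_real (Psi k x) * cis \<theta> - of_real (x * r) * cis \<theta> = of_real (Psi k x - x * r) * cis \<theta>"
        by (simp add: left_diff_distrib)
      thus ?thesis by (simp only: norm_mult norm_of_real norm_cis) simp
    qed
    also have "\<dots> \<le> 192 * (s * l\<^sup>2 / L\<^sup>2) * (x * r) + x * r / s"
      using low upx by (simp add: algebra_simps)
    finally have 3: "cmod (of_real (Psi k x) * cis \<theta> - of_real (x * r) * cis \<theta>)
        \<le> 192 * (s * l\<^sup>2 / L\<^sup>2) * (x * r) + x * r / s" .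
    have "A - of_real (x * r) * cis \<theta> = (A - G) + (G - of_real (Psi k x) * cis \<theta>)
        + (of_real (Psi k x) * cis \<theta> - of_real (x * r) * cis \<theta>)" by simp
    also have "cmod \<dots> \<le> cmod (A - G) + cmod (G - of_real (Psi k x) * cis \<theta>)
        + cmod (of_real (Psi k x) * cis \<theta> - of_real (x * r) * cis \<theta>)"
      by (intro order_trans[OF norm_triangle_ineq] add_mono norm_triangle_ineq order_refl)
    \<comment> \<open>10 = 1 + 8 + 1: the deviation on S, the twist with |\<alpha>| <= 4 / s, and
      the absorbed \<open>- 1\<close> of the lower bound.\<close>
    also have "\<dots> \<le> 10 * (x * r / s) + 192 * (s * l\<^sup>2 / L\<^sup>2) * (x * r)"
    proof -
      have "a + b + c \<le> 10 * u + v" if "a \<le> u" "b \<le> 8 * u" "c \<le> v + u" for a b c u v :: real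
        using that by linarith
      from this[OF 1 2 3] show ?thesis .
    qed
    also have "\<dots> \<le> 192 * (x * r / s) + 192 * (s * l\<^sup>2 / L\<^sup>2) * (x * r)"
      using mu unfolding \<mu>_def by (intro add_right_mono mult_right_mono) auto
    also have "\<dots> = 192 * (1 / s + s * l\<^sup>2 / L\<^sup>2) * (x * r)" by (simp add: algebra_simps)
    finally show ?thesis by (simp add: A_def)
  qed
  show ?thesis
  proof (intro exI[of _ S] conjI ballI)
    show "S \<in> sets lebesgue" by (rule res(1))
    show "S \<subseteq> {1..T}" by (auto simp: S_def)
    show "emeasure lebesgue S \<ge> ennreal (T powr (1 - 2 / ln x))"
      using res(2) ennreal_leI[OF meas] by (rule order_trans[rotated])
  qed (use bound in \<open>simp add: r_def s_def l_def\<close>)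
qed

text \<open>For log x < 2 the exponent 1 - 2 / log x is negative and the permitted relative error
  exceeds 2, so the trivial bound on all of [1, T] suffices.\<close>

lemma exponential_sum_small_x:
  fixes T x \<theta> :: real
  assumes T: "T \<ge> 2" and x: "x > 1" "ln x < 2"
  shows "{1..T} \<in> sets lebesgue \<and> {1..T} \<subseteq> {1..T} \<and> emeasure lebesgue {1..T} \<ge> ennreal (T powr (1 - 2 / ln x))
           \<and> (\<forall>t\<in>{1..T}. cmod ((\<Sum>n=1..nat \<lfloor>x\<rfloor>. chi n t) - of_real x * cis \<theta>) \<le> 192 * (1 / ln x) * x)"
proof (intro conjI ballI)
  have l: "ln x > 0" using x by simp
  have "T powr (1 - 2 / ln x) \<le> T powr 0" using T x l by (intro powr_mono) (auto simp: field_simps)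
  also have "\<dots> \<le> T - 1" using T by simp
  finally show "emeasure lebesgue {1..T} \<ge> ennreal (T powr (1 - 2 / ln x))"
    using T by (simp add: ennreal_leI)
  fix t assume "t \<in> {1..T}"
  have "cmod (\<Sum>n=1..nat \<lfloor>x\<rfloor>. chi n t) \<le> real (nat \<lfloor>x\<rfloor>)"
    by (rule order_trans[OF norm_sum]) simp
  also have "\<dots> \<le> x" using x by simp
  finally have "cmod ((\<Sum>n=1..nat \<lfloor>x\<rfloor>. chi n t) - of_real x * cis \<theta>) \<le> 2 * x"
    using norm_triangle_ineq4[of "\<Sum>n=1..nat \<lfloor>x\<rfloor>. chi n t" "of_real x * cis \<theta>"] x by (simp add: norm_mult)
  also have "2 * x \<le> 192 * (1 / ln x) * x"
    using x l by (intro mult_right_mono) (auto simp: field_simps)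
  finally show "cmod ((\<Sum>n=1..nat \<lfloor>x\<rfloor>. chi n t) - of_real x * cis \<theta>) \<le> 192 * (1 / ln x) * x" .
qed auto

theorem theorem1p2:
  "\<exists>C T0. \<forall>T x \<theta>. T \<ge> T0 \<longrightarrow> x > 1
     \<longrightarrow> ln x \<le> (ln (ln T))\<^sup>2 / (ln (ln (ln T)))\<^sup>2
     \<longrightarrow> \<bar>\<theta>\<bar> \<le> pi
     \<longrightarrow> (\<exists>S. S \<in> sets lebesgue \<and> S \<subseteq> {1..T}
           \<and> emeasure lebesgue S \<ge> ennreal (T powr (1 - 2 / ln x))
           \<and> (\<forall>t\<in>S. \<exists>E::complex.
                 cmod E \<le> C * (1 / ln x + ln x * (ln (ln (ln T)))\<^sup>2 / (ln (ln T))\<^sup>2)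
               \<and> (\<Sum>n\<in>{1..nat \<lfloor>x\<rfloor>}. (of_nat n :: complex) powr (\<i> * of_real t))
                 = of_real x * exp (\<i> * of_real \<theta>)
                   * of_real (dickman_rho (ln x / ln (ln T))) * (1 + E)))"
proof -
  obtain K where K: "\<And>J L x. L \<ge> real J + K \<Longrightarrow> x \<ge> 1 \<Longrightarrow> 2 * ln (2 * (ln x / L + 1)) \<le> L / 4 \<Longrightarrow>
       Psi (nat \<lfloor>exp (real J)\<rfloor>) x \<le> x * dickman_rho (ln x / L)"
    using Psi_upper by metis
  obtain Z where Z0: "Z \<ge> 0" and Z: "\<And>x L k. x \<ge> 1 \<Longrightarrow> L > 0 \<Longrightarrow> 2 * ln (2 * (ln x / L + 1)) \<le> L / 4 \<Longrightarrow>
      (\<And>z. 1 \<le> z \<Longrightarrow> z \<le> x \<Longrightarrow> Psi k z \<le> z * dickman_rho (ln z / L)) \<Longrightarrow>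
      (\<Sum>b=k+1..nat \<lfloor>x\<rfloor>. (Psi k (x / b))\<^sup>2) \<le> (x * dickman_rho (ln x / L))\<^sup>2 * (Z * (real k + 1) powr (-(1/4)))"
    using rough_sum_le by metis
  obtain L0 where L0: "\<And>L. L \<ge> L0 \<Longrightarrow> large_param K Z L"
    using eventually_large_param[of K Z] unfolding eventually_at_top_linorder by blast
  show ?thesis
  \<comment> \<open>192 is the constant of \<open>rho_perturb\<close>, which dominates the other
    losses; \<open>exp (exp L0)\<close> turns the threshold for L into one for T.\<close>
  proof (rule exI[of _ 192], rule exI[of _ "exp (exp L0)"], intro allI impI)
    fix T x \<theta> :: real
    assume T: "T \<ge> exp (exp L0)" and x: "x > 1" and lx: "ln x \<le> (ln (ln T))\<^sup>2 / (ln (ln (ln T)))\<^sup>2"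
      and \<theta>: "\<bar>\<theta>\<bar> \<le> pi"
    define L where "L = ln (ln T)"
    define r where "r = dickman_rho (ln x / L)"
    define d where "d = 1 / ln x + ln x * (ln L)\<^sup>2 / L\<^sup>2"
    have T0: "T > 0" using T exp_gt_zero[of "exp L0"] by linarith
    have lnT: "ln T \<ge> exp L0" using T T0 by (simp add: ln_ge_iff)
    hence lnT0: "ln T > 0" using exp_gt_zero[of L0] by linarith
    have "L \<ge> L0" unfolding L_def using lnT lnT0 by (simp add: ln_ge_iff)
    hence P: "large_param K Z L" by (rule L0)
    have TL: "T = exp (exp L)" unfolding L_def using T0 lnT0 by simp
    have L52: "L \<ge> 52" using P by (simp add: large_param_def)
    have l0: "ln x > 0" using x by simp
    have r0: "r > 0" unfolding r_def using l0 L52 by (intro rho_pos) auto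
    have "\<exists>S. S \<in> sets lebesgue \<and> S \<subseteq> {1..T} \<and> emeasure lebesgue S \<ge> ennreal (T powr (1 - 2 / ln x))
           \<and> (\<forall>t\<in>S. cmod ((\<Sum>n=1..nat \<lfloor>x\<rfloor>. chi n t) - of_real (x * r) * cis \<theta>) \<le> 192 * d * (x * r))"
    proof (cases "ln x \<ge> 2")
      case True
      show ?thesis unfolding r_def d_def
        by (rule exponential_sum_large_x[OF K Z Z0 P TL x True _ \<theta>]) (use lx in \<open>auto simp: L_def\<close>)
    next
      case False
      have r1: "r = 1" unfolding r_def using l0 L52 False by (intro rho_le_1) auto
      have T2: "T \<ge> 2" using TL exp_ge_add_one_self[of "exp L"] exp_ge_add_one_self[of L] L52 by linarith
      have "192 * (1 / ln x) * x \<le> 192 * d * x" unfolding d_def using l0 x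
        by (intro mult_right_mono mult_left_mono) auto
      thus ?thesis using exponential_sum_small_x[OF T2 x, of \<theta>] False
        unfolding r1 by (intro exI[of _ "{1..T}"]) (auto intro: order_trans)
    qed
    then obtain S where S: "S \<in> sets lebesgue" "S \<subseteq> {1..T}" "emeasure lebesgue S \<ge> ennreal (T powr (1 - 2 / ln x))"
      "\<And>t. t \<in> S \<Longrightarrow> cmod ((\<Sum>n=1..nat \<lfloor>x\<rfloor>. chi n t) - of_real (x * r) * cis \<theta>) \<le> 192 * d * (x * r)"
      by blast
    have "\<exists>E. cmod E \<le> 192 * d \<and> (\<Sum>n\<in>{1..nat \<lfloor>x\<rfloor>}. (of_nat n :: complex) powr (\<i> * of_real t))
        = of_real x * exp (\<i> * of_real \<theta>) * of_real r * (1 + E)" if t: "t \<in> S" for t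
    proof (intro exI conjI)
      define A where "A = (\<Sum>n=1..nat \<lfloor>x\<rfloor>. chi n t)"
      define W where "W = of_real (x * r) * cis \<theta>"
      have W: "cmod W = x * r" "W \<noteq> 0" using x r0 by (auto simp: W_def norm_mult)
      have "cmod (A - W) \<le> 192 * d * (x * r)" using S(4)[OF t] unfolding A_def W_def .
      thus "cmod ((A - W) / W) \<le> 192 * d"
        using x r0 W by (simp add: norm_divide pos_divide_le_eq)
      have "(\<Sum>n\<in>{1..nat \<lfloor>x\<rfloor>}. (of_nat n :: complex) powr (\<i> * of_real t)) = A"
        unfolding A_def by (intro sum.cong) (auto simp: powr_eq_chi)
      also have "A = W * (1 + (A - W) / W)" using W by (simp add: field_simps)
      finally show "(\<Sum>n\<in>{1..nat \<lfloor>x\<rfloor>}. (of_nat n :: complex) powr (\<i> * of_real t))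
        = of_real x * exp (\<i> * of_real \<theta>) * of_real r * (1 + (A - W) / W)"
        by (simp add: W_def cis_conv_exp mult_ac)
    qed
    thus "\<exists>S. S \<in> sets lebesgue \<and> S \<subseteq> {1..T}
           \<and> emeasure lebesgue S \<ge> ennreal (T powr (1 - 2 / ln x))
           \<and> (\<forall>t\<in>S. \<exists>E::complex.
                 cmod E \<le> 192 * (1 / ln x + ln x * (ln (ln (ln T)))\<^sup>2 / (ln (ln T))\<^sup>2)
               \<and> (\<Sum>n\<in>{1..nat \<lfloor>x\<rfloor>}. (of_nat n :: complex) powr (\<i> * of_real t))
                 = of_real x * exp (\<i> * of_real \<theta>)
                   * of_real (dickman_rho (ln x / ln (ln T))) * (1 + E))"
      using S(1-3) unfolding d_def r_def L_def by blast
  qed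
qed

end
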